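(* Let $R=k[x_1,\ldots,x_d]$ be a polynomial ring over a field $k$ with $d\geq 2$, and let $I$ be a zero dimensional monomial ideal of $R$. Let $e_0,e_1,\ldots,e_d$ be the Hilbert coefficients of the Hilbert function $f(n)=\ell_R(R/\overline{I^n})$, and for each $i$ let $I_i$ be the ideal obtained from $I$ by making $x_i=0$, with multiplicity $e(I_i)$. Then $$e_0(d-1)-2e_1\geq e(I_1)+\cdots+e(I_{d-1})\geq d-1.$$
   Context: Zero dimensional means $\dim(R/I)=0$. $\overline{J}$ denotes the integral closure of an ideal $J$ in $R$. The function $f$ agrees for $n\gg 0$ with a polynomial of degree $d$, and the Hilbert coefficients $e_0,\ldots,e_d$ are defined by writing this polynomial as $$e_0\binom{n+d-1}{d}-e_1\binom{n+d-2}{d-1}+\cdots+(-1)^{d-1}e_{d-1}\binom{n}{1}+(-1)^de_d.$$ The ideal $I_i$ is the image of $I$ in the polynomial ring $R_i=k[x_j\mid j\neq i]$ in $d-1$ variables under the substitution $x_i\mapsto 0$; it is a zero dimensional monomial ideal of $R_i$, and its multiplicity $e(I_i)$ is $(d-1)!$ times the leading coefficient (in degree $d-1$) of the polynomial agreeing with $\ell_{R_i}(R_i/I_i^n)$ for $n\gg 0$. *)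

theory Defs
  imports
    Complex_Main
    "HOL-Algebra.Ideal_Product"
    "HOL-Algebra.QuotRing"
    "HOL-Algebra.Module"
    "HOL-Library.Poly_Mapping"
    "HOL-Library.Extended_Real"
    "HOL-Computational_Algebra.Polynomial"
begin

section \<open>Polynomial rings and monomial ideals\<close>

text \<open>An exponent vector is a finitely supported function from variable indices to exponents; a
  polynomial is a finitely supported function from exponent vectors to coefficients, multiplied by
  convolution. Fixing the set \<open>V\<close> of admissible variables through the carrier makes
  the polynomial rings in different sets of variables live in one type.\<close>

type_synonym 'k mpoly = "(nat \<Rightarrow>\<^sub>0 nat) \<Rightarrow>\<^sub>0 'k"

definition mpoly_ring :: "nat set \<Rightarrow> 'k::field mpoly ring" where
  "mpoly_ring V =
    \<lparr>carrier = {p. \<forall>m \<in> Poly_Mapping.keys p. Poly_Mapping.keys m \<subseteq> V},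
     monoid.mult = (*), one = 1, zero = 0, add = (+)\<rparr>"

definition monomial_ideal :: "nat set \<Rightarrow> 'k::field mpoly set \<Rightarrow> bool" where
  "monomial_ideal V I \<longleftrightarrow>
    (\<exists>S \<subseteq> {m. Poly_Mapping.keys m \<subseteq> V}.
      I = genideal (mpoly_ring V) ((\<lambda>m. Poly_Mapping.single m 1) ` S))"

definition mvar :: "nat \<Rightarrow> 'k::field mpoly" where
  "mvar i = Poly_Mapping.single (Poly_Mapping.single i 1) 1"

text \<open>The substitution \<open>x\<^sub>i \<mapsto> 0\<close>, fixing all other variables.\<close>

definition subst_zero :: "nat \<Rightarrow> 'k::field mpoly \<Rightarrow> 'k mpoly" where
  "subst_zero i p =
    (\<Sum>m \<in> Poly_Mapping.keys p.
       Poly_Mapping.single 0 (Poly_Mapping.lookup p m) *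
       (\<Prod>j \<in> Poly_Mapping.keys m. (if j = i then 0 else mvar j) ^ Poly_Mapping.lookup m j))"

lemma mpoly_ring_cring: "cring (mpoly_ring V :: 'k::field mpoly ring)"
proof -
  let ?R = "mpoly_ring V :: 'k mpoly ring"
  have add: "p + q \<in> carrier ?R" if "p \<in> carrier ?R" "q \<in> carrier ?R" for p q
    using that Poly_Mapping.keys_add[of p q] unfolding mpoly_ring_def by auto
  have mult: "p * q \<in> carrier ?R" if p: "p \<in> carrier ?R" and q: "q \<in> carrier ?R" for p q
  proof -
    have "Poly_Mapping.keys m \<subseteq> V" if "m \<in> Poly_Mapping.keys (p * q)" for m
    proof -
      from that Poly_Mapping.keys_mult[of p q] obtain a b where
        ab: "a \<in> Poly_Mapping.keys p" "b \<in> Poly_Mapping.keys q" "m = a + b" by blast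
      have "Poly_Mapping.keys a \<subseteq> V" "Poly_Mapping.keys b \<subseteq> V"
        using p q ab unfolding mpoly_ring_def by auto
      then show ?thesis
        using Poly_Mapping.keys_add[of a b] ab(3) by blast
    qed
    then show ?thesis unfolding mpoly_ring_def by simp
  qed
  have uminus: "- p \<in> carrier ?R" if "p \<in> carrier ?R" for p
    using that unfolding mpoly_ring_def by simp
  have ops: "x \<oplus>\<^bsub>?R\<^esub> y = x + y" "x \<otimes>\<^bsub>?R\<^esub> y = x * y" "\<zero>\<^bsub>?R\<^esub> = 0" "\<one>\<^bsub>?R\<^esub> = 1" for x y
    unfolding mpoly_ring_def by simp_all
  have idents: "0 \<in> carrier ?R" "1 \<in> carrier ?R"
    unfolding mpoly_ring_def by simp_all
  show ?thesis
  proof (rule cringI)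
    show "abelian_group ?R"
    proof (rule abelian_groupI, unfold ops)
      fix x assume "x \<in> carrier ?R"
      then show "\<exists>y\<in>carrier ?R. y + x = 0"
        using uminus[of x] by (intro bexI[of _ "- x"]) simp_all
    qed (simp_all add: add idents add.assoc add.commute)
    show "comm_monoid ?R"
      by (rule comm_monoidI, unfold ops) (simp_all add: mult idents mult.assoc mult.commute)
  qed (simp add: ops distrib_right)
qed


section \<open>Dimension, length, integral closure\<close>

text \<open>The zero ring has no prime ideals and hence dimension \<open>-\<infinity>\<close>, so that
  dimension \<open>0\<close> of a quotient by an ideal entails that the ideal is proper.\<close>

definition krull_dim :: "('a, 'b) ring_scheme \<Rightarrow> ereal" where
  "krull_dim A =
    (SUP n \<in> {n. \<exists>P. (\<forall>i\<le>n. primeideal (P i) A) \<and> (\<forall>i<n. P i \<subset> P (Suc i))}. ereal (real n))"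

definition module_length :: "('a, 'b) ring_scheme \<Rightarrow> ('a, 'c, 'd) module_scheme \<Rightarrow> enat" where
  "module_length A M =
    (SUP n \<in> {n. \<exists>N. (\<forall>i\<le>n. submodule (N i) A M) \<and> (\<forall>i<n. N i \<subset> N (Suc i))}. enat n)"

definition quot_module :: "('a, 'b) ring_scheme \<Rightarrow> 'a set \<Rightarrow> ('a, 'a set) module" where
  "quot_module A J =
    \<lparr>carrier = carrier (A Quot J), monoid.mult = monoid.mult (A Quot J), one = monoid.one (A Quot J),
     zero = ring.zero (A Quot J), add = ring.add (A Quot J),
     module.smult = (\<lambda>r X. (J +>\<^bsub>A\<^esub> r) \<otimes>\<^bsub>A Quot J\<^esub> X)\<rparr>"

abbreviation ideal_power :: "('a, 'b) ring_scheme \<Rightarrow> 'a set \<Rightarrow> nat \<Rightarrow> 'a set" where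
  "ideal_power A J n \<equiv> J [^]\<^bsub>ideals_set A\<^esub> n"

definition integral_closure :: "('a, 'b) ring_scheme \<Rightarrow> 'a set \<Rightarrow> 'a set" where
  "integral_closure A J =
    {r \<in> carrier A. \<exists>n\<ge>1. \<exists>a. (\<forall>i\<in>{1..n}. a i \<in> ideal_power A J i) \<and>
       r [^]\<^bsub>A\<^esub> n \<oplus>\<^bsub>A\<^esub> (\<Oplus>\<^bsub>A\<^esub>i\<in>{1..n}. a i \<otimes>\<^bsub>A\<^esub> r [^]\<^bsub>A\<^esub> (n - i)) = \<zero>\<^bsub>A\<^esub>}"


section \<open>Hilbert coefficients and multiplicity\<close>

definition eventual_poly :: "(nat \<Rightarrow> enat) \<Rightarrow> real poly" where
  "eventual_poly f =
    (THE p. \<forall>\<^sub>F n in sequentially. ereal_of_enat (f n) = ereal (poly p (real n)))"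

text \<open>The coefficients \<open>e\<^sub>0, \<dots>, e\<^sub>d\<close> in the normalised binomial expansion of the
  polynomial of degree \<open>d\<close> agreeing with \<open>f\<close>; indices beyond \<open>d\<close> are set to \<open>0\<close> to make
  the description unique.\<close>

definition hilbert_coeff :: "nat \<Rightarrow> (nat \<Rightarrow> enat) \<Rightarrow> nat \<Rightarrow> real" where
  "hilbert_coeff d f =
    (THE e. (\<forall>i>d. e i = 0) \<and>
       (\<forall>x::real. poly (eventual_poly f) x =
          (\<Sum>i\<le>d. (-1) ^ i * e i * ((x + real d - 1 - real i) gchoose (d - i)))))"

text \<open>The multiplicity of a zero-dimensional ideal \<open>J\<close> in a polynomial ring \<open>A\<close> in \<open>r\<close> variables.\<close>

definition ideal_multiplicity :: "nat \<Rightarrow> ('a, 'b) ring_scheme \<Rightarrow> 'a set \<Rightarrow> real" where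
  "ideal_multiplicity r A J =
    fact r * coeff (eventual_poly (\<lambda>n. module_length A (quot_module A (ideal_power A J n)))) r"

end

theory Submission
  imports Defs "Jordan_Normal_Form.Determinant"
begin

text \<open>Write \<open>D = d - 1\<close>, let \<open>U n\<close> be the set of the exponent vectors \<open>u\<close> with \<open>x\<^sup>u\<close> in the integral
  closure of \<open>I\<^sup>n\<close>, and let \<open>f n\<close> be the number of exponent vectors outside \<open>U n\<close>. This number is the
  length in question (\<open>integral_closure_mono_set\<close>, \<open>length_monomial_quotient\<close>), and for large \<open>n\<close> it is
  a polynomial \<open>c n\<^sup>d + c' n\<^sup>D + \<dots>\<close> in \<open>n\<close>. Expanding the binomial basis gives
  \<open>e\<^sub>0 (d - 1) - 2 e\<^sub>1 = 2 D! c'\<close> (\<open>hilbert_coeff_e0_e1\<close>). So the first inequality says that \<open>c'\<close> is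
  at least half the sum, over \<open>i < d\<close>, of the leading coefficients of the colengths of the powers of
  \<open>I\<^sub>i\<close>.

  The reason is the trapezoidal rule. The region below \<open>U n\<close> has, over each point of \<open>\<nat>\<^sup>D\<close>, a column
  in the direction of \<open>x\<^sub>d\<close>, and the column heights are essentially a convex function. For a convex
  function the trapezoidal sum overestimates the integral, here \<open>c n\<^sup>d\<close>; and the trapezoidal sum is the
  plain sum \<open>f n\<close> except that points with a vanishing coordinate count half. Hence \<open>f n\<close> exceeds
  \<open>c n\<^sup>d\<close> by at least half the number of points on the hyperplanes \<open>x\<^sub>i = 0\<close>, up to \<open>O(n\<^bsup>d-2\<^esup>)\<close>.

  Integrals are avoided as follows. Let \<open>h\<^sub>n\<close> be the column height, and reflect it to \<open>\<int>\<^sup>D\<close>: put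
  \<open>F n = \<Sum>q\<in>\<int>\<^sup>D. h\<^sub>n \<bar>q\<bar>\<close>. Every \<open>q\<close> is the sum of the componentwise halves \<open>q div 2\<close> and
  \<open>(q + 1) div 2\<close>, without cancellation of signs, so \<open>U n + U n \<subseteq> U (2n)\<close> bounds \<open>h\<^bsub>2n\<^esub> \<bar>q\<bar>\<close> by the sum
  of the values of \<open>h\<^sub>n\<close> at the two halves. On each of the \<open>2\<^sup>D\<close> parity classes both halving maps are
  injective, which gives \<open>F (2n) \<le> 2\<^sup>d F n\<close> (\<open>refl_count_double\<close>). Since \<open>F n\<close> differs from \<open>2\<^sup>D f n\<close>
  by \<open>O(n\<^sup>D)\<close>, iterating this yields \<open>F n \<ge> 2\<^sup>D c n\<^sup>d\<close>. On the other hand a point with \<open>z\<close> zeros among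
  its first \<open>D\<close> coordinates has \<open>2\<^bsup>D-z\<^esup>\<close> reflections, so \<open>F n\<close> is at most
  \<open>2\<^sup>D f n - 2\<^bsup>D-1\<^esup> \<Sum>i<d. g\<^sub>i n + O(n\<^bsup>d-2\<^esup>)\<close> where \<open>g\<^sub>i n\<close> counts the points with \<open>i\<close>-th coordinate
  \<open>0\<close> (\<open>refl_count_upper\<close>). Comparing coefficients of \<open>n\<^sup>D\<close> finishes the argument
  (\<open>second_coeff_of_doubling\<close>).

  The \<open>g\<^sub>i\<close> come from integral closures, whereas \<open>e(I\<^sub>i)\<close> is defined by ordinary powers. This is
  harmless, since the closure of \<open>I\<^bsup>n+r\<^esup>\<close> lies in \<open>I\<^sup>n\<close> when \<open>I\<close> has \<open>r\<close> monomial generators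
  (\<open>closure_exps_sub_power_exps_shift\<close>). That all colengths are eventually polynomial is a Hilbert
  theorem for sets of lattice points closed under translations
  (\<open>hilbert_polynomial_of_shift_module\<close>). Finally \<open>e(I\<^sub>i) \<ge> 1\<close>, because \<open>I\<^sub>i\<close> is contained in the
  maximal ideal of the origin and so the colength of \<open>I\<^sub>i\<^sup>n\<close> is at least the number of monomials of
  degree less than \<open>n\<close> (\<open>multiplicity_ge_1\<close>).\<close>

abbreviation lookup where "lookup \<equiv> Poly_Mapping.lookup"
abbreviation single where "single \<equiv> Poly_Mapping.single"
abbreviation keys where "keys \<equiv> Poly_Mapping.keys"

section \<open>Dickson's lemma\<close>

text \<open>Pass to a monotone subsequence for one coordinate after the other; a sequence of natural numbers has
  one, formed by the places where the minimum of the remaining tail is attained.\<close>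

lemma dickson_sequence:
  fixes s :: "nat \<Rightarrow> 'i \<Rightarrow> nat"
  assumes "finite J"
  shows "\<exists>g :: nat \<Rightarrow> nat. strict_mono g \<and> (\<forall>x\<in>J. \<forall>i j. i \<le> j \<longrightarrow> s (g i) x \<le> s (g j) x)"
  using assms
proof (induction J)
  case empty
  show ?case by (intro exI[of _ id]) (auto simp: strict_mono_def)
next
  case (insert y J)
  then obtain g :: "nat \<Rightarrow> nat" where g: "strict_mono g" "\<forall>x\<in>J. \<forall>i j. i \<le> j \<longrightarrow> s (g i) x \<le> s (g j) x"
    by (elim exE conjE)
  define t where "t = (\<lambda>n. s (g n) y)"
  \<comment> \<open>a place later than \<open>n\<close> at which the minimum over the places later than \<open>n\<close> is attained\<close>
  have step: "\<exists>m>n. \<forall>k\<ge>m. t m \<le> t k" for n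
  proof -
    have "\<exists>m. m > n \<and> (\<forall>k. k > n \<longrightarrow> t m \<le> t k)"
      using ex_has_least_nat[of "\<lambda>m. m > n" "Suc n" t] by blast
    then show ?thesis by (meson less_le_trans)
  qed
  define f where "f = rec_nat (SOME m. \<forall>k\<ge>m. t m \<le> t k) (\<lambda>_ n. SOME m. m > n \<and> (\<forall>k\<ge>m. t m \<le> t k))"
  have f0: "\<forall>k\<ge>f 0. t (f 0) \<le> t k"
    unfolding f_def by simp (rule someI_ex, use step in blast)
  have fS: "f (Suc n) > f n \<and> (\<forall>k\<ge>f (Suc n). t (f (Suc n)) \<le> t k)" for n
    unfolding f_def by simp (rule someI_ex, use step in blast)
  have sm: "strict_mono f" using fS by (simp add: strict_mono_Suc_iff)
  have fle: "\<forall>k\<ge>f n. t (f n) \<le> t k" for n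
    using f0 fS by (cases n) auto
  have tmono: "i \<le> j \<Longrightarrow> t (f i) \<le> t (f j)" for i j
    using fle sm by (simp add: strict_mono_less_eq)
  show ?case
  proof (intro exI[of _ "g \<circ> f"] conjI ballI allI impI)
    show "strict_mono (g \<circ> f)" using g(1) sm by (auto simp: strict_mono_def)
  next
    fix x and i j :: nat assume x: "x \<in> insert y J" and ij: "i \<le> j"
    show "s ((g \<circ> f) i) x \<le> s ((g \<circ> f) j) x"
    proof (cases "x = y")
      case True then show ?thesis using tmono[OF ij] by (simp add: t_def)
    next
      case False
      then show ?thesis using x g(2) ij sm by (simp add: strict_mono_less_eq)
    qed
  qed
qed

text \<open>Without a finite basis one could choose successively elements that dominate none of their
  predecessors, against the previous lemma.\<close>

lemma dickson_finite_basis: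
  fixes S :: "('i \<Rightarrow> nat) set"
  assumes "finite J"
  shows "\<exists>M\<subseteq>S. finite M \<and> (\<forall>s\<in>S. \<exists>m\<in>M. \<forall>x\<in>J. m x \<le> s x)"
proof (rule ccontr)
  assume neg: "\<not> ?thesis"
  define P where "P = (\<lambda>(f::nat \<Rightarrow> 'i \<Rightarrow> nat) n r. r \<in> S \<and> (\<forall>k<n. \<exists>x\<in>J. f k x > r x))"
  have "\<exists>f. \<forall>n. P f n (f n)"
  proof (rule dependent_wellorder_choice)
    show "P f n r = P g n r" if "\<And>y. y < n \<Longrightarrow> f y = g y" for f g n r
      using that by (simp add: P_def)
  next
    fix n and f :: "nat \<Rightarrow> 'i \<Rightarrow> nat"
    assume "\<And>y. y < n \<Longrightarrow> P f y (f y)"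
    then have "f ` {..<n} \<subseteq> S" by (auto simp: P_def)
    then have "\<not> (\<forall>s\<in>S. \<exists>m\<in>f ` {..<n}. \<forall>x\<in>J. m x \<le> s x)" using neg by blast
    then obtain s where "s \<in> S" "\<forall>k<n. \<exists>x\<in>J. f k x > s x" by (force simp: not_le)
    then show "\<exists>r. P f n r" by (auto simp: P_def)
  qed
  then obtain f where f: "\<And>n. P f n (f n)" by blast
  obtain g :: "nat \<Rightarrow> nat" where g: "strict_mono g" "\<forall>x\<in>J. \<forall>i j. i \<le> j \<longrightarrow> f (g i) x \<le> f (g j) x"
    using dickson_sequence[OF assms, of f] by (elim exE conjE)
  have "g 0 < g 1" using g(1) by (simp add: strict_mono_def)
  then obtain x where "x \<in> J" "f (g 0) x > f (g 1) x" using f[of "g 1"] by (auto simp: P_def)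
  then show False using g(2) by (meson leD le0)
qed


section \<open>Hilbert polynomials of translation-closed sets\<close>

text \<open>A graded module whose homogeneous pieces are spanned by lattice points, with each variable of degree
  one acting by translation, is a set of pairs (degree, point). The variable belonging to the
  translation vector \<open>a\<close> acts by \<open>shift a\<close>.\<close>

definition shift :: "'a::cancel_comm_monoid_add \<Rightarrow> nat \<times> 'a \<Rightarrow> nat \<times> 'a" where
  "shift a = (\<lambda>(n, x). (Suc n, x + a))"

text \<open>The submodule generated by \<open>G\<close> over the variables in \<open>A\<close>.\<close>

inductive_set gen :: "'a::cancel_comm_monoid_add set \<Rightarrow> (nat \<times> 'a) set \<Rightarrow> (nat \<times> 'a) set"
  for A G where
    base: "g \<in> G \<Longrightarrow> g \<in> gen A G"
  | step: "\<lbrakk>x \<in> gen A G; a \<in> A\<rbrakk> \<Longrightarrow> shift a x \<in> gen A G"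

lemma shift_commute: "shift a (shift b x) = shift b (shift a x)"
  by (auto simp: shift_def split: prod.splits simp: add_ac)

lemma sum_const_add: "(\<Sum>i<m + k. a) = (\<Sum>i<m. a) + (\<Sum>i<(k::nat). (a::'a::comm_monoid_add))"
  by (induction k) (auto simp: add_ac)

lemma gen_iff_sum:
  assumes "finite A"
  shows "(n, x) \<in> gen A G \<longleftrightarrow>
    (\<exists>k g c. (k, g) \<in> G \<and> n = k + (\<Sum>a\<in>A. c a) \<and> x = g + (\<Sum>a\<in>A. \<Sum>i<(c a::nat). a))"
proof
  assume "(n, x) \<in> gen A G"
  then show "\<exists>k g c. (k, g) \<in> G \<and> n = k + (\<Sum>a\<in>A. c a) \<and> x = g + (\<Sum>a\<in>A. \<Sum>i<(c a::nat). a)"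
  proof (induction "(n, x)" arbitrary: n x rule: gen.induct)
    case base
    then show ?case by (intro exI[of _ n] exI[of _ x] exI[of _ "\<lambda>_. 0"]) auto
  next
    case (step y a)
    obtain m z where y: "y = (m, z)" by (cases y)
    then obtain k g c where h: "(k, g) \<in> G" "m = k + (\<Sum>a\<in>A. c a)" "z = g + (\<Sum>a\<in>A. \<Sum>i<(c a::nat). a)"
      using step.hyps(2) by blast
    define c' where "c' = c(a := Suc (c a))"
    have "(\<Sum>b\<in>A. c' b) = Suc (\<Sum>b\<in>A. c b)"
      using step.hyps assms by (simp add: c'_def sum.remove[of A a])
    moreover have "(\<Sum>b\<in>A. \<Sum>i<(c' b::nat). b) = (\<Sum>b\<in>A. \<Sum>i<(c b::nat). b) + a"
      using step.hyps assms by (simp add: c'_def sum.remove[of A a] add_ac)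
    ultimately show ?case using h step.hyps(4) y
      by (intro exI[of _ k] exI[of _ g] exI[of _ c']) (auto simp: shift_def add_ac)
  qed
next
  assume "\<exists>k g c. (k, g) \<in> G \<and> n = k + (\<Sum>a\<in>A. c a) \<and> x = g + (\<Sum>a\<in>A. \<Sum>i<(c a::nat). a)"
  then obtain k g c where h: "(k, g) \<in> G" "n = k + (\<Sum>a\<in>A. c a)" "x = g + (\<Sum>a\<in>A. \<Sum>i<(c a::nat). a)"
    by blast
  have one: "(k + m, y + (\<Sum>i<m. a)) \<in> gen A G" if "(k, y) \<in> gen A G" "a \<in> A" for k y m a
    using that by (induction m) (auto dest: gen.step simp: shift_def add_ac)
  have "(k + (\<Sum>a\<in>B. c a), g + (\<Sum>a\<in>B. \<Sum>i<(c a::nat). a)) \<in> gen A G" if "B \<subseteq> A" for B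
    using finite_subset[OF that assms] that
  proof (induction B)
    case empty then show ?case using h by (auto intro: gen.base)
  next
    case (insert b B)
    then show ?case using one[of "k + (\<Sum>a\<in>B. c a)" "g + (\<Sum>a\<in>B. \<Sum>i<(c a::nat). a)" b "c b"]
      by (simp add: add_ac)
  qed
  then show "(n, x) \<in> gen A G" using h by simp
qed

text \<open>The combinatorial form of the Hilbert basis theorem: Dickson's lemma is applied, for each generator, to the exponents of the monomials that carry it into \<open>Y\<close>.\<close>

lemma gen_noetherian:
  assumes "finite A" "finite G" "Y \<subseteq> gen A G"
  shows "\<exists>H\<subseteq>Y. finite H \<and> Y \<subseteq> gen A H"
proof -
  define e where "e = (\<lambda>(k, g) c. (k + (\<Sum>a\<in>A. c a), g + (\<Sum>a\<in>A. \<Sum>i<(c a::nat). a)))"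
  define S where "S = (\<lambda>p. {c. e p c \<in> Y})"
  have "\<exists>M\<subseteq>S p. finite M \<and> (\<forall>s\<in>S p. \<exists>m\<in>M. \<forall>x\<in>A. m x \<le> s x)" for p
    by (rule dickson_finite_basis[OF assms(1)])
  then obtain M where M: "\<And>p. M p \<subseteq> S p" "\<And>p. finite (M p)"
    "\<And>p s. s \<in> S p \<Longrightarrow> \<exists>m\<in>M p. \<forall>x\<in>A. m x \<le> s x" by metis
  define H where "H = (\<Union>p\<in>G. e p ` M p)"
  have "H \<subseteq> Y" using M(1) unfolding H_def S_def by blast
  moreover have "finite H" using M(2) assms(2) by (auto simp: H_def)
  moreover have "Y \<subseteq> gen A H"
  proof
    fix y assume y: "y \<in> Y"
    obtain n x where nx: "y = (n, x)" by (cases y)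
    then obtain k g c where h: "(k, g) \<in> G" "n = k + (\<Sum>a\<in>A. c a)" "x = g + (\<Sum>a\<in>A. \<Sum>i<(c a::nat). a)"
      using y assms gen_iff_sum[OF assms(1), of n x G] by blast
    then have "e (k, g) c = y" using nx by (simp add: e_def)
    then have "c \<in> S (k, g)" using y by (simp add: S_def)
    then obtain m where m: "m \<in> M (k, g)" "\<forall>x\<in>A. m x \<le> c x" using M(3) by blast
    have 1: "(\<Sum>a\<in>A. c a) = (\<Sum>a\<in>A. m a) + (\<Sum>a\<in>A. c a - m a)"
      using m(2) by (simp flip: sum.distrib)
    have "(\<Sum>i<c a. a) = (\<Sum>i<m a. a) + (\<Sum>i<c a - m a. a)" if "a \<in> A" for a
      using that m(2) sum_const_add[of a "m a" "c a - m a"] by simp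
    then have 2: "(\<Sum>a\<in>A. \<Sum>i<c a. a) = (\<Sum>a\<in>A. \<Sum>i<m a. a) + (\<Sum>a\<in>A. \<Sum>i<c a - m a. a)"
      by (simp flip: sum.distrib)
    show "y \<in> gen A H" unfolding nx gen_iff_sum[OF assms(1)]
      by (rule exI[of _ "fst (e (k, g) m)"], rule exI[of _ "snd (e (k, g) m)"], rule exI[of _ "\<lambda>a. c a - m a"])
        (use h m 1 2 in \<open>auto simp: H_def e_def add_ac intro!: bexI[of _ "(k, g)"]\<close>)
  qed
  ultimately show ?thesis by blast
qed

lemma finite_gen_level:
  assumes "finite A" "finite G"
  shows "finite {x. (n, x) \<in> gen A G}"
proof (induction n)
  case 0
  have "{x. (0, x) \<in> gen A G} \<subseteq> snd ` G"
    proof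
    fix x assume "x \<in> {x. (0, x) \<in> gen A G}"
    then have "(0, x) \<in> gen A G" by simp
    then show "x \<in> snd ` G" by (cases rule: gen.cases) (force simp: shift_def split: prod.splits)+
  qed
  then show ?case using assms finite_subset by blast
next
  case (Suc n)
  have "{x. (Suc n, x) \<in> gen A G} \<subseteq> snd ` G \<union> (\<Union>a\<in>A. (\<lambda>x. x + a) ` {x. (n, x) \<in> gen A G})"
  proof
    fix x assume "x \<in> {x. (Suc n, x) \<in> gen A G}"
    then have "(Suc n, x) \<in> gen A G" by simp
    then show "x \<in> snd ` G \<union> (\<Union>a\<in>A. (\<lambda>x. x + a) ` {x. (n, x) \<in> gen A G})"
      by (cases rule: gen.cases) (force simp: shift_def split: prod.splits)+
  qed
  then show ?case using assms Suc by (meson finite_UN_I finite_UnI finite_imageI finite_subset)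
qed

text \<open>Translations commute, so an element whose construction uses the variable \<open>a\<close> at all could have used it
  first.\<close>

lemma gen_insert:
  assumes "x \<in> gen (insert a A) H"
  shows "x \<in> gen A H \<or> x \<in> gen (insert a A) (shift a ` H)"
  using assms
proof (induction rule: gen.induct)
  case (base g)
  then show ?case by (auto intro: gen.base)
next
  case (step x b)
  show ?case
  proof (cases "b = a")
    case True
    have "shift a y \<in> gen (insert a A) (shift a ` H)" if "y \<in> gen (insert a A) H" for y
      using that
    proof (induction rule: gen.induct)
      case (base g) then show ?case by (auto intro: gen.base)
    next
      case (step x c)
      then show ?case by (metis gen.step shift_commute)
    qed
    then show ?thesis using step True by blast
  next
    case False
    then show ?thesis using step by (auto intro: gen.step)
  qed
qed

lemma gen_subset_closed:
  assumes "G \<subseteq> Z" "\<And>x a. x \<in> Z \<Longrightarrow> a \<in> A \<Longrightarrow> shift a x \<in> Z"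
  shows "gen A G \<subseteq> Z"
proof
  fix x assume "x \<in> gen A G"
  then show "x \<in> Z" by induction (use assms in auto)
qed

text \<open>Expand \<open>(x + 1)\<^bsup>n+1\<^esup> - x\<^bsup>n+1\<^esup>\<close> and subtract antidifferences of the lower powers.\<close>

lemma antidifference_power: "\<exists>q::real poly. \<forall>x. poly q (x + 1) - poly q x = x ^ n"
proof (induction n rule: less_induct)
  case (less n)
  then obtain Q where Q: "\<And>k x. k < n \<Longrightarrow> poly (Q k) (x + 1) - poly (Q k) x = (x::real) ^ k" by metis
  define q where "q = smult (1 / real (Suc n)) (monom 1 (Suc n) - (\<Sum>k<n. smult (real (Suc n choose k)) (Q k)))"
  have "poly q (x + 1) - poly q x = x ^ n" for x
  proof -
    have "(x + 1) ^ Suc n = (\<Sum>k\<le>Suc n. real (Suc n choose k) * x ^ k)"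
      by (subst binomial_ring) simp
    also have "\<dots> = x ^ Suc n + real (Suc n) * x ^ n + (\<Sum>k<n. real (Suc n choose k) * x ^ k)"
      by (simp add: lessThan_Suc_atMost [symmetric] del: binomial_Suc_Suc)
    finally have e: "(x + 1) ^ Suc n - x ^ Suc n - (\<Sum>k<n. real (Suc n choose k) * x ^ k) = real (Suc n) * x ^ n"
      by simp
    have "poly q (x + 1) - poly q x = 1 / real (Suc n) *
      ((x + 1) ^ Suc n - x ^ Suc n - (\<Sum>k<n. real (Suc n choose k) * (poly (Q k) (x + 1) - poly (Q k) x)))"
      unfolding q_def by (simp add: poly_monom poly_sum right_diff_distrib sum_subtractf del: power_Suc of_nat_Suc binomial_Suc_Suc)
    also have "\<dots> = 1 / real (Suc n) * (real (Suc n) * x ^ n)"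
      using e Q by simp
    finally show ?thesis by simp
  qed
  then show ?case by blast
qed

lemma poly_antidifference: "\<exists>q::real poly. \<forall>x. poly q (x + 1) - poly q x = poly p x"
proof -
  obtain Q where Q: "\<And>k x. poly (Q k) (x + 1) - poly (Q k) x = (x::real) ^ k"
    using antidifference_power by metis
  define q where "q = (\<Sum>k\<le>degree p. smult (coeff p k) (Q k))"
  have "poly q (x + 1) - poly q x = poly p x" for x
    unfolding q_def poly_altdef[of p] by (simp add: poly_sum Q flip: sum_subtractf right_diff_distrib)
  then show ?thesis by blast
qed

lemma eventually_poly_of_difference:
  fixes f :: "nat \<Rightarrow> real"
  assumes "\<forall>\<^sub>F n in sequentially. f (Suc n) - f n = poly p (real n)"
  shows "\<exists>q. \<forall>\<^sub>F n in sequentially. f n = poly q (real n)"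
proof -
  obtain q where q: "\<And>x. poly q (x + 1) - poly q x = poly p x" using poly_antidifference by blast
  obtain N where N: "\<And>n. n \<ge> N \<Longrightarrow> f (Suc n) - f n = poly p (real n)"
    using assms by (auto simp: eventually_sequentially)
  define c where "c = f N - poly q (real N)"
  have "f n = poly (q + [:c:]) (real n)" if "n \<ge> N" for n
    using that
  proof (induction n rule: dec_induct)
    case base then show ?case by (simp add: c_def)
  next
    case (step n)
    have "f (Suc n) = f n + poly p (real n)" using N[of n] step by simp
    then show ?case using step q[of "real n"] by (simp add: add_ac)
  qed
  then show ?thesis unfolding eventually_sequentially by blast
qed

text \<open>The set \<open>U - W\<close> plays the role of the module \<open>U / W\<close>. As in the classical proof of Hilbert's
  theorem, induct on the number of variables: multiplication by one variable \<open>a\<close> on \<open>U / W\<close> has a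
  kernel and a cokernel on which \<open>a\<close> acts as zero, so these are finitely generated over the remaining
  variables, and they account for the difference of the counts in consecutive degrees. Translations
  being injective, no two points are identified by the multiplication except by falling into \<open>W\<close>.\<close>

theorem hilbert_polynomial_of_shift_module:
  fixes U W :: "(nat \<times> 'a::cancel_comm_monoid_add) set"
  assumes "finite A" and "finite G" and "U - W \<subseteq> gen A G"
    and "\<And>x a. x \<in> U \<Longrightarrow> a \<in> A \<Longrightarrow> shift a x \<in> U"
    and "\<And>x a. x \<in> W \<Longrightarrow> a \<in> A \<Longrightarrow> shift a x \<in> W"
  shows "\<exists>p. \<forall>\<^sub>F n in sequentially. real (card {x. (n, x) \<in> U - W}) = poly p (real n)"
  using assms
proof (induction A arbitrary: U W G)
  case empty
  have sub: "U - W \<subseteq> G" using empty.prems(2) by (auto elim: gen.cases)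
  have "\<forall>\<^sub>F n in sequentially. n > Max (insert 0 (fst ` G))" by (rule eventually_gt_at_top)
  then have "\<forall>\<^sub>F n in sequentially. real (card {x. (n, x) \<in> U - W}) = poly 0 (real n)"
  proof eventually_elim
    case (elim n)
    have "(n, x) \<notin> U - W" for x
    proof
      assume "(n, x) \<in> U - W"
      then have "n \<in> fst ` G" using sub by force
      then have "n \<le> Max (insert 0 (fst ` G))" using empty.prems(1) by (intro Max_ge) auto
      then show False using elim by simp
    qed
    then have "{x. (n, x) \<in> U - W} = {}" by blast
    then show ?case by (simp only: card.empty) simp
  qed
  then show ?case by blast
next
  case (insert a A U W G)
  note closU = insert.prems(3) and closW = insert.prems(4)
  define K where "K = {x \<in> U. shift a x \<in> W}"
  define C where "C = W \<union> shift a ` U"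
  have closK: "shift b x \<in> K" if "x \<in> K" "b \<in> insert a A" for x b
    using that closU closW shift_commute[of a b x] by (auto simp: K_def)
  have closC: "shift b x \<in> C" if xC: "x \<in> C" and "b \<in> insert a A" for x b
  proof (cases "x \<in> W")
    case True
    then show ?thesis using closW that by (simp add: C_def)
  next
    case False
    then obtain y where "y \<in> U" "x = shift a y" using xC by (auto simp: C_def)
    then show ?thesis using closU[of y b] that shift_commute[of b a y] by (simp add: C_def)
  qed
  have fin: "finite (insert a A)" using insert.hyps by simp
  \<comment> \<open>A subquotient on which \<open>a\<close> acts as zero is finitely generated without \<open>a\<close>.\<close>
  have key: "\<exists>H. finite H \<and> Y \<subseteq> gen A H"
    if Y: "Y \<subseteq> U - W" and Z: "shift a ` Y \<subseteq> Z" "Y \<inter> Z = {}"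
      and clos: "\<And>x b. x \<in> Z \<Longrightarrow> b \<in> insert a A \<Longrightarrow> shift b x \<in> Z" for Y Z
  proof -
    obtain H where H: "H \<subseteq> Y" "finite H" "Y \<subseteq> gen (insert a A) H"
      using gen_noetherian[OF fin insert.prems(1), of Y] Y insert.prems(2) by blast
    have "gen (insert a A) (shift a ` H) \<subseteq> Z"
      by (rule gen_subset_closed) (use H Z clos in auto)
    then have "Y \<subseteq> gen A H" using H(3) Z(2) gen_insert by fast
    then show ?thesis using H(2) by blast
  qed
  obtain H1 where H1: "finite H1" "K - W \<subseteq> gen A H1"
    using key[of "K - W" W] closW by (auto simp: K_def)
  obtain H2 where H2: "finite H2" "U - C \<subseteq> gen A H2"
    using key[of "U - C" C] closC by (auto simp: C_def)
  obtain p1 where p1: "\<forall>\<^sub>F n in sequentially. real (card {x. (n, x) \<in> K - W}) = poly p1 (real n)"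
    using insert.IH[OF H1] closK closW by blast
  obtain p2 where p2: "\<forall>\<^sub>F n in sequentially. real (card {x. (n, x) \<in> U - C}) = poly p2 (real n)"
    using insert.IH[OF H2] closU closC by blast
  have finX: "finite {x. (n, x) \<in> U - W}" for n
    by (rule finite_subset[OF _ finite_gen_level[OF fin insert.prems(1), of n]]) (use insert.prems(2) in auto)
  have count: "card {x. (Suc n, x) \<in> U - W} + card {x. (n, x) \<in> K - W}
      = card {x. (Suc n, x) \<in> U - C} + card {x. (n, x) \<in> U - W}" for n
  proof -
    let ?Y = "{x. (n, x) \<in> U - K}"
    have 1: "{x. (n, x) \<in> U - W} = {x. (n, x) \<in> K - W} \<union> ?Y" "{x. (n, x) \<in> K - W} \<inter> ?Y = {}"
      using closW[of _ a] by (auto simp: K_def)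
    have c1: "card {x. (n, x) \<in> U - W} = card {x. (n, x) \<in> K - W} + card ?Y"
      using finX[of n] unfolding 1(1) by (intro card_Un_disjoint) (use 1(2) in auto)
    have 2: "{x. (Suc n, x) \<in> U - W} = {x. (Suc n, x) \<in> U - C} \<union> (\<lambda>x. x + a) ` ?Y"
      using closU[of _ a] by (force simp: K_def C_def shift_def)
    have 3: "{x. (Suc n, x) \<in> U - C} \<inter> (\<lambda>x. x + a) ` ?Y = {}"
      by (force simp: C_def shift_def)
    have "card {x. (Suc n, x) \<in> U - W} = card {x. (Suc n, x) \<in> U - C} + card ((\<lambda>x. x + a) ` ?Y)"
      using finX[of "Suc n"] unfolding 2 by (intro card_Un_disjoint) (use 3 in auto)
    also have "card ((\<lambda>x. x + a) ` ?Y) = card ?Y" by (intro card_image) (auto simp: inj_on_def)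
    finally show ?thesis using c1 by simp
  qed
  have "\<forall>\<^sub>F n in sequentially. real (card {x. (Suc n, x) \<in> U - W}) - real (card {x. (n, x) \<in> U - W})
      = poly (pcompose p2 [:1, 1:] - p1) (real n)"
    using p1 iffD2[OF eventually_sequentially_Suc p2]
  proof eventually_elim
    case (elim n)
    then show ?case using arg_cong[OF count[of n], of real] by (simp add: poly_pcompose)
  qed
  then show ?case by (rule eventually_poly_of_difference)
qed

section \<open>Exponents of powers and of their integral closures\<close>

definition exps :: "nat set \<Rightarrow> (nat \<Rightarrow>\<^sub>0 nat) set" where
  "exps V = {m. keys m \<subseteq> V}"

definition scale :: "nat \<Rightarrow> (nat \<Rightarrow>\<^sub>0 nat) \<Rightarrow> (nat \<Rightarrow>\<^sub>0 nat)" where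
  "scale k m = Poly_Mapping.map ((*) k) m"

primrec power_exps :: "nat set \<Rightarrow> (nat \<Rightarrow>\<^sub>0 nat) set \<Rightarrow> nat \<Rightarrow> (nat \<Rightarrow>\<^sub>0 nat) set" where
  "power_exps V E 0 = exps V"
| "power_exps V E (Suc n) = {u + a | u a. u \<in> power_exps V E n \<and> a \<in> E}"

text \<open>A monomial is integral over the \<open>n\<close>-th power of a monomial ideal if and only if, for some \<open>m > 0\<close>, its
  \<open>m\<close>-th power lies in the \<open>mn\<close>-th power of the ideal. Geometrically these are the lattice points of \<open>n\<close>
  times the Newton polyhedron; the present form avoids real convex combinations.\<close>

definition closure_exps :: "nat set \<Rightarrow> (nat \<Rightarrow>\<^sub>0 nat) set \<Rightarrow> nat \<Rightarrow> (nat \<Rightarrow>\<^sub>0 nat) set" where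
  "closure_exps V E n = {u \<in> exps V. \<exists>m\<ge>1. scale m u \<in> power_exps V E (m * n)}"

definition box :: "nat set \<Rightarrow> nat \<Rightarrow> (nat \<Rightarrow>\<^sub>0 nat) set" where
  "box A N = {u \<in> exps A. \<forall>i\<in>A. lookup u i < N}"

lemma lookup_scale [simp]: "lookup (scale k m) i = k * lookup m i"
  by (simp add: scale_def Poly_Mapping.map.rep_eq when_def)

lemma exps_iff: "m \<in> exps V \<longleftrightarrow> (\<forall>i. i \<notin> V \<longrightarrow> lookup m i = 0)"
  by (auto simp: exps_def in_keys_iff)

lemma scale_Suc: "scale (Suc k) u = scale k u + u"
  by (rule poly_mapping_eqI) (simp add: lookup_add)

lemma scale_0 [simp]: "scale 0 u = 0" by (rule poly_mapping_eqI) simp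
lemma scale_1 [simp]: "scale 1 u = u" by (rule poly_mapping_eqI) simp
lemma scale_Suc_0 [simp]: "scale (Suc 0) u = u" by (rule poly_mapping_eqI) simp

lemma scale_add_left: "scale (j + k) u = scale j u + scale k u"
  by (rule poly_mapping_eqI) (simp add: lookup_add algebra_simps)

lemma scale_add_right: "scale k (u + v) = scale k u + scale k v"
  by (rule poly_mapping_eqI) (simp add: lookup_add algebra_simps)

lemma scale_scale: "scale j (scale k u) = scale (j * k) u"
  by (rule poly_mapping_eqI) (simp add: algebra_simps)

lemma exps_add: "u \<in> exps V \<Longrightarrow> v \<in> exps V \<Longrightarrow> u + v \<in> exps V"
  by (simp add: exps_iff lookup_add)

lemma exps_add_iff: "u + v \<in> exps V \<longleftrightarrow> u \<in> exps V \<and> v \<in> exps V"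
  by (auto simp: exps_iff lookup_add)

lemma exps_scale: "u \<in> exps V \<Longrightarrow> scale k u \<in> exps V"
  by (simp add: exps_iff)

lemma exps_zero [simp]: "0 \<in> exps V" by (simp add: exps_iff)

lemma exps_mono: "V \<subseteq> W \<Longrightarrow> exps V \<subseteq> exps W" by (auto simp: exps_def)

lemma exps_diffE:
  assumes "u \<in> exps V" "\<And>i. i \<in> V \<Longrightarrow> lookup a i \<le> lookup u i" "a \<in> exps V"
  obtains w where "w \<in> exps V" "u = w + a"
proof
  show "u - a \<in> exps V" using assms by (simp add: exps_iff lookup_minus)
  show "u = u - a + a"
  proof (rule poly_mapping_eqI)
    fix i show "lookup u i = lookup (u - a + a) i"
      using assms by (cases "i \<in> V") (auto simp: lookup_add lookup_minus exps_iff)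
  qed
qed

definition exp_vec :: "nat set \<Rightarrow> (nat \<Rightarrow> nat) \<Rightarrow> (nat \<Rightarrow>\<^sub>0 nat)" where
  "exp_vec A f = Abs_poly_mapping (\<lambda>i. if i \<in> A then f i else 0)"

lemma lookup_exp_vec:
  assumes "finite A"
  shows "lookup (exp_vec A f) i = (if i \<in> A then f i else 0)"
proof -
  have "finite {i. (if i \<in> A then f i else 0) \<noteq> (0::nat)}"
    by (rule finite_subset[OF _ assms]) auto
  then show ?thesis unfolding exp_vec_def by (subst lookup_Abs_poly_mapping) auto
qed

lemma card_box:
  assumes "finite A"
  shows "finite (box A N)" "card (box A N) = N ^ card A"
proof -
  have "bij_betw (\<lambda>u. restrict (lookup u) A) (box A N) (A \<rightarrow>\<^sub>E {..<N})"
  proof (rule bij_betwI[where g = "exp_vec A"])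
    show "(\<lambda>u. restrict (lookup u) A) \<in> box A N \<rightarrow> A \<rightarrow>\<^sub>E {..<N}"
      by (auto simp: box_def)
    show "exp_vec A \<in> (A \<rightarrow>\<^sub>E {..<N}) \<rightarrow> box A N"
      by (auto simp: box_def exps_iff lookup_exp_vec[OF assms])
    show "exp_vec A (restrict (lookup x) A) = x" if "x \<in> box A N" for x
      using that by (intro poly_mapping_eqI) (auto simp: lookup_exp_vec[OF assms] box_def exps_iff)
    show "restrict (lookup (exp_vec A y)) A = y" if "y \<in> A \<rightarrow>\<^sub>E {..<N}" for y
      using that by (auto simp: lookup_exp_vec[OF assms] fun_eq_iff PiE_def extensional_def)
  qed
  note b = this
  have "finite (A \<rightarrow>\<^sub>E {..<N})" using assms by (intro finite_PiE) auto
  then show "finite (box A N)" using b bij_betw_finite by blast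
  show "card (box A N) = N ^ card A"
    using bij_betw_same_card[OF b] assms by (simp add: card_PiE)
qed

text \<open>A filtration \<open>\<Phi>\<close> that is eventually generated over the translations by \<open>Ag\<close> has an associated graded
  module to which the Hilbert theorem applies, and the colength is the sum of its Hilbert function.\<close>

theorem eventually_poly_colength:
  assumes Ag: "finite Ag"
    and sub: "\<And>n. \<Phi> n \<subseteq> exps V"
    and dec: "\<And>n. \<Phi> (Suc n) \<subseteq> \<Phi> n"
    and mult: "\<And>n u a. u \<in> \<Phi> n \<Longrightarrow> a \<in> Ag \<Longrightarrow> u + a \<in> \<Phi> (Suc n)"
    and split: "\<And>n u. n \<ge> r \<Longrightarrow> u \<in> \<Phi> (Suc n) \<Longrightarrow> \<exists>w\<in>\<Phi> n. \<exists>a\<in>Ag. u = w + a"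
    and fin: "\<And>n. finite (exps V - \<Phi> n)"
  shows "\<exists>p. \<forall>\<^sub>F n in sequentially. real (card (exps V - \<Phi> n)) = poly p (real n)"
proof -
  define U where "U = {(n, u). u \<in> \<Phi> n}"
  define W where "W = {(n, u). u \<in> \<Phi> (Suc n)}"
  define G where "G = {(n, u). n \<le> r \<and> u \<in> \<Phi> n - \<Phi> (Suc n)}"
  have "G = (SIGMA n:{..r}. \<Phi> n - \<Phi> (Suc n))" by (auto simp: G_def)
  moreover have finX: "finite (\<Phi> n - \<Phi> (Suc n))" for n
    by (rule finite_subset[OF _ fin[of "Suc n"]]) (use sub in auto)
  ultimately have finG: "finite G" by simp
  have gen: "(n, u) \<in> gen Ag G" if "u \<in> \<Phi> n - \<Phi> (Suc n)" for n u
    using that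
  proof (induction n arbitrary: u)
    case 0
    then show ?case by (intro gen.base) (auto simp: G_def)
  next
    case (Suc n)
    show ?case
    proof (cases "Suc n \<le> r")
      case True
      then show ?thesis using Suc.prems by (intro gen.base) (auto simp: G_def)
    next
      case False
      then obtain w a where wa: "w \<in> \<Phi> n" "a \<in> Ag" "u = w + a"
        using split[of n u] Suc.prems by auto
      then have "w \<notin> \<Phi> (Suc n)" using mult[of w "Suc n" a] Suc.prems by auto
      then have "(n, w) \<in> gen Ag G" using Suc.IH wa by blast
      then have "shift a (n, w) \<in> gen Ag G" using wa(2) by (rule gen.step)
      then show ?thesis using wa by (simp add: shift_def)
    qed
  qed
  have sub': "U - W \<subseteq> gen Ag G" using gen by (auto simp: U_def W_def)
  have "\<exists>p. \<forall>\<^sub>F n in sequentially. real (card {x. (n, x) \<in> U - W}) = poly p (real n)"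
    by (rule hilbert_polynomial_of_shift_module[OF Ag finG sub']) (auto simp: U_def W_def shift_def mult)
  then obtain p where p: "\<forall>\<^sub>F n in sequentially. real (card {x. (n, x) \<in> U - W}) = poly p (real n)" ..
  have X: "{x. (n, x) \<in> U - W} = \<Phi> n - \<Phi> (Suc n)" for n by (auto simp: U_def W_def)
  have "card (exps V - \<Phi> (Suc n)) = card (exps V - \<Phi> n) + card (\<Phi> n - \<Phi> (Suc n))" for n
  proof -
    have "exps V - \<Phi> (Suc n) = (exps V - \<Phi> n) \<union> (\<Phi> n - \<Phi> (Suc n))" using sub dec by blast
    then show ?thesis using fin[of n] finX[of n] by (simp only:) (rule card_Un_disjoint, auto)
  qed
  then have "\<forall>\<^sub>F n in sequentially. real (card (exps V - \<Phi> (Suc n))) - real (card (exps V - \<Phi> n)) = poly p (real n)"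
    using p unfolding X by simp
  then show ?thesis by (rule eventually_poly_of_difference)
qed

lemma power_exps_face:
  assumes "E \<subseteq> exps V" "W \<subseteq> V"
  shows "power_exps W (E \<inter> exps W) n = power_exps V E n \<inter> exps W"
proof (induction n)
  case 0
  show ?case using exps_mono[OF assms(2)] by auto
next
  case (Suc n)
  have "u + a \<in> power_exps V E (Suc n) \<inter> exps W" if "u \<in> power_exps W (E \<inter> exps W) n" "a \<in> E \<inter> exps W" for u a
    using that unfolding Suc by (auto intro: exps_add)
  moreover have "u + a \<in> power_exps W (E \<inter> exps W) (Suc n)"
    if "u \<in> power_exps V E n" "a \<in> E" "u + a \<in> exps W" for u a
    using that unfolding power_exps.simps Suc exps_add_iff by blast
  ultimately show ?case by auto
qed

locale exponent_ideal =
  fixes V :: "nat set" and E :: "(nat \<Rightarrow>\<^sub>0 nat) set"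
  assumes finV: "finite V" and E_sub: "E \<subseteq> exps V"
    and E_up: "\<And>a b. a \<in> E \<Longrightarrow> b \<in> exps V \<Longrightarrow> a + b \<in> E"
begin

lemma power_exps_sub: "power_exps V E n \<subseteq> exps V"
  using E_sub by (induction n) (auto intro: exps_add)

lemma power_exps_SucI: "w \<in> power_exps V E n \<Longrightarrow> a \<in> E \<Longrightarrow> w + a \<in> power_exps V E (Suc n)"
  by auto

lemma power_exps_up: "u \<in> power_exps V E n \<Longrightarrow> b \<in> exps V \<Longrightarrow> u + b \<in> power_exps V E n"
proof (induction n arbitrary: u)
  case 0 then show ?case by (simp add: exps_add)
next
  case (Suc n)
  then obtain w a where "u = w + a" "w \<in> power_exps V E n" "a \<in> E" by auto
  then show ?case using Suc.IH[of w] Suc.prems(2) power_exps_SucI[of "w + b" n a] by (simp add: add_ac del: power_exps.simps)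
qed

lemma power_exps_add: "u \<in> power_exps V E m \<Longrightarrow> v \<in> power_exps V E n \<Longrightarrow> u + v \<in> power_exps V E (m + n)"
proof (induction n arbitrary: v)
  case 0 then show ?case by (simp add: power_exps_up)
next
  case (Suc n)
  then obtain w a where "v = w + a" "w \<in> power_exps V E n" "a \<in> E" by auto
  then show ?case using Suc.IH[of w] Suc.prems(1) power_exps_SucI[of "u + w" "m + n" a] by (simp add: add_ac del: power_exps.simps)
qed

lemma power_exps_scale: "u \<in> power_exps V E n \<Longrightarrow> scale k u \<in> power_exps V E (k * n)"
proof (induction k)
  case 0 then show ?case by simp
next
  case (Suc k)
  then show ?case using power_exps_add[of "scale k u" "k * n" u n] by (simp add: scale_Suc add_ac)
qed

lemma power_exps_dec: "power_exps V E (Suc n) \<subseteq> power_exps V E n"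
  using E_sub by (auto intro!: power_exps_up)

lemma power_exps_antimono: "m \<le> n \<Longrightarrow> power_exps V E n \<subseteq> power_exps V E m"
proof (induction n rule: dec_induct)
  case (step k)
  then show ?case using power_exps_dec[of k] by blast
qed simp

lemma power_exps_1: "power_exps V E 1 = E"
proof
  show "power_exps V E 1 \<subseteq> E" using E_up by (fastforce simp: add.commute)
  show "E \<subseteq> power_exps V E 1" using exps_zero[of V] by force
qed

lemma finite_generators:
  assumes "S \<subseteq> exps V"
  shows "\<exists>Ag\<subseteq>S. finite Ag \<and> (\<forall>u\<in>S. \<exists>w\<in>exps V. \<exists>a\<in>Ag. u = w + a)"
proof -
  obtain M where M: "M \<subseteq> lookup ` S" "finite M"
    "\<forall>s\<in>lookup ` S. \<exists>m\<in>M. \<forall>x\<in>V. m x \<le> s x"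
    using dickson_finite_basis[OF finV, of "lookup ` S"] by blast
  obtain Ag where Ag: "Ag \<subseteq> S" "finite Ag" "M = lookup ` Ag"
    using M(1,2) by (meson finite_subset_image)
  have "\<exists>w\<in>exps V. \<exists>a\<in>Ag. u = w + a" if u: "u \<in> S" for u
  proof -
    obtain a where a: "a \<in> Ag" "\<forall>x\<in>V. lookup a x \<le> lookup u x"
      using M(3) u Ag(3) by blast
    show ?thesis
      by (rule exps_diffE[of u V a]) (use a u Ag assms in auto)
  qed
  then show ?thesis using Ag by blast
qed

text \<open>An exponent of the \<open>n\<close>-th power is a sum of \<open>n\<close> generators, counted with multiplicity, plus an arbitrary
  vector. This form makes the multiplicities available for pigeonhole arguments.\<close>

lemma power_exps_iff:
  assumes "finite Ag" "Ag \<subseteq> E" "\<forall>u\<in>E. \<exists>w\<in>exps V. \<exists>a\<in>Ag. u = w + a"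
  shows "u \<in> power_exps V E n \<longleftrightarrow> (\<exists>c. \<exists>v\<in>exps V. (\<Sum>a\<in>Ag. c a) = n \<and> u = v + (\<Sum>a\<in>Ag. scale (c a) a))"
proof
  show "u \<in> power_exps V E n \<Longrightarrow> \<exists>c. \<exists>v\<in>exps V. (\<Sum>a\<in>Ag. c a) = n \<and> u = v + (\<Sum>a\<in>Ag. scale (c a) a)"
  proof (induction n arbitrary: u)
    case 0
    then show ?case by (intro exI[of _ "\<lambda>_. 0"]) auto
  next
    case (Suc n)
    then obtain w e where we: "u = w + e" "w \<in> power_exps V E n" "e \<in> E" by auto
    obtain b a where ba: "b \<in> exps V" "a \<in> Ag" "e = b + a" using assms(3) we by blast
    obtain c v where cv: "v \<in> exps V" "(\<Sum>a\<in>Ag. c a) = n" "w = v + (\<Sum>a\<in>Ag. scale (c a) a)"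
      using Suc.IH[OF we(2)] by blast
    define c' where "c' = c(a := Suc (c a))"
    have "(\<Sum>b\<in>Ag. c' b) = Suc n"
      using cv(2) ba(2) assms(1) by (simp add: c'_def sum.remove[of Ag a])
    moreover have "(\<Sum>b\<in>Ag. scale (c' b) b) = (\<Sum>b\<in>Ag. scale (c b) b) + a"
      using ba(2) assms(1) by (simp add: c'_def sum.remove[of Ag a] scale_Suc add_ac)
    ultimately show ?case using we ba cv
      by (intro exI[of _ c'] bexI[of _ "v + b"]) (auto simp: add_ac exps_add)
  qed
next
  assume "\<exists>c. \<exists>v\<in>exps V. (\<Sum>a\<in>Ag. c a) = n \<and> u = v + (\<Sum>a\<in>Ag. scale (c a) a)"
  then obtain c v where cv: "v \<in> exps V" "(\<Sum>a\<in>Ag. c a) = n" "u = v + (\<Sum>a\<in>Ag. scale (c a) a)" by blast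
  have "(\<Sum>a\<in>B. scale (c a) a) \<in> power_exps V E (\<Sum>a\<in>B. c a)" if "B \<subseteq> Ag" for B
    using finite_subset[OF that assms(1)] that
  proof (induction B)
    case empty then show ?case by simp
  next
    case (insert b B)
    have "b \<in> power_exps V E 1" using insert.prems assms(2) unfolding power_exps_1 by auto
    then have "scale (c b) b \<in> power_exps V E (c b)" using power_exps_scale[of b 1 "c b"] by simp
    then show ?case using insert power_exps_add by simp
  qed
  from this[of Ag] show "u \<in> power_exps V E n" using cv power_exps_up by (simp add: add.commute[of v])
qed

lemma closure_exps_sub: "closure_exps V E n \<subseteq> exps V" by (auto simp: closure_exps_def)

lemma power_exps_sub_closure_exps: "power_exps V E n \<subseteq> closure_exps V E n"
  using power_exps_sub by (auto simp: closure_exps_def intro!: exI[of _ 1])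

lemma closure_exps_add:
  assumes "u \<in> closure_exps V E m" "v \<in> closure_exps V E n"
  shows "u + v \<in> closure_exps V E (m + n)"
proof -
  obtain k where k: "k \<ge> 1" "scale k u \<in> power_exps V E (k * m)" using assms by (auto simp: closure_exps_def)
  obtain l where l: "l \<ge> 1" "scale l v \<in> power_exps V E (l * n)" using assms by (auto simp: closure_exps_def)
  have "scale l (scale k u) + scale k (scale l v) \<in> power_exps V E (l * (k * m) + k * (l * n))"
    using power_exps_add power_exps_scale k l by blast
  then have "scale (k * l) (u + v) \<in> power_exps V E ((k * l) * (m + n))"
    by (simp add: scale_scale scale_add_right algebra_simps)
  moreover have "u + v \<in> exps V" using assms exps_add by (auto simp: closure_exps_def)
  moreover have "k * l \<ge> 1" using k l by simp
  ultimately show ?thesis unfolding closure_exps_def by blast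
qed

lemma closure_exps_up: "u \<in> closure_exps V E n \<Longrightarrow> b \<in> exps V \<Longrightarrow> u + b \<in> closure_exps V E n"
  using closure_exps_add[of u n b 0] power_exps_sub_closure_exps[of 0] by auto

lemma closure_exps_dec: "closure_exps V E (Suc n) \<subseteq> closure_exps V E n"
proof
  fix u assume "u \<in> closure_exps V E (Suc n)"
  then obtain m where "m \<ge> 1" "scale m u \<in> power_exps V E (m * Suc n)" "u \<in> exps V" by (auto simp: closure_exps_def)
  moreover have "m * n \<le> m * Suc n" by simp
  ultimately show "u \<in> closure_exps V E n" using power_exps_antimono unfolding closure_exps_def by blast
qed

text \<open>If \<open>m u\<close> is a sum of \<open>m (n + 1)\<close> generators and \<open>n\<close> is at least the number of generators, then one
  generator \<open>a\<close> occurs at least \<open>m\<close> times. Then \<open>a \<le> u\<close>, and removing \<open>m\<close> copies of \<open>a\<close> shows that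
  \<open>u - a\<close> belongs to the closure one step below.\<close>

lemma closure_exps_split:
  assumes Ag: "finite Ag" "Ag \<subseteq> E" "\<forall>u\<in>E. \<exists>w\<in>exps V. \<exists>a\<in>Ag. u = w + a"
    and n: "card Ag \<le> n" and u: "u \<in> closure_exps V E (Suc n)"
  shows "\<exists>w\<in>closure_exps V E n. \<exists>a\<in>Ag. u = w + a"
proof -
  obtain m where m: "m \<ge> 1" "scale m u \<in> power_exps V E (m * Suc n)" using u by (auto simp: closure_exps_def)
  obtain c v where cv: "v \<in> exps V" "(\<Sum>a\<in>Ag. c a) = m * Suc n" "scale m u = v + (\<Sum>a\<in>Ag. scale (c a) a)"
    using m(2) unfolding power_exps_iff[OF Ag] by blast
  have "\<exists>a\<in>Ag. c a \<ge> m"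
  proof (rule ccontr)
    assume "\<not> ?thesis"
    then have "(\<Sum>a\<in>Ag. c a) \<le> (\<Sum>a\<in>Ag. m)" by (intro sum_mono) auto
    also have "\<dots> \<le> m * n" using n by simp
    finally show False using cv(2) m(1) by simp
  qed
  then obtain a where a: "a \<in> Ag" "c a \<ge> m" by blast
  define c' where "c' = c(a := c a - m)"
  have s1: "(\<Sum>b\<in>Ag. c' b) = m * n"
    using cv(2) a Ag(1) by (simp add: c'_def sum.remove[of Ag a])
  have "scale (c a) a = scale m a + scale (c a - m) a" using a(2) by (simp flip: scale_add_left)
  then have s2: "(\<Sum>b\<in>Ag. scale (c b) b) = (\<Sum>b\<in>Ag. scale (c' b) b) + scale m a"
    using a Ag(1) by (simp add: c'_def sum.remove[of Ag a] add_ac)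
  have le: "lookup a i \<le> lookup u i" for i
  proof -
    have "m * lookup a i \<le> m * lookup u i"
      using arg_cong[OF cv(3), of "\<lambda>p. lookup p i"] unfolding s2 by (simp add: lookup_add)
    then show ?thesis using m(1) by simp
  qed
  have aV: "a \<in> exps V" and uV: "u \<in> exps V" using a Ag(2) E_sub u closure_exps_sub[of "Suc n"] by auto
  obtain w where w: "w \<in> exps V" "u = w + a" using exps_diffE[OF uV le aV] by blast
  have "scale m w = v + (\<Sum>b\<in>Ag. scale (c' b) b)"
    using cv(3) unfolding s2 w(2) by (simp add: scale_add_right flip: add.assoc)
  then have "scale m w \<in> power_exps V E (m * n)" unfolding power_exps_iff[OF Ag] using s1 cv(1) by blast
  then have "w \<in> closure_exps V E n" using w m by (auto simp: closure_exps_def)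
  then show ?thesis using a w by blast
qed

lemma closure_exps_sub_power_exps_shift:
  assumes Ag: "finite Ag" "Ag \<subseteq> E" "\<forall>u\<in>E. \<exists>w\<in>exps V. \<exists>a\<in>Ag. u = w + a"
  shows "closure_exps V E (n + card Ag) \<subseteq> power_exps V E n"
proof (induction n)
  case 0 then show ?case using closure_exps_sub by simp
next
  case (Suc n)
  show ?case
  proof
    fix u assume "u \<in> closure_exps V E (Suc n + card Ag)"
    then obtain w a where "w \<in> closure_exps V E (n + card Ag)" "a \<in> Ag" "u = w + a"
      using closure_exps_split[OF Ag, of "n + card Ag" u] by auto
    then show "u \<in> power_exps V E (Suc n)" using Suc Ag by auto
  qed
qed

end

locale zero_dim_exponent_ideal = exponent_ideal +
  fixes K :: nat
  assumes K: "\<And>i. i \<in> V \<Longrightarrow> single i K \<in> E"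
    and zero_notin: "0 \<notin> E"
begin

lemma not_power_exps_box: "exps V - power_exps V E n \<subseteq> box V (K * n)"
proof
  fix u assume u: "u \<in> exps V - power_exps V E n"
  have "lookup u i < K * n" if i: "i \<in> V" for i
  proof (rule ccontr)
    assume ge: "\<not> ?thesis"
    have "scale n (single i K) \<in> power_exps V E (n * 1)"
      by (rule power_exps_scale) (use K[OF i] in \<open>simp only: power_exps_1\<close>)
    then have 1: "scale n (single i K) \<in> power_exps V E n" by simp
    obtain w where "w \<in> exps V" "u = w + scale n (single i K)"
      by (rule exps_diffE[of u V "scale n (single i K)"])
        (use ge u 1 power_exps_sub in \<open>auto simp: lookup_single when_def mult.commute\<close>)
    then show False using power_exps_up[OF 1] u by (simp add: add.commute)
  qed
  then show "u \<in> box V (K * n)" using u by (auto simp: box_def)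
qed

lemma not_closure_exps_box: "exps V - closure_exps V E n \<subseteq> box V (K * n)"
  using not_power_exps_box[of n] power_exps_sub_closure_exps[of n] by blast

lemma finite_not_power_exps: "finite (exps V - power_exps V E n)"
  using not_power_exps_box card_box(1)[OF finV] finite_subset by blast

lemma finite_not_closure_exps: "finite (exps V - closure_exps V E n)"
  using not_closure_exps_box card_box(1)[OF finV] finite_subset by blast

lemma eventually_poly_power_exps: "\<exists>p. \<forall>\<^sub>F n in sequentially. real (card (exps V - power_exps V E n)) = poly p (real n)"
proof -
  obtain Ag where Ag: "finite Ag" "Ag \<subseteq> E" "\<forall>u\<in>E. \<exists>w\<in>exps V. \<exists>a\<in>Ag. u = w + a"
    using finite_generators[OF E_sub] by blast
  show ?thesis
  proof (rule eventually_poly_colength[OF Ag(1), where r = 0])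
    show "\<exists>w\<in>power_exps V E n. \<exists>a\<in>Ag. u = w + a" if u: "u \<in> power_exps V E (Suc n)" for n u
    proof -
      obtain w e where we: "u = w + e" "w \<in> power_exps V E n" "e \<in> E" using u by auto
      obtain b a where "b \<in> exps V" "a \<in> Ag" "e = b + a" using Ag(3) we by blast
      then have "w + b \<in> power_exps V E n" "u = (w + b) + a" using we power_exps_up[of w n b] by (auto simp: add_ac)
      then show ?thesis using \<open>a \<in> Ag\<close> by blast
    qed
    show "u + a \<in> power_exps V E (Suc n)" if "u \<in> power_exps V E n" "a \<in> Ag" for n u a
      using that Ag(2) by (intro power_exps_SucI) auto
  qed (rule power_exps_sub power_exps_dec finite_not_power_exps)+
qed

lemma eventually_poly_closure_exps: "\<exists>p. \<forall>\<^sub>F n in sequentially. real (card (exps V - closure_exps V E n)) = poly p (real n)"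
proof -
  obtain Ag where Ag: "finite Ag" "Ag \<subseteq> E" "\<forall>u\<in>E. \<exists>w\<in>exps V. \<exists>a\<in>Ag. u = w + a"
    using finite_generators[OF E_sub] by blast
  show ?thesis
  proof (rule eventually_poly_colength[OF Ag(1), where r = "card Ag"])
    show "u + a \<in> closure_exps V E (Suc n)" if "u \<in> closure_exps V E n" "a \<in> Ag" for n u a
      using closure_exps_add[of u n a 1] that power_exps_sub_closure_exps[of 1] Ag(2) unfolding power_exps_1 by auto
  qed (use closure_exps_sub closure_exps_dec closure_exps_split[OF Ag] finite_not_closure_exps in auto)
qed

end

section \<open>The trapezoidal inequality for staircases\<close>

definition height :: "nat \<Rightarrow> (nat \<Rightarrow>\<^sub>0 nat) set \<Rightarrow> (nat \<Rightarrow>\<^sub>0 nat) \<Rightarrow> nat" where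
  "height l S u = (LEAST t. u + single l t \<in> S)"

definition int_vecs :: "nat set \<Rightarrow> (nat \<Rightarrow> int) set" where
  "int_vecs A = {q. \<forall>i. i \<notin> A \<longrightarrow> q i = 0}"

definition abs_vec :: "nat set \<Rightarrow> (nat \<Rightarrow> int) \<Rightarrow> (nat \<Rightarrow>\<^sub>0 nat)" where
  "abs_vec A q = exp_vec A (\<lambda>i. nat \<bar>q i\<bar>)"

text \<open>Up to the factor \<open>2 ^ card (V - {l})\<close> this is the trapezoidal sum of the column heights: a column with
  \<open>z\<close> vanishing coordinates is counted with relative weight \<open>2\<^bsup>-z\<^esup>\<close>.\<close>

definition refl_count :: "nat set \<Rightarrow> nat \<Rightarrow> (nat \<Rightarrow>\<^sub>0 nat) set \<Rightarrow> nat" where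
  "refl_count V l S =
    (\<Sum>q | q \<in> int_vecs (V - {l}) \<and> height l S (abs_vec (V - {l}) q) \<noteq> 0. height l S (abs_vec (V - {l}) q))"

lemma lookup_abs_vec: "finite A \<Longrightarrow> lookup (abs_vec A q) i = (if i \<in> A then nat \<bar>q i\<bar> else 0)"
  by (simp add: abs_vec_def lookup_exp_vec)

text \<open>The set \<open>S\<close> lies above a staircase that is contained in the cube of side \<open>N\<close>; the coordinate \<open>l\<close> is the
  direction of the columns.\<close>

locale staircase =
  fixes V :: "nat set" and l :: nat and S :: "(nat \<Rightarrow>\<^sub>0 nat) set" and N :: nat
  assumes finV: "finite V" and lV: "l \<in> V" and sub: "S \<subseteq> exps V"
    and up: "\<And>u b. u \<in> S \<Longrightarrow> b \<in> exps V \<Longrightarrow> u + b \<in> S"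
    and bounded: "exps V - S \<subseteq> box V N"
begin

abbreviation "V' \<equiv> V - {l}"
abbreviation "D \<equiv> card (V - {l})"

lemma finV': "finite V'" using finV by simp

lemma card_V: "card V = Suc D" using card.remove[OF finV lV] by simp

lemma single_exps: "single l t \<in> exps V"
  using lV by (auto simp: exps_iff lookup_single when_def)

lemma abs_vec_exps: "abs_vec V' q \<in> exps V'" "abs_vec V' q \<in> exps V"
  using finV' by (auto simp: exps_iff lookup_abs_vec)

lemma height_le_iff:
  assumes "u \<in> exps V"
  shows "height l S u \<le> t \<longleftrightarrow> u + single l t \<in> S"
proof -
  have "u + single l N \<in> S"
  proof (rule ccontr)
    assume "\<not> ?thesis"
    then have "u + single l N \<in> box V N"
      using bounded assms single_exps exps_add by blast
    then show False using lV by (auto simp: box_def lookup_add)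
  qed
  then have L: "u + single l (height l S u) \<in> S"
    unfolding height_def by (rule LeastI)
  show ?thesis
  proof
    assume "height l S u \<le> t"
    then have "u + single l t =
        u + single l (height l S u) + single l (t - height l S u)"
      by (simp add: add.assoc flip: single_add)
    then show "u + single l t \<in> S" using up[OF L] single_exps by simp
  next
    assume "u + single l t \<in> S"
    then show "height l S u \<le> t" unfolding height_def by (rule Least_le)
  qed
qed

definition supp :: "(nat \<Rightarrow> int) set" where
  "supp = {q \<in> int_vecs V'. height l S (abs_vec V' q) \<noteq> 0}"

lemma finite_supp: "finite supp"
proof -
  have "supp \<subseteq> {q. \<forall>i. (i \<in> V' \<longrightarrow> q i \<in> {- int N..int N}) \<and> (i \<notin> V' \<longrightarrow> q i = 0)}"
  proof
    fix q assume q: "q \<in> supp"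
    then have "abs_vec V' q + single l 0 \<notin> S"
      using height_le_iff[OF abs_vec_exps(2), of q 0] by (simp add: supp_def)
    then have "abs_vec V' q \<in> box V N" using bounded abs_vec_exps(2) by (auto simp: )
    then have "nat \<bar>q i\<bar> < N" if "i \<in> V'" for i
      using that finV' by (auto simp: box_def lookup_abs_vec dest!: bspec[of _ _ i])
    then show "q \<in> {q. \<forall>i. (i \<in> V' \<longrightarrow> q i \<in> {- int N..int N}) \<and> (i \<notin> V' \<longrightarrow> q i = 0)}"
      using q by (force simp: supp_def int_vecs_def)
  qed
  moreover have "finite \<dots>" using finV' by (intro finite_set_of_finite_funs) auto
  ultimately show ?thesis by (rule finite_subset)
qed

lemma refl_count_eq: "refl_count V l S = (\<Sum>q\<in>supp. height l S (abs_vec V' q))"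
  by (simp add: refl_count_def supp_def)

lemma sum_height_le:
  assumes "finite A" "inj_on \<phi> A" "\<phi> ` A \<subseteq> int_vecs V'"
  shows "(\<Sum>q\<in>A. height l S (abs_vec V' (\<phi> q))) \<le> refl_count V l S"
proof -
  have "(\<Sum>q\<in>A. height l S (abs_vec V' (\<phi> q))) = (\<Sum>q\<in>\<phi> ` A. height l S (abs_vec V' q))"
    using assms(2) by (simp add: sum.reindex)
  also have "\<dots> = (\<Sum>q\<in>\<phi> ` A \<inter> supp. height l S (abs_vec V' q))"
    using assms by (intro sum.mono_neutral_right) (auto simp: supp_def)
  also have "\<dots> \<le> (\<Sum>q\<in>supp. height l S (abs_vec V' q))"
    using finite_supp by (intro sum_mono2) auto
  finally show ?thesis by (simp add: refl_count_eq)
qed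

text \<open>Choose a sign for each nonzero coordinate.\<close>

lemma card_sign_patterns:
  assumes "p \<in> exps V"
  shows "card {q \<in> int_vecs V'. \<forall>i\<in>V'. nat \<bar>q i\<bar> = lookup p i}
    = 2 ^ card {i \<in> V'. lookup p i \<noteq> 0}"
proof -
  let ?Q = "{q \<in> int_vecs V'. \<forall>i\<in>V'. nat \<bar>q i\<bar> = lookup p i}"
  let ?B = "{i \<in> V'. lookup p i \<noteq> 0}"
  have "bij_betw (\<lambda>q. {i \<in> V'. q i < 0}) ?Q (Pow ?B)"
  proof (rule bij_betwI[where g = "\<lambda>s i. if i \<in> V' then (if i \<in> s then - int (lookup p i)
      else int (lookup p i)) else 0"], goal_cases)
    case 1
    show ?case
    proof (intro funcsetI PowI subsetI)
      fix q i assume "q \<in> ?Q" "i \<in> {i \<in> V'. q i < 0}"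
      then have "nat \<bar>q i\<bar> = lookup p i" "i \<in> V'" "q i < 0" by blast+
      then show "i \<in> ?B" by auto
    qed
  next
    case 2 then show ?case by (auto simp: int_vecs_def)
  next
    case (3 q)
    then have "nat \<bar>q i\<bar> = lookup p i" if "i \<in> V'" for i using that by blast
    then have "int (lookup p i) = \<bar>q i\<bar>" if "i \<in> V'" for i using that by (metis abs_ge_zero int_nat_eq)
    then show ?case using 3 by (auto simp: int_vecs_def fun_eq_iff)
  next
    case (4 s)
    then show ?case by (auto split: if_splits)
  qed
  then have "card ?Q = card (Pow ?B)" by (rule bij_betw_same_card)
  then show ?thesis using finV' by (simp add: card_Pow)
qed

text \<open>Count the points below the reflected staircase by their absolute values.\<close>

lemma refl_count_eq_weighted:
  "refl_count V l S = (\<Sum>p\<in>exps V - S. 2 ^ card {i \<in> V'. lookup p i \<noteq> 0})"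
proof -
  define T where "T = (SIGMA q:supp. {..<height l S (abs_vec V' q)})"
  define \<pi> where "\<pi> = (\<lambda>(q, t). abs_vec V' q + single l t)"
  have finS: "finite (exps V - S)" using bounded card_box(1)[OF finV] finite_subset by blast
  have T_iff: "(q, t) \<in> T \<longleftrightarrow> q \<in> int_vecs V' \<and> \<pi> (q, t) \<in> exps V - S" for q t
    using height_le_iff[OF abs_vec_exps(2), of q t] exps_add[OF abs_vec_exps(2) single_exps, of q t]
    by (auto simp: T_def \<pi>_def supp_def not_less[symmetric])
  have finT: "finite T" unfolding T_def using finite_supp by blast
  have "refl_count V l S = card T" unfolding refl_count_eq T_def using finite_supp by simp
  also have "\<dots> = (\<Sum>x\<in>T. 1)" by simp
  also have "\<dots> = (\<Sum>p\<in>exps V - S. \<Sum>x\<in>{x\<in>T. \<pi> x = p}. 1)"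
    by (rule sum.group[symmetric]) (use finT finS T_iff in auto)
  also have "\<dots> = (\<Sum>p\<in>exps V - S. 2 ^ card {i \<in> V'. lookup p i \<noteq> 0})"
  proof (rule sum.cong[OF refl])
    fix p assume p: "p \<in> exps V - S"
    let ?Q = "{q \<in> int_vecs V'. \<forall>i\<in>V'. nat \<bar>q i\<bar> = lookup p i}"
    have eq: "\<pi> (q, t) = p \<longleftrightarrow> (\<forall>i\<in>V'. nat \<bar>q i\<bar> = lookup p i) \<and> t = lookup p l" for q t
    proof -
      have "\<pi> (q, t) = p \<longleftrightarrow> (\<forall>i. lookup (\<pi> (q, t)) i = lookup p i)"
        by (metis poly_mapping_eqI)
      also have "\<dots> \<longleftrightarrow> (\<forall>i\<in>V. lookup (\<pi> (q, t)) i = lookup p i)"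
        using p exps_add[OF abs_vec_exps(2) single_exps, of q t] by (auto simp: \<pi>_def exps_iff)
      also have "\<dots> \<longleftrightarrow> (\<forall>i\<in>V'. nat \<bar>q i\<bar> = lookup p i) \<and> t = lookup p l"
        using finV' lV by (auto simp: \<pi>_def lookup_add lookup_abs_vec lookup_single when_def)
      finally show ?thesis .
    qed
    have "{x\<in>T. \<pi> x = p} = (\<lambda>q. (q, lookup p l)) ` ?Q"
    proof (rule Set.set_eqI)
      fix x :: "(nat \<Rightarrow> int) \<times> nat"
      obtain q t where x: "x = (q, t)" by (cases x)
      have "x \<in> {x\<in>T. \<pi> x = p} \<longleftrightarrow> q \<in> int_vecs V' \<and> \<pi> (q, t) = p"
        using T_iff p unfolding x by auto
      then show "x \<in> {x\<in>T. \<pi> x = p} \<longleftrightarrow> x \<in> (\<lambda>q. (q, lookup p l)) ` ?Q"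
        unfolding eq x by blast
    qed
    then have "card {x\<in>T. \<pi> x = p} = card ?Q" by (simp add: card_image inj_on_def)
    then have "card {x\<in>T. \<pi> x = p} = 2 ^ card {i \<in> V'. lookup p i \<noteq> 0}"
      using card_sign_patterns[of p] p by (simp only: Diff_iff)
    then show "(\<Sum>x\<in>{x\<in>T. \<pi> x = p}. 1::nat) = 2 ^ card {i \<in> V'. lookup p i \<noteq> 0}"
      by (simp only: card_eq_sum)
  qed
  finally show ?thesis .
qed

abbreviation "zeros p \<equiv> card {i \<in> V'. lookup p i = 0}"

lemma card_supp_zeros: "card {i \<in> V'. lookup p i \<noteq> 0} + zeros p = D"
proof -
  have "D = card ({i \<in> V'. lookup p i \<noteq> 0} \<union> {i \<in> V'. lookup p i = 0})"
    by (rule arg_cong[of _ _ card]) auto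
  also have "\<dots> = card {i \<in> V'. lookup p i \<noteq> 0} + zeros p"
    using finV' by (intro card_Un_disjoint) auto
  finally show ?thesis by simp
qed

lemma finite_compl: "finite (exps V - S)" using bounded card_box(1)[OF finV] finite_subset by blast

lemma sum_zeros: "(\<Sum>p\<in>exps V - S. zeros p) = (\<Sum>i\<in>V'. card (exps (V - {i}) - S))"
proof -
  have "(\<Sum>p\<in>exps V - S. zeros p) = (\<Sum>p\<in>exps V - S. \<Sum>i\<in>V'. if lookup p i = 0 then 1 else 0)"
    using finV' by (intro sum.cong refl) (simp add: sum.If_cases Int_def)
  also have "\<dots> = (\<Sum>i\<in>V'. \<Sum>p\<in>exps V - S. if lookup p i = 0 then 1 else 0)"
    by (rule sum.swap)
  also have "\<dots> = (\<Sum>i\<in>V'. card (exps (V - {i}) - S))"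
  proof (intro sum.cong refl)
    fix i assume "i \<in> V'"
    then have "exps (V - {i}) - S = (exps V - S) \<inter> {p. lookup p i = 0}"
      by (auto simp: exps_iff)
    then show "(\<Sum>p\<in>exps V - S. if lookup p i = 0 then 1 else 0) = card (exps (V - {i}) - S)"
      using finite_compl by (simp add: sum.If_cases)
  qed
  finally show ?thesis .
qed

lemma card_face_le:
  assumes "i \<in> V'"
  shows "card (exps (V - {i}) - S) \<le> N ^ D"
proof -
  have "exps (V - {i}) - S \<subseteq> box (V - {i}) N"
  proof
    fix p assume p: "p \<in> exps (V - {i}) - S"
    then have "p \<in> box V N" using bounded exps_mono[of "V - {i}" V] by auto
    then show "p \<in> box (V - {i}) N" using p by (simp add: box_def)
  qed
  then have "card (exps (V - {i}) - S) \<le> card (box (V - {i}) N)"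
    using card_box(1)[of "V - {i}" N] finV by (intro card_mono) auto
  also have "\<dots> = N ^ D" using card_box(2)[of "V - {i}" N] finV assms card_V by simp
  finally show ?thesis .
qed

text \<open>The points with two vanishing coordinates lie in boxes of codimension two; they are the error term of
  order \<open>N ^ (D - 1)\<close>.\<close>

lemma card_codim2_le: "card {p \<in> exps V - S. zeros p \<ge> 2} \<le> D ^ 2 * N ^ (D - 1)"
proof -
  let ?P = "{(i, j) \<in> V' \<times> V'. i \<noteq> j}"
  have "{p \<in> exps V - S. zeros p \<ge> 2} \<subseteq> (\<Union>(i, j)\<in>?P. box (V - {i, j}) N)"
  proof
    fix p assume p: "p \<in> {p \<in> exps V - S. zeros p \<ge> 2}"
    then obtain i j where ij: "i \<in> V'" "j \<in> V'" "i \<noteq> j" "lookup p i = 0" "lookup p j = 0"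
      using card_le_Suc0_iff_eq[of "{i \<in> V'. lookup p i = 0}"] finV' by (auto simp: not_le[symmetric])
    have "p \<in> box (V - {i, j}) N" using p ij bounded by (auto simp: box_def exps_iff)
    then show "p \<in> (\<Union>(i, j)\<in>?P. box (V - {i, j}) N)" using ij by blast
  qed
  then have "card {p \<in> exps V - S. zeros p \<ge> 2} \<le> card (\<Union>(i, j)\<in>?P. box (V - {i, j}) N)"
    using finV card_box(1) by (intro card_mono finite_UN_I) (auto intro: finite_subset[of _ "V' \<times> V'"])
  also have "\<dots> \<le> (\<Sum>(i, j)\<in>?P. card (box (V - {i, j}) N))"
    unfolding case_prod_unfold by (rule card_UN_le) (use finV' in \<open>auto intro: finite_subset[of _ "V' \<times> V'"]\<close>)
  also have "\<dots> = (\<Sum>(i, j)\<in>?P. N ^ (D - 1))"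
  proof -
    have "card (box (V - {i, j}) N) = N ^ (D - 1)" if "(i, j) \<in> ?P" for i j
    proof -
      have "card (V - {i, j}) = D - 1" using that finV card_V by (simp add: card_Diff_subset)
      then show ?thesis using card_box(2)[of "V - {i, j}"] finV by simp
    qed
    then show ?thesis by (intro sum.cong refl) auto
  qed
  also have "\<dots> = card ?P * N ^ (D - 1)" by (simp add: case_prod_unfold)
  also have "\<dots> \<le> D ^ 2 * N ^ (D - 1)"
  proof (rule mult_right_mono)
    have "card ?P \<le> card (V' \<times> V')" using finV' by (intro card_mono) auto
    then show "card ?P \<le> D ^ 2" by (simp add: card_cartesian_product power2_eq_square)
  qed simp
  finally show ?thesis .
qed

text \<open>The upper bound linear in \<open>z\<close> for the weight \<open>2\<^sup>a\<close> is exact for \<open>z \<le> 1\<close>, so that only the points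
  with two vanishing coordinates enter the error term.\<close>

lemma weight_upper:
  assumes "a + z = (d::nat)"
  shows "2 * (2::real) ^ a \<le> 2 * 2 ^ d - 2 ^ d * real z + (if z \<ge> 2 then 2 ^ d * real d else 0)"
proof -
  consider "z = 0" | "z = 1" | "z \<ge> 2" by linarith
  then show ?thesis
  proof cases
    case 3
    have "(2::real) ^ a \<le> 2 ^ d" using assms by (intro power_increasing) auto
    moreover have "(2::real) ^ d * real z \<le> 2 ^ d * real d" using assms by (intro mult_left_mono) auto
    ultimately have "2 * (2::real) ^ a \<le> 2 * 2 ^ d - 2 ^ d * real z + 2 ^ d * real d" by linarith
    then show ?thesis using 3 by simp
  qed (use assms in auto)
qed

lemma weight_lower:
  assumes "a + z = (d::nat)"
  shows "(2::real) ^ a \<ge> 2 ^ d - 2 ^ d * real z"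
proof (cases "z = 0")
  case True then show ?thesis using assms by simp
next
  case False
  then have "(2::real) ^ d * 1 \<le> 2 ^ d * real z" by (intro mult_left_mono) auto
  then show ?thesis by (smt (verit) zero_le_power)
qed

lemma refl_count_upper:
  "2 * real (refl_count V l S) \<le> 2 * 2 ^ D * real (card (exps V - S))
    - 2 ^ D * (\<Sum>i\<in>V'. real (card (exps (V - {i}) - S))) + 2 ^ D * real D ^ 3 * real N ^ (D - 1)"
proof -
  have "2 * real (refl_count V l S) = (\<Sum>p\<in>exps V - S. 2 * 2 ^ card {i \<in> V'. lookup p i \<noteq> 0})"
    unfolding refl_count_eq_weighted by (simp add: sum_distrib_left)
  also have "\<dots> \<le> (\<Sum>p\<in>exps V - S. 2 * 2 ^ D - 2 ^ D * real (zeros p) + (if zeros p \<ge> 2 then 2 ^ D * real D else 0))"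
    by (intro sum_mono weight_upper card_supp_zeros)
  also have "\<dots> = 2 * 2 ^ D * real (card (exps V - S)) - 2 ^ D * real (\<Sum>p\<in>exps V - S. zeros p)
      + 2 ^ D * real D * real (card {p \<in> exps V - S. zeros p \<ge> 2})"
  proof -
    have "(\<Sum>p\<in>exps V - S. if zeros p \<ge> 2 then (2::real) ^ D * real D else 0)
        = 2 ^ D * real D * real (card {p \<in> exps V - S. zeros p \<ge> 2})"
      by (subst sum.inter_filter[OF finite_compl, symmetric]) simp
    then show ?thesis by (simp add: sum.distrib sum_subtractf flip: sum_distrib_left)
  qed
  also have "\<dots> \<le> 2 * 2 ^ D * real (card (exps V - S)) - 2 ^ D * real (\<Sum>p\<in>exps V - S. zeros p)
      + 2 ^ D * real D * real (D ^ 2 * N ^ (D - 1))"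
    using card_codim2_le by (intro add_left_mono mult_left_mono) (simp_all only: of_nat_le_iff, simp)
  finally show ?thesis unfolding sum_zeros by (simp add: power3_eq_cube power2_eq_square)
qed

lemma refl_count_lower:
  "real (refl_count V l S) \<ge> 2 ^ D * real (card (exps V - S)) - 2 ^ D * real D * real N ^ D"
proof -
  have "(\<Sum>i\<in>V'. card (exps (V - {i}) - S)) \<le> (\<Sum>i\<in>V'. N ^ D)"
    by (intro sum_mono card_face_le)
  then have "(\<Sum>p\<in>exps V - S. zeros p) \<le> D * N ^ D" unfolding sum_zeros by simp
  then have "real (\<Sum>p\<in>exps V - S. zeros p) \<le> real (D * N ^ D)" by (simp only: of_nat_le_iff)
  then have 1: "2 ^ D * real (\<Sum>p\<in>exps V - S. zeros p) \<le> 2 ^ D * real (D * N ^ D)"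
    by (intro mult_left_mono) auto
  have "2 ^ D * real (card (exps V - S)) - 2 ^ D * real (\<Sum>p\<in>exps V - S. zeros p)
      = (\<Sum>p\<in>exps V - S. 2 ^ D - 2 ^ D * real (zeros p))"
    by (simp add: sum_subtractf sum_distrib_left)
  also have "\<dots> \<le> (\<Sum>p\<in>exps V - S. 2 ^ card {i \<in> V'. lookup p i \<noteq> 0})"
    by (intro sum_mono weight_lower card_supp_zeros)
  also have "\<dots> = real (refl_count V l S)" unfolding refl_count_eq_weighted by simp
  finally show ?thesis using 1 by (simp only: of_nat_mult of_nat_power mult.assoc)
qed

end

lemma nat_abs_halves: "nat \<bar>x\<bar> = nat \<bar>x div 2\<bar> + nat \<bar>(x + 1) div 2\<bar>" for x :: int
proof -
  have sum: "x div 2 + (x + 1) div 2 = x" by presburger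
  have "0 \<le> x \<Longrightarrow> 0 \<le> x div 2 \<and> 0 \<le> (x + 1) div 2" by presburger
  moreover have "x < 0 \<Longrightarrow> x div 2 \<le> 0 \<and> (x + 1) div 2 \<le> 0" by presburger
  ultimately have "\<bar>x\<bar> = \<bar>x div 2\<bar> + \<bar>(x + 1) div 2\<bar>"
    using sum by (cases "0 \<le> x") (auto simp only: abs_of_nonneg abs_of_nonpos not_le)
  then show ?thesis by (simp add: nat_add_distrib)
qed

text \<open>The discrete convexity argument: subadditivity \<open>S + S \<subseteq> S2\<close> bounds the height of \<open>S2\<close> at \<open>\<bar>q\<bar>\<close> by the
  heights of \<open>S\<close> at the absolute values of the two halves of \<open>q\<close>. Once the set of odd coordinates is fixed,
  each half determines \<open>q\<close>; each of the \<open>2 ^ (card V - 1)\<close> parity classes therefore contributes at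
  most twice the count of \<open>S\<close>.\<close>

lemma refl_count_double:
  assumes "staircase V l S N" "staircase V l S2 N2"
    and add: "\<And>u v. u \<in> S \<Longrightarrow> v \<in> S \<Longrightarrow> u + v \<in> S2"
  shows "refl_count V l S2 \<le> 2 ^ card V * refl_count V l S"
proof -
  interpret s: staircase V l S N by fact
  interpret t: staircase V l S2 N2 by fact
  let ?V' = "V - {l}"
  define lo where "lo = (\<lambda>(q::nat \<Rightarrow> int) i. q i div 2)"
  define hi where "hi = (\<lambda>(q::nat \<Rightarrow> int) i. (q i + 1) div 2)"
  define odds where "odds = (\<lambda>(q::nat \<Rightarrow> int). {i \<in> ?V'. odd (q i)})"
  have le: "height l S2 (abs_vec ?V' q) \<le> height l S (abs_vec ?V' (lo q)) + height l S (abs_vec ?V' (hi q))" for q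
  proof -
    let ?a = "height l S (abs_vec ?V' (lo q))" and ?b = "height l S (abs_vec ?V' (hi q))"
    have "abs_vec ?V' (lo q) + single l ?a \<in> S" "abs_vec ?V' (hi q) + single l ?b \<in> S"
      using s.height_le_iff[OF s.abs_vec_exps(2)] by blast+
    then have "abs_vec ?V' (lo q) + single l ?a + (abs_vec ?V' (hi q) + single l ?b) \<in> S2"
      by (rule add)
    moreover have "abs_vec ?V' q = abs_vec ?V' (lo q) + abs_vec ?V' (hi q)"
    proof (rule poly_mapping_eqI)
      fix i
      have "nat \<bar>q i\<bar> = nat \<bar>q i div 2\<bar> + nat \<bar>(q i + 1) div 2\<bar>" by (rule nat_abs_halves)
      then show "lookup (abs_vec ?V' q) i = lookup (abs_vec ?V' (lo q) + abs_vec ?V' (hi q)) i"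
        by (cases "i \<in> ?V'") (simp_all only: lookup_add lookup_abs_vec[OF s.finV'] lo_def hi_def if_True if_False add_0)
    qed
    moreover have "abs_vec ?V' (lo q) + abs_vec ?V' (hi q) + single l (?a + ?b) =
        abs_vec ?V' (lo q) + single l ?a + (abs_vec ?V' (hi q) + single l ?b)"
      by (simp only: single_add add_ac)
    ultimately have "abs_vec ?V' q + single l (?a + ?b) \<in> S2"
      by (simp only:)
    then show ?thesis using t.height_le_iff[OF t.abs_vec_exps(2)] by blast
  qed
  have inj: "inj_on lo {q \<in> t.supp. odds q = X}" "inj_on hi {q \<in> t.supp. odds q = X}" for X
  proof -
    have par: "odd (q i) \<longleftrightarrow> odd (r i)" if "q \<in> t.supp" "r \<in> t.supp" "odds q = odds r" for q r i
    proof (cases "i \<in> ?V'")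
      case True
      then show ?thesis using that(3) by (auto simp: odds_def)
    next
      case False
      then show ?thesis using that(1,2) by (auto simp: t.supp_def int_vecs_def)
    qed
    show "inj_on lo {q \<in> t.supp. odds q = X}"
    proof (rule inj_onI, rule ext)
      fix q r i assume "q \<in> {q \<in> t.supp. odds q = X}" "r \<in> {q \<in> t.supp. odds q = X}" "lo q = lo r"
      then have "q i div 2 = r i div 2" "odd (q i) \<longleftrightarrow> odd (r i)" using par by (auto simp: lo_def fun_eq_iff)
      then show "q i = r i" by presburger
    qed
    show "inj_on hi {q \<in> t.supp. odds q = X}"
    proof (rule inj_onI, rule ext)
      fix q r i assume "q \<in> {q \<in> t.supp. odds q = X}" "r \<in> {q \<in> t.supp. odds q = X}" "hi q = hi r"
      then have "(q i + 1) div 2 = (r i + 1) div 2" "odd (q i) \<longleftrightarrow> odd (r i)" using par by (auto simp: hi_def fun_eq_iff)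
      then show "q i = r i" by presburger
    qed
  qed
  have part: "(\<Sum>q\<in>t.supp. height l S (abs_vec ?V' (\<phi> q))) \<le> 2 ^ card ?V' * refl_count V l S"
    if "\<phi> = lo \<or> \<phi> = hi" for \<phi>
  proof -
    have "(\<Sum>q\<in>t.supp. height l S (abs_vec ?V' (\<phi> q)))
        = (\<Sum>X\<in>Pow ?V'. \<Sum>q\<in>{q \<in> t.supp. odds q = X}. height l S (abs_vec ?V' (\<phi> q)))"
      using t.finite_supp s.finV' by (intro sum.group[symmetric]) (auto simp: odds_def)
    also have "\<dots> \<le> (\<Sum>X\<in>Pow ?V'. refl_count V l S)"
    proof (rule sum_mono)
      fix X
      show "(\<Sum>q\<in>{q \<in> t.supp. odds q = X}. height l S (abs_vec ?V' (\<phi> q))) \<le> refl_count V l S"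
      proof (rule s.sum_height_le)
        show "finite {q \<in> t.supp. odds q = X}" using t.finite_supp by simp
        show "inj_on \<phi> {q \<in> t.supp. odds q = X}" using that inj by blast
        show "\<phi> ` {q \<in> t.supp. odds q = X} \<subseteq> int_vecs ?V'"
          using that unfolding lo_def hi_def t.supp_def int_vecs_def by fastforce
      qed
    qed
    finally show ?thesis using s.finV' by (simp add: card_Pow)
  qed
  have "refl_count V l S2 = (\<Sum>q\<in>t.supp. height l S2 (abs_vec ?V' q))" by (rule t.refl_count_eq)
  also have "\<dots> \<le> (\<Sum>q\<in>t.supp. height l S (abs_vec ?V' (lo q)) + height l S (abs_vec ?V' (hi q)))"
    by (intro sum_mono le)
  also have "\<dots> \<le> 2 * (2 ^ card ?V' * refl_count V l S)"
    using part[of lo] part[of hi] by (simp add: sum.distrib)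
  finally show ?thesis using s.card_V by simp
qed

section \<open>Growth of polynomials and Hilbert coefficients\<close>

lemma ratio_power_tendsto: "k < D \<Longrightarrow> (\<lambda>n. real n ^ k / real n ^ D) \<longlonglongrightarrow> 0"
proof -
  assume kD: "k < D"
  have "(\<lambda>n. inverse (real n) ^ (D - k)) \<longlonglongrightarrow> 0 ^ (D - k)"
    by (intro tendsto_power lim_inverse_n)
  moreover have "\<forall>\<^sub>F n in sequentially. inverse (real n) ^ (D - k) = real n ^ k / real n ^ D"
    using eventually_gt_at_top[of 0]
  proof eventually_elim
    case (elim n)
    have "real n ^ D = real n ^ k * real n ^ (D - k)" using kD by (simp flip: power_add)
    then show ?case using elim by (simp add: field_simps)
  qed
  ultimately show ?thesis using kD by (simp add: tendsto_cong zero_power)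
qed

lemma poly_over_power_tendsto:
  fixes p :: "real poly"
  assumes "degree p \<le> D"
  shows "(\<lambda>n. poly p (real n) / real n ^ D) \<longlonglongrightarrow> coeff p D"
proof -
  have "poly p x = (\<Sum>i\<le>D. coeff p i * x ^ i)" for x
    unfolding poly_altdef using assms by (intro sum.mono_neutral_left) (auto simp: coeff_eq_0)
  then have eq: "poly p (real n) / real n ^ D = (\<Sum>i\<le>D. coeff p i * (real n ^ i / real n ^ D))" for n
    by (simp add: sum_divide_distrib)
  have "(\<lambda>n. coeff p i * (real n ^ i / real n ^ D)) \<longlonglongrightarrow> (if i = D then coeff p D else 0)" if "i \<le> D" for i
  proof (cases "i = D")
    case True
    have "\<forall>\<^sub>F n in sequentially. coeff p i * (real n ^ i / real n ^ D) = coeff p D"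
      using eventually_gt_at_top[of 0] by eventually_elim (simp add: True)
    then show ?thesis using tendsto_eventually[of _ "coeff p D"] by (simp only: True refl if_True)
  next
    case False
    then show ?thesis using that tendsto_mult_right_zero[OF ratio_power_tendsto[of i D]] by simp
  qed
  then have "(\<lambda>n. \<Sum>i\<le>D. coeff p i * (real n ^ i / real n ^ D)) \<longlonglongrightarrow> (\<Sum>i\<le>D. if i = D then coeff p D else 0)"
    by (intro tendsto_sum) auto
  then show ?thesis unfolding eq by simp
qed

lemma degree_le_of_growth:
  fixes p :: "real poly"
  assumes "\<forall>\<^sub>F n in sequentially. \<bar>poly p (real n)\<bar> \<le> C * real n ^ D"
  shows "degree p \<le> D"
proof (rule ccontr)
  assume neg: "\<not> ?thesis"
  have Z: "(\<lambda>n. C * (real n ^ D / real n ^ degree p)) \<longlonglongrightarrow> 0"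
    using neg by (intro tendsto_mult_right_zero ratio_power_tendsto) simp
  have "\<forall>\<^sub>F n in sequentially. norm (poly p (real n) / real n ^ degree p)
      \<le> norm (C * (real n ^ D / real n ^ degree p)) * 1"
    using assms
  proof eventually_elim
    case (elim n)
    then have "\<bar>poly p (real n)\<bar> / real n ^ degree p \<le> C * real n ^ D / real n ^ degree p"
      by (intro divide_right_mono) auto
    also have "\<dots> \<le> \<bar>C * (real n ^ D / real n ^ degree p)\<bar>"
      by (simp only: times_divide_eq_right abs_ge_self)
    finally show ?case by (simp add: abs_divide)
  qed
  then have "(\<lambda>n. poly p (real n) / real n ^ degree p) \<longlonglongrightarrow> 0" by (rule tendsto_0_le[OF Z])
  then have "lead_coeff p = 0"
    using poly_over_power_tendsto[of p "degree p"] LIMSEQ_unique by blast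
  then show False using neg by auto
qed

lemma poly_eq_of_eventually_eq:
  fixes p q :: "real poly"
  assumes "\<forall>\<^sub>F n in sequentially. poly p (real n) = poly q (real n)"
  shows "p = q"
proof -
  have "\<forall>\<^sub>F n in sequentially. \<bar>poly (p - q) (real n)\<bar> \<le> 0 * real n ^ 0"
    using assms by eventually_elim simp
  then have "degree (p - q) = 0" using degree_le_of_growth by fastforce
  then obtain c where c: "p - q = [:c:]" by (metis degree_eq_zeroE)
  obtain n where "poly p (real n) = poly q (real n)"
    using assms unfolding eventually_sequentially by blast
  then have "poly (p - q) (real n) = 0" by simp
  then have "p - q = 0" unfolding c by simp
  then show ?thesis by simp
qed

lemma eventual_poly_eqI:
  assumes "\<forall>\<^sub>F n in sequentially. real (f n) = poly p (real n)"
  shows "eventual_poly (\<lambda>n. enat (f n)) = p"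
  unfolding eventual_poly_def
proof (rule the_equality)
  show "\<forall>\<^sub>F n in sequentially. ereal_of_enat (enat (f n)) = ereal (poly p (real n))"
    using assms by simp
next
  fix q assume "\<forall>\<^sub>F n in sequentially. ereal_of_enat (enat (f n)) = ereal (poly q (real n))"
  with assms have "\<forall>\<^sub>F n in sequentially. poly q (real n) = poly p (real n)"
    by eventually_elim simp
  then show "q = p" by (rule poly_eq_of_eventually_eq)
qed

text \<open>The polynomial of the rising factorial. The binomial basis in the definition of the Hilbert
  coefficients consists of these polynomials, divided by factorials.\<close>

definition rising :: "nat \<Rightarrow> real poly" where
  "rising k = (\<Prod>j<k. [:real j, 1:])"

lemma poly_rising: "poly (rising k) x = pochhammer x k"
  by (simp add: rising_def poly_prod pochhammer_prod lessThan_atLeast0 add.commute)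

lemma monic_rising: "degree (rising k) = k \<and> lead_coeff (rising k) = 1"
proof (induction k)
  case 0 then show ?case by (simp add: rising_def)
next
  case (Suc k)
  have r: "rising (Suc k) = rising k * [:real k, 1:]" by (simp add: rising_def)
  have "rising k \<noteq> 0" using Suc by auto
  then have "degree (rising (Suc k)) = Suc k" unfolding r using conjunct1[OF Suc] by (subst degree_mult_eq) auto
  moreover have "lead_coeff (rising (Suc k)) = 1" unfolding r lead_coeff_mult using conjunct2[OF Suc] by simp
  ultimately show ?case by simp
qed

lemma degree_rising: "degree (rising k) = k" using monic_rising by blast

lemma coeff_rising: "coeff (rising k) k = 1" using monic_rising[of k] by (metis (no_types))

lemma coeff_rising_second: "coeff (rising (Suc k)) k = real k * (real k + 1) / 2"
proof (induction k)
  case 0 then show ?case by (simp add: rising_def)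
next
  case (Suc k)
  have r: "rising (Suc (Suc k)) = pCons 0 (rising (Suc k)) + Polynomial.smult (real (Suc k)) (rising (Suc k))"
    unfolding rising_def by (simp add: mult.commute[of _ "[:_, _:]"])
  show ?case unfolding r using Suc coeff_rising[of "Suc k"] by (simp add: field_simps)
qed

lemma gbinomial_eq_rising:
  assumes "i \<le> d"
  shows "((x::real) + real d - 1 - real i) gchoose (d - i) = poly (rising (d - i)) x / fact (d - i)"
proof -
  have "x + real d - 1 - real i - real (d - i) + 1 = x" using assms by (simp add: of_nat_diff)
  then show ?thesis unfolding gbinomial_pochhammer' poly_rising by simp
qed

lemma rising_combination_exists:
  assumes "degree p \<le> d"
  shows "\<exists>c. p = (\<Sum>i\<le>d. Polynomial.smult (c i) (rising i))"
  using assms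
proof (induction d arbitrary: p)
  case 0
  then obtain a where "p = [:a:]" by (metis degree_eq_zeroE le_zero_eq)
  then show ?case by (intro exI[of _ "\<lambda>_. a"]) (simp add: rising_def)
next
  case (Suc d)
  define q where "q = p - Polynomial.smult (coeff p (Suc d)) (rising (Suc d))"
  have "degree q \<le> d"
  proof (rule degree_le, intro allI impI)
    fix i assume "d < i"
    show "coeff q i = 0"
    proof (cases "i = Suc d")
      case True then show ?thesis by (simp add: q_def coeff_rising)
    next
      case False
      then show ?thesis using \<open>d < i\<close> Suc.prems by (simp add: q_def coeff_eq_0 degree_rising)
    qed
  qed
  then obtain c where c: "q = (\<Sum>i\<le>d. Polynomial.smult (c i) (rising i))" using Suc.IH by blast
  show ?case
    by (rule exI[of _ "c(Suc d := coeff p (Suc d))"]) (use c in \<open>simp add: q_def algebra_simps\<close>)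
qed

lemma rising_combination_unique:
  assumes "(\<Sum>i\<le>d. Polynomial.smult (c i) (rising i)) = 0" "i \<le> d"
  shows "c i = 0"
  using assms
proof (induction d)
  case 0 then show ?case by (simp add: rising_def)
next
  case (Suc d)
  have "coeff (\<Sum>i\<le>d. Polynomial.smult (c i) (rising i)) (Suc d) = 0"
    by (simp add: coeff_sum coeff_eq_0 degree_rising)
  moreover have "coeff (\<Sum>i\<le>Suc d. Polynomial.smult (c i) (rising i)) (Suc d) = 0" using Suc.prems(1) by simp
  ultimately have "c (Suc d) = 0" using coeff_rising[of "Suc d"] by simp
  then show ?case using Suc by (cases "i = Suc d") auto
qed

text \<open>Since \<open>rising k\<close> is monic of degree \<open>k\<close>, the expansion of a polynomial of degree at most \<open>d\<close> exists and
  is unique, which makes the definite description in \<open>hilbert_coeff\<close> meaningful.\<close>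

lemma hilbert_coeff_expansion:
  assumes "degree p \<le> d" "eventual_poly f = p"
  shows "p = (\<Sum>i\<le>d. Polynomial.smult ((-1) ^ i * hilbert_coeff d f i / fact (d - i)) (rising (d - i)))"
proof -
  have expand: "(\<forall>x. poly (eventual_poly f) x =
      (\<Sum>i\<le>d. (-1) ^ i * e i * ((x + real d - 1 - real i) gchoose (d - i)))) \<longleftrightarrow>
      p = (\<Sum>i\<le>d. Polynomial.smult ((-1) ^ i * e i / fact (d - i)) (rising (d - i)))" for e
  proof -
    have "(\<Sum>i\<le>d. (-1) ^ i * e i * ((x + real d - 1 - real i) gchoose (d - i)))
        = poly (\<Sum>i\<le>d. Polynomial.smult ((-1) ^ i * e i / fact (d - i)) (rising (d - i))) x" for x
      unfolding poly_sum by (intro sum.cong refl) (simp add: gbinomial_eq_rising)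
    then show ?thesis unfolding assms(2) by (simp add: poly_eq_poly_eq_iff[symmetric] fun_eq_iff)
  qed
  have flip: "(\<Sum>i\<le>d. Polynomial.smult (g i) (rising (d - i))) = (\<Sum>i\<le>d. Polynomial.smult (g (d - i)) (rising i))" for g
    by (rule sum.reindex_bij_witness[where i = "\<lambda>i. d - i" and j = "\<lambda>i. d - i"]) auto
  obtain c where c: "p = (\<Sum>i\<le>d. Polynomial.smult (c i) (rising i))"
    using rising_combination_exists[OF assms(1)] by blast
  define e0 where "e0 = (\<lambda>i. if i \<le> d then (-1) ^ i * fact (d - i) * c (d - i) else 0)"
  have "\<exists>!e. (\<forall>i>d. e i = 0) \<and> p = (\<Sum>i\<le>d. Polynomial.smult ((-1) ^ i * e i / fact (d - i)) (rising (d - i)))"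
  proof (rule ex1I[of _ e0])
    have "(\<Sum>i\<le>d. Polynomial.smult ((-1) ^ i * e0 i / fact (d - i)) (rising (d - i))) = (\<Sum>i\<le>d. Polynomial.smult (c (d - i)) (rising (d - i)))"
    proof (intro sum.cong refl)
      fix i assume "i \<in> {..d}"
      have "(-1) ^ i * ((-1) ^ i * z) = (z::real)" for z by (simp flip: mult.assoc power_add mult_2)
      then show "Polynomial.smult ((-1) ^ i * e0 i / fact (d - i)) (rising (d - i)) = Polynomial.smult (c (d - i)) (rising (d - i))"
        using \<open>i \<in> {..d}\<close> by (simp add: e0_def mult.assoc)
    qed
    then show "(\<forall>i>d. e0 i = 0) \<and> p = (\<Sum>i\<le>d. Polynomial.smult ((-1) ^ i * e0 i / fact (d - i)) (rising (d - i)))"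
      unfolding flip[of "\<lambda>i. c (d - i)"] using c by (simp add: e0_def)
  next
    fix e assume e: "(\<forall>i>d. e i = 0) \<and> p = (\<Sum>i\<le>d. Polynomial.smult ((-1) ^ i * e i / fact (d - i)) (rising (d - i)))"
    then have "p = (\<Sum>i\<le>d. Polynomial.smult ((-1) ^ (d - i) * e (d - i) / fact (d - (d - i))) (rising i))"
      unfolding flip[of "\<lambda>i. (-1) ^ i * e i / fact (d - i)"] by blast
    with c have "(\<Sum>i\<le>d. Polynomial.smult ((-1) ^ (d - i) * e (d - i) / fact (d - (d - i)) - c i) (rising i)) = 0"
      by (simp add: smult_diff_left sum_subtractf)
    then have z: "i \<le> d \<Longrightarrow> (-1) ^ (d - i) * e (d - i) / fact (d - (d - i)) - c i = 0" for i
      by (rule rising_combination_unique)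
    show "e = e0"
    proof
      fix i
      show "e i = e0 i"
      proof (cases "i \<le> d")
        case True
        then have "(-1) ^ i * e i = fact (d - i) * c (d - i)" using z[of "d - i"] by (simp add: field_simps)
        then have "(-1) ^ i * ((-1) ^ i * e i) = (-1) ^ i * (fact (d - i) * c (d - i))" by simp
        moreover have "(-1) ^ i * ((-1) ^ i * e i) = e i" by (simp flip: mult.assoc power_add mult_2)
        ultimately show ?thesis using True by (simp add: e0_def)
      next
        case False then show ?thesis using e by (simp add: e0_def)
      qed
    qed
  qed
  from theI'[OF this] show ?thesis unfolding hilbert_coeff_def expand by blast
qed

text \<open>The coefficient of \<open>x\<^sup>D\<close> receives \<open>e\<^sub>0 D / (2 D!)\<close> from the first basis polynomial and \<open>- e\<^sub>1 / D!\<close>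
  from the second.\<close>

lemma hilbert_coeff_e0_e1:
  assumes "degree p \<le> Suc D" "eventual_poly f = p"
  shows "hilbert_coeff (Suc D) f 0 * real D - 2 * hilbert_coeff (Suc D) f 1 = 2 * fact D * coeff p D"
proof -
  let ?e = "hilbert_coeff (Suc D) f"
  have ce: "coeff p k = (\<Sum>i\<le>Suc D. (-1) ^ i * ?e i / fact (Suc D - i) * coeff (rising (Suc D - i)) k)" for k
    by (subst hilbert_coeff_expansion[OF assms]) (simp add: coeff_sum)
  have "coeff p D = ?e 0 / fact (Suc D) * coeff (rising (Suc D)) D + - (?e 1 / fact D * coeff (rising D) D)"
  proof -
    have "coeff (rising (Suc D - i)) D = 0" if "i \<ge> 2" "i \<le> Suc D" for i
      by (rule coeff_eq_0) (use that in \<open>simp add: degree_rising\<close>)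
    then have "(\<Sum>i\<in>{..Suc D} - {0} - {1}. (-1) ^ i * ?e i / fact (Suc D - i) * coeff (rising (Suc D - i)) D) = 0"
      by (intro sum.neutral) auto
    then show ?thesis
      unfolding ce[of D] by (subst sum.remove[of _ 0], simp, simp, subst sum.remove[of _ 1]) auto
  qed
  then have "coeff p D = ?e 0 / fact (Suc D) * (real D * (real D + 1) / 2) - ?e 1 / fact D"
    by (simp add: coeff_rising_second coeff_rising)
  also have "?e 0 / fact (Suc D) * (real D * (real D + 1) / 2) = ?e 0 * real D / (2 * fact D)"
  proof -
    have "e / (s * f) * (k * s / 2) = e * k / (2 * f)" if "s \<noteq> 0" "f \<noteq> 0" for e s f k :: real
      using that by (simp add: field_simps)
    from this[of "real D + 1" "fact D"] show ?thesis by (simp add: add.commute)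
  qed
  finally show ?thesis
    by (simp add: field_simps)
qed

lemma coeff_pcompose_shift:
  fixes q :: "real poly"
  assumes "degree q \<le> D"
  shows "coeff (pcompose q [:a, 1:]) D = coeff q D"
proof (cases "degree q = D")
  case True
  then show ?thesis using lead_coeff_comp[of "[:a, 1:]" q] by (simp add: degree_pcompose)
next
  case False
  then show ?thesis using assms by (simp add: coeff_eq_0 degree_pcompose)
qed

text \<open>The analytic core. The bound \<open>double\<close> says that \<open>F n / n\<^bsup>D+1\<^esup>\<close> does not increase along
  \<open>n, 2n, 4n, \<dots>\<close>; by \<open>lower\<close> its values along this sequence are eventually at least \<open>a c - o(1)\<close>, where
  \<open>c\<close> is the coefficient of \<open>x\<^bsup>D+1\<^esup>\<close> in \<open>p\<close>. Inserting \<open>F n \<ge> a c n\<^bsup>D+1\<^esup>\<close> into \<open>upper\<close> cancels the leading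
  term of \<open>p\<close> and leaves an inequality between the coefficients of \<open>x\<^sup>D\<close>. A shift of the argument by a
  constant \<open>r\<close> does not affect leading coefficients.\<close>

theorem second_coeff_of_doubling:
  fixes p :: "real poly" and q :: "'i \<Rightarrow> real poly" and F f :: "nat \<Rightarrow> real"
  assumes D: "D \<ge> 1" and A: "finite A"
    and f: "\<forall>\<^sub>F n in sequentially. f n = poly p (real n)" and dp: "degree p \<le> Suc D"
    and dq: "\<And>i. i \<in> A \<Longrightarrow> degree (q i) \<le> D"
    and q: "\<forall>\<^sub>F n in sequentially. \<forall>i\<in>A. g i n = poly (q i) (real n)"
    and gb: "\<And>i n. i \<in> A \<Longrightarrow> gb i (n + r) \<ge> g i n"
    and upper: "\<And>n. 2 * F n \<le> 2 * a * f n - a * (\<Sum>i\<in>A. gb i n) + C * real n ^ (D - 1)"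
    and lower: "\<And>n. F n \<ge> a * f n - C' * real n ^ D"
    and double: "\<And>n. F (2 * n) \<le> 2 ^ Suc D * F n" and a: "a > 0"
  shows "2 * coeff p D \<ge> (\<Sum>i\<in>A. coeff (q i) D)"
proof -
  define c where "c = coeff p (Suc D)"
  have iter: "F (2 ^ k * n) \<le> (2 ^ k) ^ Suc D * F n" for k n
  proof (induction k)
    case 0 then show ?case by simp
  next
    case (Suc k)
    have "F (2 ^ Suc k * n) \<le> 2 ^ Suc D * F (2 ^ k * n)" using double[of "2 ^ k * n"] by (simp add: mult.assoc)
    also have "\<dots> \<le> 2 ^ Suc D * ((2 ^ k) ^ Suc D * F n)" using Suc by (intro mult_left_mono) auto
    also have "\<dots> = (2 ^ Suc k) ^ Suc D * F n" by (simp add: power_mult_distrib)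
    finally show ?case .
  qed
  \<comment> \<open>Let \<open>k\<close> tend to infinity in the comparison of \<open>F (2 ^ k * n)\<close> with \<open>F n\<close>.\<close>
  have F_ge: "F n \<ge> a * c * real n ^ Suc D" if n: "n \<ge> 1" for n
  proof -
    have sub: "filterlim (\<lambda>k. 2 ^ k * n) sequentially sequentially"
      by (rule filterlim_subseq) (use n in \<open>auto simp: strict_mono_def\<close>)
    have "(\<lambda>m. a * (poly p (real m) / real m ^ Suc D) - C' * (real m ^ D / real m ^ Suc D)) \<longlonglongrightarrow> a * c - C' * 0"
      unfolding c_def using dp by (intro tendsto_intros poly_over_power_tendsto ratio_power_tendsto) auto
    then have lim: "(\<lambda>k. a * (poly p (real (2 ^ k * n)) / real (2 ^ k * n) ^ Suc D)
        - C' * (real (2 ^ k * n) ^ D / real (2 ^ k * n) ^ Suc D)) \<longlonglongrightarrow> a * c - C' * 0"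
      using sub by (rule filterlim_compose)
    have ev: "\<forall>\<^sub>F k in sequentially. f (2 ^ k * n) = poly p (real (2 ^ k * n))"
      using filterlim_iff[THEN iffD1, OF sub] f by blast
    have "\<forall>\<^sub>F k in sequentially. a * (poly p (real (2 ^ k * n)) / real (2 ^ k * n) ^ Suc D)
        - C' * (real (2 ^ k * n) ^ D / real (2 ^ k * n) ^ Suc D) \<le> F n / real n ^ Suc D"
      using ev
    proof eventually_elim
      case (elim k)
      let ?m = "2 ^ k * n"
      have pos: "real ?m ^ Suc D > 0" using n by simp
      have "a * poly p (real ?m) - C' * real ?m ^ D \<le> (2 ^ k) ^ Suc D * F n"
        using lower[of ?m] iter[of k n] unfolding elim by linarith
      then have "(a * poly p (real ?m) - C' * real ?m ^ D) / real ?m ^ Suc D \<le> (2 ^ k) ^ Suc D * F n / real ?m ^ Suc D"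
        using pos by (intro divide_right_mono) auto
      also have "(2 ^ k) ^ Suc D * F n / real ?m ^ Suc D = F n / real n ^ Suc D"
        by (simp only: of_nat_mult of_nat_power of_nat_numeral power_mult_distrib) simp
      finally show ?case by (simp only: diff_divide_distrib times_divide_eq_right)
    qed
    then have "a * c - C' * 0 \<le> F n / real n ^ Suc D"
      by (rule tendsto_upperbound[OF lim]) simp
    then show ?thesis using n by (simp add: pos_le_divide_eq)
  qed
  define p1 where "p1 = p - monom c (Suc D)"
  have dp1: "degree p1 \<le> D"
  proof (rule degree_le, intro allI impI)
    fix i assume "D < i"
    then show "coeff p1 i = 0" using dp by (cases "i = Suc D") (auto simp: p1_def c_def coeff_eq_0)
  qed
  define q' where "q' = (\<lambda>i. pcompose (q i) [:- real r, 1:])"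
  define z where "z = Polynomial.smult 2 p1 - (\<Sum>i\<in>A. q' i)"
  have dq': "degree (q' i) \<le> D" if "i \<in> A" for i using dq[OF that] by (simp add: q'_def degree_pcompose)
  have dz: "degree z \<le> D" unfolding z_def
    using A dq' by (intro degree_diff_le degree_sum_le order.trans[OF degree_smult_le dp1]) auto
  obtain M where M: "\<And>n. n \<ge> M \<Longrightarrow> \<forall>i\<in>A. g i n = poly (q i) (real n)"
    using q unfolding eventually_sequentially by blast
  have "\<forall>\<^sub>F n in sequentially. - (C / a) * (real n ^ (D - 1) / real n ^ D) \<le> poly z (real n) / real n ^ D"
    using f eventually_ge_at_top[of "M + r + 1"]
  proof eventually_elim
    case (elim n)
    have "(\<Sum>i\<in>A. poly (q' i) (real n)) \<le> (\<Sum>i\<in>A. gb i n)"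
    proof (rule sum_mono)
      fix i assume i: "i \<in> A"
      have "g i (n - r) = poly (q i) (real (n - r))" using M[of "n - r"] elim(2) i by auto
      also have "\<dots> = poly (q' i) (real n)" using elim(2) by (simp add: q'_def poly_pcompose of_nat_diff)
      finally show "poly (q' i) (real n) \<le> gb i n" using gb[OF i, of "n - r"] elim(2) by simp
    qed
    then have "a * (\<Sum>i\<in>A. poly (q' i) (real n)) \<le> a * (\<Sum>i\<in>A. gb i n)" using a by simp
    then have "2 * (a * c * real n ^ Suc D) \<le> 2 * a * poly p (real n)
        - a * (\<Sum>i\<in>A. poly (q' i) (real n)) + C * real n ^ (D - 1)"
      using upper[of n] F_ge[of n] elim by (simp add: mult.assoc) 
    then have "0 \<le> a * poly z (real n) + C * real n ^ (D - 1)"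
      by (simp add: z_def p1_def poly_monom poly_sum algebra_simps)
    then have "- (C / a) * real n ^ (D - 1) \<le> poly z (real n)" using a by (simp add: field_simps)
    then have "- (C / a) * real n ^ (D - 1) / real n ^ D \<le> poly z (real n) / real n ^ D"
      by (intro divide_right_mono) auto
    then show ?case by simp
  qed
  moreover have "(\<lambda>n. - (C / a) * (real n ^ (D - 1) / real n ^ D)) \<longlonglongrightarrow> 0"
    using D by (intro tendsto_mult_right_zero ratio_power_tendsto) simp
  ultimately have "0 \<le> coeff z D"
    using poly_over_power_tendsto[OF dz] by (intro tendsto_le[of sequentially]) auto
  also have "coeff z D = 2 * coeff p D - (\<Sum>i\<in>A. coeff (q i) D)"
    using dq by (simp add: z_def p1_def q'_def coeff_sum coeff_pcompose_shift)
  finally show ?thesis by simp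
qed

section \<open>The multiplicity is at least one\<close>

definition total_deg :: "nat set \<Rightarrow> (nat \<Rightarrow>\<^sub>0 nat) \<Rightarrow> nat" where
  "total_deg V u = (\<Sum>i\<in>V. lookup u i)"

text \<open>A vector of total degree at most \<open>n\<close> becomes a composition of \<open>n\<close> into \<open>card V + 1\<close> parts, zero
  allowed, by appending the missing degree.\<close>

lemma card_total_deg_less:
  assumes "finite V" "finite T" "{u \<in> exps V. total_deg V u \<le> n} \<subseteq> T"
  shows "(n + card V) choose n \<le> card T"
proof -
  let ?D = "card V"
  obtain h where h: "bij_betw h V {0..<?D}" using ex_bij_betw_finite_nat[OF assms(1)] by blast
  define L where "L = {l::nat list. length l = Suc ?D \<and> sum_list l = n}"
  define \<phi> where "\<phi> = (\<lambda>l::nat list. exp_vec V (\<lambda>i. l ! h i))"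
  have hD: "h i < ?D" if "i \<in> V" for i using h that by (auto simp: bij_betw_def)
  have sum: "(\<Sum>i\<in>V. l ! h i) = (\<Sum>j<?D. l ! j)" for l :: "nat list"
    using sum.reindex_bij_betw[OF h, of "\<lambda>j. l ! j"] by (simp add: lessThan_atLeast0)
  have tot: "(\<Sum>j<?D. l ! j) + l ! ?D = n" if "l \<in> L" for l
    using that by (auto simp: L_def sum_list_sum_nth atLeast0LessThan)
  have "inj_on \<phi> L"
  proof (rule inj_onI)
    fix k l assume kl: "k \<in> L" "l \<in> L" "\<phi> k = \<phi> l"
    have "k ! h i = l ! h i" if "i \<in> V" for i
      using arg_cong[OF kl(3), of "\<lambda>u. lookup u i"] that assms(1) by (simp add: \<phi>_def lookup_exp_vec)
    then have lt: "k ! j = l ! j" if "j < ?D" for j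
      using h that unfolding bij_betw_def by (metis atLeastLessThan_iff image_iff zero_le)
    then have "(\<Sum>j<?D. k ! j) = (\<Sum>j<?D. l ! j)" by simp
    then have "k ! ?D = l ! ?D" using tot[OF kl(1)] tot[OF kl(2)] by simp
    then show "k = l" using kl lt by (intro nth_equalityI) (auto simp: L_def less_Suc_eq)
  qed
  moreover have "\<phi> ` L \<subseteq> T"
  proof -
    have "\<phi> l \<in> exps V \<and> total_deg V (\<phi> l) \<le> n" if "l \<in> L" for l
      using tot[OF that] sum[of l] assms(1) by (simp add: \<phi>_def total_deg_def exps_iff lookup_exp_vec)
    then show ?thesis using assms(3) by blast
  qed
  ultimately have "card L \<le> card T" using assms(2) by (meson card_inj_on_le)
  moreover have "card L = (n + ?D) choose n" unfolding L_def by (subst card_length_sum_list) simp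
  ultimately show ?thesis by simp
qed

lemma binomial_ge_power_over_fact: "real ((n + D) choose n) \<ge> real n ^ D / fact D"
proof -
  have "real ((n + D) choose n) = real ((n + D) choose D)"
    using binomial_symmetric[of n "n + D"] by simp
  also have "\<dots> = pochhammer (real n + 1) D / fact D"
    unfolding binomial_gbinomial gbinomial_pochhammer' by simp
  finally have eq: "real ((n + D) choose n) = pochhammer (real n + 1) D / fact D" .
  have "real n ^ D = (\<Prod>j = 0..<D. real n)" by simp
  also have "\<dots> \<le> pochhammer (real n + 1) D" unfolding pochhammer_prod by (rule prod_mono) auto
  finally show ?thesis unfolding eq by (intro divide_right_mono) auto
qed

context zero_dim_exponent_ideal
begin

lemma total_deg_power_exps: "u \<in> power_exps V E n \<Longrightarrow> n \<le> total_deg V u"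
proof (induction n arbitrary: u)
  case (Suc n)
  then obtain w a where wa: "w \<in> power_exps V E n" "a \<in> E" "u = w + a" by auto
  have "\<exists>i\<in>V. lookup a i \<noteq> 0"
  proof (rule ccontr)
    assume "\<not> ?thesis"
    moreover have "a \<in> exps V" using wa(2) E_sub by blast
    ultimately have "lookup a i = 0" for i by (cases "i \<in> V") (auto simp: exps_iff)
    then have "a = 0" by (intro poly_mapping_eqI) simp
    then show False using zero_notin wa(2) by simp
  qed
  then have "total_deg V a \<noteq> 0" using finV by (auto simp: total_deg_def)
  moreover have "total_deg V u = total_deg V w + total_deg V a"
    by (simp add: wa total_deg_def lookup_add sum.distrib)
  ultimately show ?case using Suc.IH[OF wa(1)] by simp
qed simp

lemma colength_poly_degree:
  assumes "\<forall>\<^sub>F n in sequentially. real (card (exps V - S n)) = poly p (real n)"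
    and "\<And>n. exps V - S n \<subseteq> box V (K * n)"
  shows "degree p \<le> card V"
proof (rule degree_le_of_growth)
  show "\<forall>\<^sub>F n in sequentially. \<bar>poly p (real n)\<bar> \<le> real K ^ card V * real n ^ card V"
    using assms(1)
  proof eventually_elim
    case (elim n)
    have "card (exps V - S n) \<le> card (box V (K * n))"
      using assms(2) card_box(1)[OF finV] by (intro card_mono) auto
    then have "card (exps V - S n) \<le> (K * n) ^ card V" using card_box(2)[OF finV] by simp
    then have "real (card (exps V - S n)) \<le> real ((K * n) ^ card V)" by (simp only: of_nat_le_iff)
    then show ?case using elim by (simp add: power_mult_distrib)
  qed
qed

text \<open>The \<open>(n + 1)\<close>-st power has no element of degree at most \<open>n\<close>, so the colength is at least the number
  of vectors of degree at most \<open>n\<close>, which is at least \<open>n\<^sup>D / D!\<close> for \<open>D = card V\<close>.\<close>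

lemma multiplicity_ge_1:
  assumes q: "\<forall>\<^sub>F n in sequentially. real (card (exps V - power_exps V E n)) = poly q (real n)"
  shows "fact (card V) * coeff q (card V) \<ge> 1"
proof -
  let ?D = "card V"
  have ge: "real n ^ ?D / fact ?D \<le> real (card (exps V - power_exps V E (Suc n)))" for n
  proof -
    have "(n + ?D) choose n \<le> card (exps V - power_exps V E (Suc n))"
      using total_deg_power_exps[of _ "Suc n"] finite_not_power_exps finV by (intro card_total_deg_less) fastforce+
    then have "real ((n + ?D) choose n) \<le> real (card (exps V - power_exps V E (Suc n)))" by simp
    then show ?thesis using binomial_ge_power_over_fact[of n ?D] by linarith
  qed
  define q1 where "q1 = pcompose q [:1, 1:]"
  have dq: "degree q \<le> ?D" by (rule colength_poly_degree[OF q not_power_exps_box])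
  then have "degree q1 \<le> ?D" by (simp add: q1_def degree_pcompose)
  then have lim: "(\<lambda>n. poly q1 (real n) / real n ^ ?D) \<longlonglongrightarrow> coeff q1 ?D" by (rule poly_over_power_tendsto)
  have "\<forall>\<^sub>F n in sequentially. 1 / fact ?D \<le> poly q1 (real n) / real n ^ ?D"
    using iffD2[OF eventually_sequentially_Suc q] eventually_gt_at_top[of 0]
  proof eventually_elim
    case (elim n)
    then show ?case using ge[of n] by (simp add: q1_def poly_pcompose field_simps)
  qed
  then have "1 / fact ?D \<le> coeff q1 ?D" by (intro tendsto_lowerbound[OF lim]) auto
  then show ?thesis using dq by (simp add: q1_def coeff_pcompose_shift field_simps)
qed

end


section \<open>Monomial ideals and their powers\<close>

text \<open>For a set \<open>S\<close> of exponents closed under adding vectors this is the monomial ideal with exponent set \<open>S\<close>;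
  for \<open>S = exps V\<close> it is the polynomial ring itself.\<close>

definition mono_set :: "(nat \<Rightarrow>\<^sub>0 nat) set \<Rightarrow> 'k::field mpoly set" where
  "mono_set S = {p. keys p \<subseteq> S}"

definition up_set :: "nat set \<Rightarrow> (nat \<Rightarrow>\<^sub>0 nat) set \<Rightarrow> bool" where
  "up_set V S \<longleftrightarrow> S \<subseteq> exps V \<and> (\<forall>u\<in>S. \<forall>b\<in>exps V. u + b \<in> S)"

lemma mono_set_iff: "p \<in> mono_set S \<longleftrightarrow> (\<forall>u. u \<notin> S \<longrightarrow> lookup p u = 0)"
  by (auto simp: mono_set_def in_keys_iff)

lemma mpoly_ring_simps [simp]:
  "carrier (mpoly_ring V) = mono_set (exps V)"
  "x \<otimes>\<^bsub>mpoly_ring V\<^esub> y = x * y" "x \<oplus>\<^bsub>mpoly_ring V\<^esub> y = x + y"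
  "\<zero>\<^bsub>mpoly_ring V\<^esub> = 0" "\<one>\<^bsub>mpoly_ring V\<^esub> = 1"
  by (auto simp: mpoly_ring_def mono_set_def exps_def)

lemma mono_set_zero [simp]: "0 \<in> mono_set S" by (simp add: mono_set_iff)

lemma mono_set_add: "p \<in> mono_set S \<Longrightarrow> q \<in> mono_set S \<Longrightarrow> p + q \<in> mono_set S"
  by (simp add: mono_set_iff lookup_add)

lemma mono_set_uminus: "p \<in> mono_set S \<Longrightarrow> - p \<in> mono_set S"
  by (simp add: mono_set_iff)

lemma mono_set_diff: "p \<in> mono_set S \<Longrightarrow> q \<in> mono_set S \<Longrightarrow> p - q \<in> mono_set S"
  by (simp add: mono_set_iff lookup_minus)

lemma mono_set_sum: "(\<And>x. x \<in> A \<Longrightarrow> f x \<in> mono_set S) \<Longrightarrow> sum f A \<in> mono_set S"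
  by (simp add: mono_set_iff lookup_sum)

lemma mono_set_mono: "S \<subseteq> T \<Longrightarrow> mono_set S \<subseteq> mono_set T"
  by (auto simp: mono_set_def)

lemma single_mono_set: "u \<in> S \<Longrightarrow> single u c \<in> mono_set S"
  by (auto simp: mono_set_iff lookup_single when_def)

lemma single_in_mono_set_iff: "c \<noteq> 0 \<Longrightarrow> single u c \<in> mono_set S \<longleftrightarrow> u \<in> S"
  by (auto simp: mono_set_def)

lemma mono_set_mult:
  assumes "p \<in> mono_set S" "q \<in> mono_set T" "\<And>s t. s \<in> S \<Longrightarrow> t \<in> T \<Longrightarrow> s + t \<in> X"
  shows "p * q \<in> mono_set X"
  using assms keys_mult[of p q] unfolding mono_set_def by blast

lemma monomial_expansion: "(p :: 'k::field mpoly) = (\<Sum>u\<in>keys p. single u (lookup p u))"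
proof (rule poly_mapping_eqI)
  fix k
  show "lookup p k = lookup (\<Sum>u\<in>keys p. single u (lookup p u)) k"
    by (simp add: lookup_sum lookup_single when_def in_keys_iff)
qed

lemma one_carrier: "1 \<in> mono_set (exps V)"
  using single_mono_set[of 0 "exps V" 1] by simp

lemma carrier_mult: "p \<in> mono_set (exps V) \<Longrightarrow> q \<in> mono_set (exps V) \<Longrightarrow> p * q \<in> mono_set (exps V)"
  by (rule mono_set_mult) (auto intro: exps_add)

lemma up_mult:
  assumes "up_set V S" "p \<in> mono_set S" "q \<in> mono_set (exps V)"
  shows "p * q \<in> mono_set S" "q * p \<in> mono_set S"
proof -
  show "p * q \<in> mono_set S" by (rule mono_set_mult[OF assms(2,3)]) (use assms(1) in \<open>simp add: up_set_def\<close>)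
  then show "q * p \<in> mono_set S" by (simp add: mult.commute)
qed

lemma mpoly_a_inv: "p \<in> mono_set (exps V) \<Longrightarrow> \<ominus>\<^bsub>mpoly_ring V\<^esub> p = - p"
proof -
  assume p: "p \<in> mono_set (exps V)"
  interpret cring "mpoly_ring V :: 'a mpoly ring" by (rule mpoly_ring_cring)
  show ?thesis by (rule minus_equality) (use p mono_set_uminus in auto)
qed

lemma mpoly_a_minus: "p \<in> mono_set (exps V) \<Longrightarrow> q \<in> mono_set (exps V) \<Longrightarrow> p \<ominus>\<^bsub>mpoly_ring V\<^esub> q = p - q"
  by (simp add: a_minus_def mpoly_a_inv)

lemma mpoly_pow: "p [^]\<^bsub>mpoly_ring V\<^esub> (n::nat) = p ^ n"
  by (induction n) (simp_all add: nat_pow_def power_Suc2 del: power_Suc)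

lemma carrier_power: "p \<in> mono_set (exps V) \<Longrightarrow> p ^ n \<in> mono_set (exps V)"
  by (induction n) (auto intro: one_carrier carrier_mult)

lemma mpoly_finsum:
  fixes f :: "'x \<Rightarrow> 'a::field mpoly"
  assumes "finite A" "\<And>x. x \<in> A \<Longrightarrow> f x \<in> mono_set (exps V)"
  shows "finsum (mpoly_ring V) f A = sum f A"
proof -
  interpret cring "mpoly_ring V :: 'a mpoly ring" by (rule mpoly_ring_cring)
  show ?thesis using assms
    by (induction A) (auto simp: finsum_insert Pi_def)
qed

lemma mono_set_ideal:
  assumes "up_set V S"
  shows "ideal (mono_set S) (mpoly_ring V :: 'k::field mpoly ring)"
proof (rule idealI)
  interpret cring "mpoly_ring V :: 'k mpoly ring" by (rule mpoly_ring_cring)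
  show "ring (mpoly_ring V :: 'k mpoly ring)" by (rule ring_axioms)
  have sub: "mono_set S \<subseteq> (mono_set (exps V) :: 'k mpoly set)"
    using assms by (intro mono_set_mono) (simp add: up_set_def)
  show "subgroup (mono_set S) (add_monoid (mpoly_ring V :: 'k mpoly ring))"
  proof (rule subgroup.intro)
    fix x :: "'k mpoly" assume x: "x \<in> mono_set S"
    have "inv\<^bsub>add_monoid (mpoly_ring V)\<^esub> x = - x"
      using mpoly_a_inv[OF subsetD[OF sub x]] unfolding a_inv_def .
    then show "inv\<^bsub>add_monoid (mpoly_ring V)\<^esub> x \<in> mono_set S"
      using mono_set_uminus[OF x] by (simp only:)
  qed (use sub mono_set_add in auto)
qed (use up_mult[OF assms] in auto)

lemma monomial_ideal_exponents:
  assumes "monomial_ideal V (I :: 'k::field mpoly set)"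
  obtains E where "up_set V E" "I = mono_set E"
proof -
  let ?R = "mpoly_ring V :: 'k mpoly ring"
  interpret cring ?R by (rule mpoly_ring_cring)
  obtain S where S: "S \<subseteq> exps V" "I = genideal ?R ((\<lambda>m. single m 1) ` S)"
    using assms unfolding monomial_ideal_def exps_def by blast
  define E where "E = {u + v | u v. u \<in> S \<and> v \<in> exps V}"
  have up: "up_set V E"
    using S(1) unfolding up_set_def E_def by (auto intro: exps_add simp: add.assoc) (metis add.assoc exps_add)
  have gens: "(\<lambda>m. single m (1::'k)) ` S \<subseteq> carrier ?R"
    using S(1) by (auto intro!: single_mono_set)
  have "I = mono_set E"
  proof
    have "(\<lambda>m. single m (1::'k)) ` S \<subseteq> mono_set E"
    proof
      fix p assume "p \<in> (\<lambda>m. single m (1::'k)) ` S"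
      then obtain m where m: "m \<in> S" "p = single m 1" by blast
      have "m + 0 \<in> E" unfolding E_def using m(1) exps_zero by blast
      then show "p \<in> mono_set E" using m by (simp add: single_mono_set)
    qed
    then show "I \<subseteq> mono_set E"
      unfolding S(2) using mono_set_ideal[OF up] by (rule genideal_minimal[rotated])
    have id: "ideal I ?R" unfolding S(2) by (rule genideal_ideal[OF gens])
    have mono: "single u c \<in> I" if "u \<in> E" for u and c :: 'k
    proof -
      obtain s v where sv: "s \<in> S" "v \<in> exps V" "u = s + v" using \<open>u \<in> E\<close> unfolding E_def by blast
      have "single s (1::'k) \<in> I" unfolding S(2) using genideal_self[OF gens] sv(1) by blast
      then have "single s (1::'k) \<otimes>\<^bsub>?R\<^esub> single v c \<in> I"
        by (rule ideal.I_r_closed[OF id]) (use sv in \<open>simp add: single_mono_set\<close>)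
      then show ?thesis using sv by (simp add: mult_single)
    qed
    show "mono_set E \<subseteq> I"
    proof
      fix p :: "'k mpoly" assume p: "p \<in> mono_set E"
      have "(\<Sum>u\<in>X. single u (lookup p u)) \<in> I" if "finite X" "X \<subseteq> E" for X
        using that
      proof (induction X)
        case empty
        show ?case using additive_subgroup.zero_closed[OF ideal.axioms(1)[OF id]] by simp
      next
        case (insert x X)
        then show ?case using additive_subgroup.a_closed[OF ideal.axioms(1)[OF id], of "single x (lookup p x)"] mono by simp
      qed
      then have "(\<Sum>u\<in>keys p. single u (lookup p u)) \<in> I" using p by (auto simp: mono_set_def)
      then show "p \<in> I" using monomial_expansion[of p] by simp
    qed
  qed
  then show ?thesis using that up by blast
qed

lemma ideal_prod_mono_set:
  "ideal_prod (mpoly_ring V) (mono_set S) (mono_set T) = (mono_set {s + t | s t. s \<in> S \<and> t \<in> T} :: 'k::field mpoly set)"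
proof
  show "ideal_prod (mpoly_ring V) (mono_set S) (mono_set T) \<subseteq> (mono_set {s + t | s t. s \<in> S \<and> t \<in> T} :: 'k mpoly set)"
  proof
    fix p :: "'k mpoly" assume "p \<in> ideal_prod (mpoly_ring V) (mono_set S) (mono_set T)"
    then show "p \<in> mono_set {s + t | s t. s \<in> S \<and> t \<in> T}"
    proof (induction rule: ideal_prod.induct)
      case (prod i j)
      then show ?case by (auto intro: mono_set_mult)
    next
      case (sum s1 s2)
      then show ?case by (simp add: mono_set_add)
    qed
  qed
  show "(mono_set {s + t | s t. s \<in> S \<and> t \<in> T} :: 'k mpoly set) \<subseteq> ideal_prod (mpoly_ring V) (mono_set S) (mono_set T)"
  proof
    let ?P = "ideal_prod (mpoly_ring V) (mono_set S) (mono_set T) :: 'k mpoly set"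
    fix p :: "'k mpoly" assume p: "p \<in> mono_set {s + t | s t. s \<in> S \<and> t \<in> T}"
    have "(\<Sum>u\<in>X. single u (lookup p u)) \<in> ?P" if "finite X" "X \<subseteq> {s + t | s t. s \<in> S \<and> t \<in> T}" for X
      using that
    proof (induction X)
      case empty
      show ?case using ideal_prod.prod[of 0 "mono_set S" 0 "mono_set T" "mpoly_ring V :: 'k mpoly ring"] by simp
    next
      case (insert x X)
      then obtain s t where st: "s \<in> S" "t \<in> T" "x = s + t" by auto
      have "single s (lookup p x) \<otimes>\<^bsub>mpoly_ring V\<^esub> single t 1 \<in> ?P"
        by (rule ideal_prod.prod) (use st in \<open>auto intro: single_mono_set\<close>)
      then have "single x (lookup p x) \<in> ?P" using st by (simp add: mult_single)
      then show ?case using insert ideal_prod.sum[of "single x (lookup p x)" "mpoly_ring V" "mono_set S" "mono_set T"] by simp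
    qed
    then have "(\<Sum>u\<in>keys p. single u (lookup p u)) \<in> ?P" using p by (auto simp: mono_set_def)
    then show "p \<in> ?P" using monomial_expansion[of p] by simp
  qed
qed

lemma ideal_power_mono_set: "ideal_power (mpoly_ring V) (mono_set E) n = mono_set (power_exps V E n)"
proof (induction n)
  case 0
  show ?case by (simp add: nat_pow_def ideals_set_def)
next
  case (Suc n)
  then show ?case by (simp add: nat_pow_def ideals_set_def ideal_prod_mono_set)
qed

lemma mvar_power: "(mvar j :: 'k::field mpoly) ^ k = single (scale k (single j 1)) 1"
  by (induction k) (simp_all add: mvar_def scale_Suc mult_single add.commute)

lemma subst_zero_eq:
  "subst_zero i p = (\<Sum>m\<in>{m \<in> keys p. lookup m i = 0}. single m (lookup p m))"
proof -
  have prod: "(\<Prod>j\<in>keys m. (if j = i then 0 else mvar j) ^ lookup m j)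
      = (if lookup m i = 0 then single m 1 else (0 :: 'a mpoly))" for m
  proof (cases "lookup m i = 0")
    case True
    then have "(\<Prod>j\<in>keys m. (if j = i then 0 else mvar j) ^ lookup m j)
      = (\<Prod>j\<in>keys m. single (scale (lookup m j) (single j 1)) (1::'a))"
      by (intro prod.cong refl) (auto simp: mvar_power in_keys_iff)
    also have "\<dots> = single (\<Sum>j\<in>keys m. scale (lookup m j) (single j 1)) 1"
    proof -
      have "(\<Prod>j\<in>X. single (g j) (1::'a)) = single (\<Sum>j\<in>X. g j) 1" if "finite X" for X and g :: "nat \<Rightarrow> nat \<Rightarrow>\<^sub>0 nat"
        using that by (induction X) (auto simp: mult_single)
      then show ?thesis by simp
    qed
    also have "(\<Sum>j\<in>keys m. scale (lookup m j) (single j 1)) = m"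
    proof (rule poly_mapping_eqI)
      fix k
      have "(\<Sum>j\<in>keys m. lookup m j * (if j = k then 1 else 0)) = lookup m k"
        by (simp add: if_distrib[of "(*) _"] in_keys_iff cong: if_cong)
      then show "lookup (\<Sum>j\<in>keys m. scale (lookup m j) (single j 1)) k = lookup m k"
        by (simp add: lookup_sum lookup_single when_def del: One_nat_def)
    qed
    finally show ?thesis using True by simp
  next
    case False
    then have "(\<Prod>j\<in>keys m. (if j = i then 0 else mvar j) ^ lookup m j) = (0 :: 'a mpoly)"
      by (intro prod_zero) (auto simp: in_keys_iff intro!: bexI[of _ i])
    then show ?thesis using False by simp
  qed
  have "subst_zero i p = (\<Sum>m\<in>keys p. if lookup m i = 0 then single m (lookup p m) else 0)"
    unfolding subst_zero_def prod by (intro sum.cong refl) (simp add: mult_single)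
  then show ?thesis by (simp add: sum.inter_filter)
qed

lemma subst_zero_image:
  assumes "E \<subseteq> exps V"
  shows "subst_zero i ` mono_set E = (mono_set (E \<inter> exps (V - {i})) :: 'k::field mpoly set)"
proof
  show "subst_zero i ` mono_set E \<subseteq> (mono_set (E \<inter> exps (V - {i})) :: 'k mpoly set)"
  proof
    fix q :: "'k mpoly" assume "q \<in> subst_zero i ` mono_set E"
    then obtain p :: "'k mpoly" where p: "p \<in> mono_set E" "q = subst_zero i p" by blast
    have "m \<in> E \<inter> exps (V - {i})" if "m \<in> keys p" "lookup m i = 0" for m
    proof -
      have "m \<in> E" "m \<in> exps V" using that(1) p(1) assms by (auto simp: mono_set_def)
      then show ?thesis using that(2) by (auto simp: exps_iff)
    qed
    then show "q \<in> mono_set (E \<inter> exps (V - {i}))"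
      unfolding p subst_zero_eq by (intro mono_set_sum single_mono_set) simp
  qed
  show "(mono_set (E \<inter> exps (V - {i})) :: 'k mpoly set) \<subseteq> subst_zero i ` mono_set E"
  proof
    fix p :: "'k mpoly" assume p: "p \<in> mono_set (E \<inter> exps (V - {i}))"
    then have "{m \<in> keys p. lookup m i = 0} = keys p"
      by (auto simp: mono_set_def exps_iff)
    then have "subst_zero i p = p" unfolding subst_zero_eq using monomial_expansion[of p] by simp
    moreover have "p \<in> mono_set E" using p by (auto simp: mono_set_def)
    ultimately show "p \<in> subst_zero i ` mono_set E" by (metis imageI)
  qed
qed

section \<open>Zero-dimensional monomial ideals\<close>

text \<open>The ideal generated by the variables outside \<open>W\<close>. If neither factor lies in it, then the parts of the
  factors in the variables of \<open>W\<close> are nonzero, hence so is their product, which is the corresponding part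
  of the product.\<close>

lemma face_prime:
  assumes "W \<subseteq> V"
  shows "primeideal (mono_set (exps V - exps W)) (mpoly_ring V :: 'k::field mpoly ring)"
proof (rule primeidealI)
  have up: "up_set V (exps V - exps W)" unfolding up_set_def by (auto simp: exps_add_iff)
  show "ideal (mono_set (exps V - exps W)) (mpoly_ring V :: 'k mpoly ring)" by (rule mono_set_ideal[OF up])
  show "cring (mpoly_ring V :: 'k mpoly ring)" by (rule mpoly_ring_cring)
  have "(1 :: 'k mpoly) \<notin> mono_set (exps V - exps W)"
    by (auto simp: mono_set_iff lookup_one intro!: exI[of _ 0])
  then show "carrier (mpoly_ring V :: 'k mpoly ring) \<noteq> mono_set (exps V - exps W)"
    using one_carrier[of V] by auto
  fix a b :: "'k mpoly"
  assume a: "a \<in> carrier (mpoly_ring V)" and b: "b \<in> carrier (mpoly_ring V)"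
    and ab: "a \<otimes>\<^bsub>mpoly_ring V\<^esub> b \<in> mono_set (exps V - exps W)"
  define part where "part = (\<lambda>p :: 'k mpoly. \<Sum>u\<in>{u \<in> keys p. u \<in> exps W}. single u (lookup p u))"
  have lk_part: "lookup (part p) u = (if u \<in> exps W then lookup p u else 0)" for p u
    by (simp add: part_def lookup_sum lookup_single when_def in_keys_iff)
  have p1: "part p \<in> mono_set (exps W)" for p by (simp add: mono_set_iff lk_part)
  have p2: "p - part p \<in> mono_set (exps V - exps W)" if "p \<in> mono_set (exps V)" for p
    using that by (auto simp: mono_set_iff lookup_minus lk_part)
  have "part a * part b \<in> mono_set (exps W)" by (rule mono_set_mult[OF p1 p1]) (rule exps_add)
  moreover have "part a * part b \<in> mono_set (exps V - exps W)"
  proof -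
    have "part a * part b = a * b - (a - part a) * b - part a * (b - part b)" by (simp add: algebra_simps)
    moreover have "(a - part a) * b \<in> mono_set (exps V - exps W)"
      using up_mult(1)[OF up p2] a b by simp
    moreover have "part a * (b - part b) \<in> mono_set (exps V - exps W)"
      using up_mult(2)[OF up p2, of b "part a"] b p1[of a] mono_set_mono[OF exps_mono[OF assms]] by auto
    ultimately show ?thesis using ab by (simp add: mono_set_diff)
  qed
  ultimately have "part a * part b = 0" by (intro poly_mapping_eqI) (auto simp: mono_set_iff)
  then have "part a = 0 \<or> part b = 0" by simp
  then show "a \<in> mono_set (exps V - exps W) \<or> b \<in> mono_set (exps V - exps W)"
    using p2[of a] p2[of b] a b by auto
qed

lemma prime_quotient:
  assumes J: "ideal J R" and P: "primeideal P R" and JP: "J \<subseteq> P"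
  shows "primeideal ((+>\<^bsub>R\<^esub>) J ` P) (R Quot J)"
    and "\<And>x. x \<in> carrier R \<Longrightarrow> J +>\<^bsub>R\<^esub> x \<in> (+>\<^bsub>R\<^esub>) J ` P \<longleftrightarrow> x \<in> P"
proof -
  interpret P: primeideal P R by fact
  interpret J: ideal J R by fact
  show mem: "J +>\<^bsub>R\<^esub> x \<in> (+>\<^bsub>R\<^esub>) J ` P \<longleftrightarrow> x \<in> P" if x: "x \<in> carrier R" for x
  proof
    assume "J +>\<^bsub>R\<^esub> x \<in> (+>\<^bsub>R\<^esub>) J ` P"
    then obtain y where y: "y \<in> P" "J +>\<^bsub>R\<^esub> x = J +>\<^bsub>R\<^esub> y" by blast
    then have "x \<ominus>\<^bsub>R\<^esub> y \<in> J" using P.quotient_eq_iff_same_a_r_cos[OF J x] P.Icarr by blast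
    then have "x \<ominus>\<^bsub>R\<^esub> y \<oplus>\<^bsub>R\<^esub> y \<in> P" using JP y by auto
    moreover have "x \<ominus>\<^bsub>R\<^esub> y \<oplus>\<^bsub>R\<^esub> y = x"
      using x P.Icarr[OF y(1)] by (simp add: a_minus_def P.a_assoc P.l_neg)
    ultimately show "x \<in> P" by simp
  qed auto
  have carr: "carrier (R Quot J) = (+>\<^bsub>R\<^esub>) J ` carrier R"
    by (auto simp: FactRing_def A_RCOSETS_def')
  show "primeideal ((+>\<^bsub>R\<^esub>) J ` P) (R Quot J)"
  proof (rule primeidealI)
    show "ideal ((+>\<^bsub>R\<^esub>) J ` P) (R Quot J)"
      by (rule P.ring_ideal_imp_quot_ideal[OF J]) (rule P.is_ideal)
    show "cring (R Quot J)" by (rule J.quotient_is_cring) (rule P.is_cring)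
    obtain x where "x \<in> carrier R" "x \<notin> P" using P.I_notcarr P.a_subset by blast
    then have "J +>\<^bsub>R\<^esub> x \<notin> (+>\<^bsub>R\<^esub>) J ` P" using mem by simp
    moreover have "J +>\<^bsub>R\<^esub> x \<in> carrier (R Quot J)"
      unfolding carr using \<open>x \<in> carrier R\<close> by (rule imageI)
    ultimately show "carrier (R Quot J) \<noteq> (+>\<^bsub>R\<^esub>) J ` P" by metis
    fix a b assume "a \<in> carrier (R Quot J)" "b \<in> carrier (R Quot J)"
      and ab: "a \<otimes>\<^bsub>R Quot J\<^esub> b \<in> (+>\<^bsub>R\<^esub>) J ` P"
    then obtain x y where xy: "x \<in> carrier R" "y \<in> carrier R" "a = J +>\<^bsub>R\<^esub> x" "b = J +>\<^bsub>R\<^esub> y"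
      unfolding carr by blast
    have "a \<otimes>\<^bsub>R Quot J\<^esub> b = J +>\<^bsub>R\<^esub> (x \<otimes>\<^bsub>R\<^esub> y)"
      using xy by (simp add: FactRing_def J.rcoset_mult_add)
    then have "x \<otimes>\<^bsub>R\<^esub> y \<in> P" using ab mem[of "x \<otimes>\<^bsub>R\<^esub> y"] xy by simp
    then show "a \<in> (+>\<^bsub>R\<^esub>) J ` P \<or> b \<in> (+>\<^bsub>R\<^esub>) J ` P" using P.I_prime xy by auto
  qed
qed

lemma krull_dim_0D:
  assumes "krull_dim A = 0"
  shows "\<exists>P. primeideal P A" and "\<And>P Q. primeideal P A \<Longrightarrow> primeideal Q A \<Longrightarrow> \<not> P \<subset> Q"
proof -
  define N where "N = {n. \<exists>P. (\<forall>i\<le>n. primeideal (P i) A) \<and> (\<forall>i<n. P i \<subset> P (Suc i))}"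
  have dim: "(SUP n\<in>N. ereal (real n)) = 0" using assms unfolding krull_dim_def N_def .
  have "N \<noteq> {}"
  proof
    assume "N = {}"
    then have "(SUP n\<in>N. ereal (real n)) = bot" by simp
    then show False using dim by (simp add: bot_ereal_def)
  qed
  then obtain n where "n \<in> N" by (meson ex_in_conv)
  then obtain P where "\<forall>i\<le>n. primeideal (P i) A" unfolding N_def by auto
  then have "primeideal (P 0) A" by simp
  then show "\<exists>P. primeideal P A" ..
  fix P Q assume PQ: "primeideal P A" "primeideal Q A"
  show "\<not> P \<subset> Q"
  proof
    assume "P \<subset> Q"
    then have "(1::nat) \<in> N" unfolding N_def using PQ
      by (intro CollectI exI[of _ "\<lambda>n. if n = 0 then P else Q"]) auto
    then have "ereal (real 1) \<le> (SUP n\<in>N. ereal (real n))" by (intro SUP_upper)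
    then show False using dim by simp
  qed
qed

text \<open>If no power of \<open>x\<^sub>i\<close> belongs to the ideal, then the ideal is contained in the prime generated by the
  other variables, which is strictly smaller than the maximal ideal of the origin; so the dimension is
  positive. If the ideal is the whole ring, the quotient has no prime ideal.\<close>

lemma zero_dim_exponents:
  fixes E :: "(nat \<Rightarrow>\<^sub>0 nat) set"
  assumes up: "up_set V E" and finV: "finite V"
    and dim: "krull_dim ((mpoly_ring V :: 'k::field mpoly ring) Quot mono_set E) = 0"
  shows "0 \<notin> E" "\<exists>K. \<forall>i\<in>V. single i K \<in> E"
proof -
  let ?R = "mpoly_ring V :: 'k mpoly ring" and ?J = "mono_set E :: 'k mpoly set"
  let ?Q = "?R Quot ?J"
  interpret R: cring ?R by (rule mpoly_ring_cring)
  have J: "ideal ?J ?R" by (rule mono_set_ideal[OF up])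
  interpret J: ideal ?J ?R by (rule J)
  have E_sub: "E \<subseteq> exps V" using up by (simp add: up_set_def)
  note chain = krull_dim_0D[OF dim]
  show z: "0 \<notin> E"
  proof
    assume "0 \<in> E"
    then have "E = exps V" using up unfolding up_set_def by (metis add_0 subsetI subset_antisym)
    then have JR: "?J = carrier ?R" by simp
    obtain P where P: "primeideal P ?Q" using chain(1) by blast
    interpret P: primeideal P ?Q by (rule P)
    have "carrier ?Q \<subseteq> {?J}"
    proof
      fix X assume "X \<in> carrier ?Q"
      then obtain x where "x \<in> carrier ?R" "X = ?J +>\<^bsub>?R\<^esub> x" by (auto simp: FactRing_def A_RCOSETS_def')
      then show "X \<in> {?J}" using J.a_rcos_const[of x] JR by simp
    qed
    moreover have "\<zero>\<^bsub>?Q\<^esub> \<in> P" by simp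
    then have "?J \<in> P" by (simp add: FactRing_def)
    ultimately show False using P.I_notcarr P.a_subset by blast
  qed
  have pure: "\<exists>k. single i k \<in> E" if i: "i \<in> V" for i
  proof (rule ccontr)
    assume no: "\<not> ?thesis"
    have sub: "E \<subseteq> exps V - exps {i}"
    proof
      fix u assume u: "u \<in> E"
      have "u \<notin> exps {i}"
      proof
        assume "u \<in> exps {i}"
        then have "u = single i (lookup u i)"
          by (intro poly_mapping_eqI) (auto simp: exps_iff lookup_single when_def)
        then show False using no u by metis
      qed
      then show "u \<in> exps V - exps {i}" using u E_sub by blast
    qed
    have exps_empty: "exps {} = {0 :: nat \<Rightarrow>\<^sub>0 nat}" by (auto simp: exps_def)
    let ?P0 = "mono_set (exps V - exps {i}) :: 'k mpoly set" and ?P1 = "mono_set (exps V - exps {}) :: 'k mpoly set"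
    have P0: "primeideal ?P0 ?R" by (rule face_prime) (use i in auto)
    have P1: "primeideal ?P1 ?R" by (rule face_prime) auto
    have sub1: "exps V - exps {i} \<subseteq> exps V - exps {}" using exps_mono[of "{}" "{i}"] by blast
    have J0: "?J \<subseteq> ?P0" by (rule mono_set_mono[OF sub])
    have J1: "?J \<subseteq> ?P1" by (rule mono_set_mono) (use sub sub1 in blast)
    let ?x = "single (single i 1) 1 :: 'k mpoly"
    have xV: "single i (1::nat) \<in> exps V" "single i (1::nat) \<in> exps {i}" using i by (auto simp: exps_iff lookup_single when_def)
    have x0: "single i (1::nat) \<noteq> 0" by (metis lookup_single_eq lookup_zero zero_neq_one)
    have x: "?x \<in> carrier ?R" "?x \<in> ?P1" "?x \<notin> ?P0"
      using xV x0 by (simp_all add: single_in_mono_set_iff exps_empty del: One_nat_def)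
    have "(+>\<^bsub>?R\<^esub>) ?J ` ?P0 \<subset> (+>\<^bsub>?R\<^esub>) ?J ` ?P1"
    proof
      show "(+>\<^bsub>?R\<^esub>) ?J ` ?P0 \<subseteq> (+>\<^bsub>?R\<^esub>) ?J ` ?P1" by (intro image_mono mono_set_mono sub1)
      show "(+>\<^bsub>?R\<^esub>) ?J ` ?P0 \<noteq> (+>\<^bsub>?R\<^esub>) ?J ` ?P1"
        using prime_quotient(2)[OF J P0 J0 x(1)] x(2,3) by blast
    qed
    then show False
      using chain(2)[OF prime_quotient(1)[OF J P0 J0] prime_quotient(1)[OF J P1 J1]] by blast
  qed
  then obtain k where k: "\<And>i. i \<in> V \<Longrightarrow> single i (k i) \<in> E" by metis
  have "single i (Max (k ` V)) \<in> E" if i: "i \<in> V" for i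
  proof -
    have le: "k i \<le> Max (k ` V)" using i finV by simp
    have "single i (k i) + single i (Max (k ` V) - k i) \<in> E"
      using up k[OF i] i unfolding up_set_def by (auto simp: exps_iff lookup_single when_def)
    then show ?thesis using le by (simp flip: single_add)
  qed
  then show "\<exists>K. \<forall>i\<in>V. single i K \<in> E" by blast
qed

section \<open>The length of a monomial quotient\<close>

definition subspace_like :: "nat set \<Rightarrow> 'k::field mpoly set \<Rightarrow> bool" where
  "subspace_like V A \<longleftrightarrow> A \<subseteq> mono_set (exps V) \<and> (\<forall>p\<in>A. \<forall>q\<in>A. p + q \<in> A) \<and>
    (\<forall>p\<in>A. \<forall>c. single 0 c * p \<in> A)"

text \<open>Leading monomials modulo the monomial ideal with exponent set \<open>S\<close>, for the linear order that the type of
  finitely supported functions carries.\<close>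

definition initials :: "(nat \<Rightarrow>\<^sub>0 nat) set \<Rightarrow> 'k::field mpoly set \<Rightarrow> (nat \<Rightarrow>\<^sub>0 nat) set" where
  "initials S A = {u. \<exists>p\<in>A. u \<in> keys p - S \<and> (\<forall>w\<in>keys p - S. w \<le> u)}"

lemma initials_mono: "A \<subseteq> B \<Longrightarrow> initials S A \<subseteq> initials S B"
  unfolding initials_def by blast

lemma initials_sub: "A \<subseteq> mono_set (exps V) \<Longrightarrow> initials S A \<subseteq> exps V - S"
  by (auto simp: initials_def mono_set_def)

lemma lookup_scalar: "lookup (single 0 c * p) u = c * lookup (p :: 'k::field mpoly) u"
  unfolding mult_map_scale_conv_mult[symmetric] by (simp add: Poly_Mapping.map.rep_eq when_def)

text \<open>Division with remainder: subtract a multiple of an element of \<open>A\<close> with the same leading monomial, and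
  induct on the number of exponents outside \<open>S\<close> below the leading one.\<close>

lemma eq_of_initials_eq:
  fixes A B :: "'k::field mpoly set"
  assumes A: "subspace_like V A" and B: "subspace_like V B" and AB: "A \<subseteq> B"
    and J: "mono_set S \<subseteq> A" and fin: "finite (exps V - S)" and init: "initials S B \<subseteq> initials S A"
  shows "B \<subseteq> A"
proof
  fix p assume "p \<in> B"
  then show "p \<in> A"
  proof (induction "card {w \<in> exps V - S. \<exists>x\<in>keys p - S. w \<le> x}" arbitrary: p rule: less_induct)
    case less
    let ?below = "\<lambda>p :: 'k mpoly. {w \<in> exps V - S. \<exists>x\<in>keys p - S. w \<le> x}"
    show ?case
    proof (cases "keys p - S = {}")
      case True
      then have "p \<in> mono_set S" by (auto simp: mono_set_def)
      then show ?thesis using J by blast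
    next
      case False
      define u where "u = Max (keys p - S)"
      have u: "u \<in> keys p - S" "\<And>w. w \<in> keys p - S \<Longrightarrow> w \<le> u"
        unfolding u_def by (rule Max_in) (use False in auto)
      have "u \<in> initials S B" unfolding initials_def using u less.prems by blast
      then obtain q where q: "q \<in> A" "u \<in> keys q - S" "\<And>w. w \<in> keys q - S \<Longrightarrow> w \<le> u"
        using init unfolding initials_def by blast
      define c where "c = lookup p u / lookup q u"
      define r where "r = p + single 0 (- c) * q"
      have lkr: "lookup r w = lookup p w - c * lookup q w" for w by (simp add: r_def lookup_add lookup_scalar)
      have rB: "r \<in> B" using less.prems q(1) AB B unfolding r_def subspace_like_def by blast
      have r0: "lookup r u = 0" using q(2) by (simp add: lkr c_def in_keys_iff)
      have rlt: "w < u" if "w \<in> keys r - S" for w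
      proof -
        have "w \<noteq> u" using that r0 by (auto simp: in_keys_iff)
        moreover have "w \<in> keys p - S \<or> w \<in> keys q - S"
          using that lkr[of w] by (auto simp: in_keys_iff)
        ultimately show ?thesis using u(2) q(3) by (metis order_le_imp_less_or_eq)
      qed
      have uV: "u \<in> exps V - S" using u(1) less.prems B by (auto simp: subspace_like_def mono_set_def)
      have "?below r \<subset> ?below p"
      proof
        show "?below r \<subseteq> ?below p"
        proof
          fix x assume "x \<in> ?below r"
          then obtain y where y: "x \<in> exps V - S" "y \<in> keys r - S" "x \<le> y" by blast
          then have "x \<le> u" using rlt[OF y(2)] by simp
          then show "x \<in> ?below p" using y(1) u(1) by blast
        qed
        have "u \<in> ?below p" using uV u(1) by blast
        moreover have "u \<notin> ?below r" using rlt by (auto simp: not_le)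
        ultimately show "?below r \<noteq> ?below p" by blast
      qed
      then have "card (?below r) < card (?below p)" 
        by (intro psubset_card_mono rev_finite_subset[OF fin]) auto
      then have "r \<in> A" using less.hyps rB by blast
      then have "r + single 0 c * q \<in> A" using A q(1) unfolding subspace_like_def by blast
      moreover have "r + single 0 c * q = p"
        by (rule poly_mapping_eqI) (simp add: lookup_add lookup_scalar lkr)
      ultimately show ?thesis by simp
    qed
  qed
qed

text \<open>Adding to \<open>S\<close> a missing vector of maximal total degree keeps it closed under adding vectors.\<close>

lemma up_set_chain:
  assumes "up_set V S" "finite V" "finite (exps V - S)"
  shows "\<exists>T. T 0 = S \<and> (\<forall>i\<le>card (exps V - S). up_set V (T i) \<and> S \<subseteq> T i) \<and>
    (\<forall>i<card (exps V - S). T i \<subset> T (Suc i))"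
  using assms
proof (induction "card (exps V - S)" arbitrary: S)
  case 0
  show ?case unfolding 0(1)[symmetric] using 0(2) by (intro exI[of _ "\<lambda>_. S"]) simp
next
  case (Suc m)
  define deg where "deg = total_deg V"
  have ne: "exps V - S \<noteq> {}" using Suc.hyps(2) by (metis card.empty nat.distinct(1))
  obtain u where u: "u \<in> exps V - S" "\<And>w. w \<in> exps V - S \<Longrightarrow> deg w \<le> deg u"
  proof -
    have "Max (deg ` (exps V - S)) \<in> deg ` (exps V - S)"
      by (rule Max_in) (use ne Suc.prems(3) in simp_all)
    then obtain u where "u \<in> exps V - S" "deg u = Max (deg ` (exps V - S))" by (metis imageE)
    moreover have "deg w \<le> Max (deg ` (exps V - S))" if "w \<in> exps V - S" for w
      by (rule Max_ge) (use that Suc.prems(3) in simp_all)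
    ultimately show ?thesis using that by simp
  qed
  have upu: "up_set V (insert u S)"
    unfolding up_set_def
  proof (intro conjI ballI)
    show "insert u S \<subseteq> exps V" using u(1) Suc.prems(1) by (auto simp: up_set_def)
    fix w b assume w: "w \<in> insert u S" and b: "b \<in> exps V"
    show "w + b \<in> insert u S"
    proof (cases "w \<in> S")
      case True
      then show ?thesis using Suc.prems(1) b by (auto simp: up_set_def)
    next
      case False
      then have wu: "w = u" using w by simp
      show ?thesis
      proof (cases "b = 0")
        case False
        then obtain i where "lookup b i \<noteq> 0" by (metis lookup_zero poly_mapping_eqI)
        moreover from this have "i \<in> V" using b by (auto simp: exps_iff)
        ultimately have "deg b \<noteq> 0" using Suc.prems(2) by (auto simp: deg_def total_deg_def)
        then have "deg (u + b) > deg u" by (simp add: deg_def total_deg_def lookup_add sum.distrib)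
        then have "u + b \<notin> exps V - S" using u(2) by (meson not_le)
        then show ?thesis using wu u(1) b exps_add by auto
      qed (use wu in simp)
    qed
  qed
  have eq: "exps V - S = insert u (exps V - insert u S)" using u(1) by blast
  have fin: "finite (exps V - insert u S)" using Suc.prems(3) by (rule rev_finite_subset) auto
  have "card (exps V - S) = card (insert u (exps V - insert u S))" using eq by (rule arg_cong)
  also have "\<dots> = Suc (card (exps V - insert u S))" using fin by (rule card_insert_disjoint) simp
  finally have m: "m = card (exps V - insert u S)" using Suc.hyps(2) by simp
  obtain T where T: "T 0 = insert u S" "\<forall>i\<le>m. up_set V (T i) \<and> insert u S \<subseteq> T i" "\<forall>i<m. T i \<subset> T (Suc i)"
    using Suc.hyps(1)[OF m upu Suc.prems(2) fin] unfolding m[symmetric] by blast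
  show ?case unfolding Suc.hyps(2)[symmetric]
  proof (intro exI[of _ "case_nat S T"] conjI allI impI)
    fix i
    show "case_nat S T 0 = S" by simp
    show "up_set V (case_nat S T i)" "S \<subseteq> case_nat S T i" if "i \<le> Suc m"
    proof -
      have "up_set V (case_nat S T i) \<and> S \<subseteq> case_nat S T i"
      proof (cases i)
        case 0
        then show ?thesis using Suc.prems(1) by simp
      next
        case (Suc j)
        then have "up_set V (T j) \<and> insert u S \<subseteq> T j" using T(2) that by simp
        then show ?thesis using Suc by simp
      qed
      then show "up_set V (case_nat S T i)" "S \<subseteq> case_nat S T i" by blast+
    qed
    show "case_nat S T i \<subset> case_nat S T (Suc i)" if "i < Suc m"
    proof (cases i)
      case 0
      then show ?thesis using T(1) u(1) by auto
    next
      case (Suc j)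
      then show ?thesis using T(3) that by simp
    qed
  qed
qed

text \<open>For the quotient of the polynomial ring by the monomial ideal with exponent set \<open>S\<close>, submodules are
  compared with their preimages \<open>pull N\<close> in the ring. Chains of exponent sets provide a chain of length
  \<open>card (exps V - S)\<close>; conversely the sets of leading monomials outside \<open>S\<close> grow strictly along every
  strict chain.\<close>

context
  fixes V :: "nat set" and S :: "(nat \<Rightarrow>\<^sub>0 nat) set" and R :: "'k::field mpoly ring"
    and J :: "'k mpoly set"
  assumes up: "up_set V S" and finV: "finite V" and fin: "finite (exps V - S)"
  defines "R \<equiv> mpoly_ring V" and "J \<equiv> mono_set S"
begin

interpretation R: cring R unfolding R_def by (rule mpoly_ring_cring)
interpretation J: ideal J R unfolding R_def J_def by (rule mono_set_ideal[OF up])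

lemma R_simps: "carrier R = mono_set (exps V)" "x \<otimes>\<^bsub>R\<^esub> y = x * y" "x \<oplus>\<^bsub>R\<^esub> y = x + y" "\<zero>\<^bsub>R\<^esub> = 0"
  by (simp_all add: R_def)

lemma quot_simps:
  shows "carrier (quot_module R J) = (+>\<^bsub>R\<^esub>) J ` mono_set (exps V)"
    and "\<zero>\<^bsub>quot_module R J\<^esub> = J +>\<^bsub>R\<^esub> 0"
    and "p \<in> mono_set (exps V) \<Longrightarrow> q \<in> mono_set (exps V) \<Longrightarrow>
      (J +>\<^bsub>R\<^esub> p) \<oplus>\<^bsub>quot_module R J\<^esub> (J +>\<^bsub>R\<^esub> q) = J +>\<^bsub>R\<^esub> (p + q)"
    and "r \<in> mono_set (exps V) \<Longrightarrow> p \<in> mono_set (exps V) \<Longrightarrow>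
      r \<odot>\<^bsub>quot_module R J\<^esub> (J +>\<^bsub>R\<^esub> p) = J +>\<^bsub>R\<^esub> (r * p)"
proof -
  show "carrier (quot_module R J) = (+>\<^bsub>R\<^esub>) J ` mono_set (exps V)"
    by (auto simp: quot_module_def FactRing_def A_RCOSETS_def' R_simps)
  have "J = J +>\<^bsub>R\<^esub> \<zero>\<^bsub>R\<^esub>"
    using R.a_rcos_zero[OF J.is_ideal J.zero_closed] by simp
  then show "\<zero>\<^bsub>quot_module R J\<^esub> = J +>\<^bsub>R\<^esub> 0" by (simp add: quot_module_def FactRing_def R_simps)
  show "(J +>\<^bsub>R\<^esub> p) \<oplus>\<^bsub>quot_module R J\<^esub> (J +>\<^bsub>R\<^esub> q) = J +>\<^bsub>R\<^esub> (p + q)"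
    if "p \<in> mono_set (exps V)" "q \<in> mono_set (exps V)"
    using J.a_rcos_sum[of p q] that by (simp add: quot_module_def FactRing_def R_simps)
  show "r \<odot>\<^bsub>quot_module R J\<^esub> (J +>\<^bsub>R\<^esub> p) = J +>\<^bsub>R\<^esub> (r * p)"
    if "r \<in> mono_set (exps V)" "p \<in> mono_set (exps V)"
    using J.rcoset_mult_add[of r p] that by (simp add: quot_module_def FactRing_def R_simps)
qed

lemma coset_eq_iff:
  assumes "p \<in> mono_set (exps V)" "q \<in> mono_set (exps V)"
  shows "J +>\<^bsub>R\<^esub> p = J +>\<^bsub>R\<^esub> q \<longleftrightarrow> p - q \<in> J"
  using R.quotient_eq_iff_same_a_r_cos[OF J.is_ideal, of p q] assms mpoly_a_minus[OF assms]
  by (simp add: R_def)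

definition pull :: "'k mpoly set set \<Rightarrow> 'k mpoly set" where
  "pull N = {p \<in> mono_set (exps V). J +>\<^bsub>R\<^esub> p \<in> N}"

lemma pull_submodule:
  assumes "submodule N R (quot_module R J)"
  shows "subspace_like V (pull N)" "mono_set S \<subseteq> pull N" "N = (+>\<^bsub>R\<^esub>) J ` pull N"
proof -
  interpret N: submodule N R "quot_module R J" by fact
  have zero: "J +>\<^bsub>R\<^esub> 0 \<in> N" using N.one_closed by (simp add: quot_simps)
  have add: "x \<in> N \<Longrightarrow> y \<in> N \<Longrightarrow> x \<oplus>\<^bsub>quot_module R J\<^esub> y \<in> N" for x y using N.m_closed by simp
  have cst: "single 0 c \<in> mono_set (exps V)" for c :: 'k by (rule single_mono_set) simp
  show "subspace_like V (pull N)"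
    unfolding subspace_like_def
  proof (intro conjI ballI allI)
    show "pull N \<subseteq> mono_set (exps V)" by (auto simp: pull_def)
    show "p + q \<in> pull N" if "p \<in> pull N" "q \<in> pull N" for p q
      using that add[of "J +>\<^bsub>R\<^esub> p" "J +>\<^bsub>R\<^esub> q"] by (simp add: pull_def quot_simps mono_set_add)
    show "single 0 c * p \<in> pull N" if "p \<in> pull N" for p c
      using that N.smult_closed[of "single 0 c" "J +>\<^bsub>R\<^esub> p"] cst[of c]
      by (simp add: pull_def quot_simps R_simps carrier_mult)
  qed
  show "mono_set S \<subseteq> pull N"
  proof
    fix p :: "'k mpoly" assume p: "p \<in> mono_set S"
    then have pV: "p \<in> mono_set (exps V)" using up mono_set_mono unfolding up_set_def by blast
    then have "J +>\<^bsub>R\<^esub> p = J +>\<^bsub>R\<^esub> 0" using p by (subst coset_eq_iff) (auto simp: J_def)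
    then show "p \<in> pull N" using zero pV by (simp add: pull_def)
  qed
  have "N \<subseteq> (+>\<^bsub>R\<^esub>) J ` mono_set (exps V)" using N.subset by (simp add: quot_simps)
  then show "N = (+>\<^bsub>R\<^esub>) J ` pull N" by (auto simp: pull_def)
qed

lemma push_submodule:
  assumes T: "up_set V T" "S \<subseteq> T"
  shows "submodule ((+>\<^bsub>R\<^esub>) J ` mono_set T) R (quot_module R J)"
proof (intro submodule.intro subgroup.intro)
  have TV: "mono_set T \<subseteq> (mono_set (exps V) :: 'k mpoly set)"
    using T unfolding up_set_def by (intro mono_set_mono) auto
  let ?M = "quot_module R J"
  show "(+>\<^bsub>R\<^esub>) J ` mono_set T \<subseteq> carrier (add_monoid ?M)" using TV by (auto simp: quot_simps)
  show "\<one>\<^bsub>add_monoid ?M\<^esub> \<in> (+>\<^bsub>R\<^esub>) J ` mono_set T" by (auto simp: quot_simps)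
  show "x \<otimes>\<^bsub>add_monoid ?M\<^esub> y \<in> (+>\<^bsub>R\<^esub>) J ` mono_set T"
    if xy: "x \<in> (+>\<^bsub>R\<^esub>) J ` mono_set T" "y \<in> (+>\<^bsub>R\<^esub>) J ` mono_set T" for x y
  proof -
    obtain p q where "p \<in> mono_set T" "q \<in> mono_set T" "x = J +>\<^bsub>R\<^esub> p" "y = J +>\<^bsub>R\<^esub> q" using xy by blast
    then show ?thesis using TV mono_set_add[of p T q] by (auto simp: quot_simps subsetD)
  qed
  have grp: "group (add_monoid ?M)"
  proof -
    have "abelian_group (R Quot J)" using J.quotient_is_ring by (rule ring.is_abelian_group)
    then have "group (add_monoid (R Quot J))" by (rule abelian_group.a_group)
    then show ?thesis
      unfolding Group.group_def Group.monoid_def group_axioms_def Units_def by (simp add: quot_module_def)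
  qed
  show "inv\<^bsub>add_monoid ?M\<^esub> x \<in> (+>\<^bsub>R\<^esub>) J ` mono_set T" if x: "x \<in> (+>\<^bsub>R\<^esub>) J ` mono_set T" for x
  proof -
    obtain p where p: "p \<in> mono_set T" "x = J +>\<^bsub>R\<^esub> p" using x by blast
    have pV: "p \<in> mono_set (exps V)" "- p \<in> mono_set (exps V)" using p TV mono_set_uminus by blast+
    have "inv\<^bsub>add_monoid ?M\<^esub> x = J +>\<^bsub>R\<^esub> (- p)"
    proof (rule group.inv_equality[OF grp])
      show "(J +>\<^bsub>R\<^esub> (- p)) \<otimes>\<^bsub>add_monoid ?M\<^esub> x = \<one>\<^bsub>add_monoid ?M\<^esub>"
        using p(2) pV by (simp add: quot_simps)
      show "x \<in> carrier (add_monoid ?M)" "J +>\<^bsub>R\<^esub> (- p) \<in> carrier (add_monoid ?M)"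
        using p(2) pV by (auto simp: quot_simps)
    qed
    then show ?thesis using mono_set_uminus[OF p(1)] by auto
  qed
  show "submodule_axioms ((+>\<^bsub>R\<^esub>) J ` mono_set T) R ?M"
  proof
    fix a x assume a: "a \<in> carrier R" and "x \<in> (+>\<^bsub>R\<^esub>) J ` mono_set T"
    then obtain p where p: "p \<in> mono_set T" "x = J +>\<^bsub>R\<^esub> p" by blast
    then show "a \<odot>\<^bsub>?M\<^esub> x \<in> (+>\<^bsub>R\<^esub>) J ` mono_set T"
      using a up_mult(2)[OF T(1) p(1), of a] TV by (auto simp: quot_simps R_simps subsetD)
  qed
qed

lemma push_strict:
  assumes T: "up_set V T" "S \<subseteq> T" and T': "up_set V T'" "T \<subset> T'"
  shows "(+>\<^bsub>R\<^esub>) J ` mono_set T \<subset> (+>\<^bsub>R\<^esub>) J ` mono_set T'"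
proof
  show "(+>\<^bsub>R\<^esub>) J ` mono_set T \<subseteq> (+>\<^bsub>R\<^esub>) J ` mono_set T'" using T' by (intro image_mono mono_set_mono) auto
  obtain u where u: "u \<in> T'" "u \<notin> T" using T' by blast
  have "J +>\<^bsub>R\<^esub> single u 1 \<notin> (+>\<^bsub>R\<^esub>) J ` mono_set T"
  proof
    assume "J +>\<^bsub>R\<^esub> single u 1 \<in> (+>\<^bsub>R\<^esub>) J ` mono_set T"
    then obtain q where q: "q \<in> mono_set T" "J +>\<^bsub>R\<^esub> single u 1 = J +>\<^bsub>R\<^esub> q" by blast
    have "single u 1 \<in> mono_set (exps V)" using u(1) T'(1) by (intro single_mono_set) (auto simp: up_set_def)
    moreover have "q \<in> mono_set (exps V)" using q(1) T(1) mono_set_mono[of T "exps V"] by (auto simp: up_set_def)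
    ultimately have "single u 1 - q \<in> J" using q(2) coset_eq_iff by blast
    then have "single u 1 - q \<in> mono_set T" using mono_set_mono[OF T(2)] by (auto simp: J_def)
    then have "single u 1 - q + q \<in> mono_set T" using q(1) by (rule mono_set_add)
    then have "single u (1::'k) \<in> mono_set T" by simp
    then show False using u(2) by (simp add: single_in_mono_set_iff)
  qed
  then show "(+>\<^bsub>R\<^esub>) J ` mono_set T \<noteq> (+>\<^bsub>R\<^esub>) J ` mono_set T'" using single_mono_set[OF u(1)] by blast
qed

lemma submodule_chain_le:
  assumes "\<forall>i\<le>n. submodule (N i) R (quot_module R J)" "\<forall>i<n. N i \<subset> N (Suc i)"
  shows "n \<le> card (exps V - S)"
proof -
  have "i \<le> card (initials S (pull (N i)))" if "i \<le> n" for i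
    using that
  proof (induction i)
    case (Suc i)
    let ?A = "pull (N i)" and ?B = "pull (N (Suc i))"
    have A: "subspace_like V ?A" "mono_set S \<subseteq> ?A" "N i = (+>\<^bsub>R\<^esub>) J ` ?A"
      and B: "subspace_like V ?B" "N (Suc i) = (+>\<^bsub>R\<^esub>) J ` ?B"
      using pull_submodule assms(1) Suc.prems by auto
    have NN: "N i \<subset> N (Suc i)" using assms(2) Suc.prems by auto
    then have AB: "?A \<subseteq> ?B" unfolding pull_def by blast
    have "\<not> ?B \<subseteq> ?A"
    proof
      assume "?B \<subseteq> ?A"
      then have "(+>\<^bsub>R\<^esub>) J ` ?B \<subseteq> (+>\<^bsub>R\<^esub>) J ` ?A" by (rule image_mono)
      then have "N (Suc i) \<subseteq> N i" by (simp only: A(3)[symmetric] B(2)[symmetric])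
      then show False using NN by blast
    qed
    then have "\<not> initials S ?B \<subseteq> initials S ?A"
      using eq_of_initials_eq[OF A(1) B(1) AB A(2) fin] by blast
    then have "initials S ?A \<subset> initials S ?B" using initials_mono[OF AB, of S] by blast
    moreover have "initials S ?B \<subseteq> exps V - S" using B(1) by (intro initials_sub) (simp add: subspace_like_def)
    ultimately have "card (initials S ?A) < card (initials S ?B)"
      using fin by (intro psubset_card_mono) (auto intro: finite_subset)
    then show ?case using Suc by simp
  qed simp
  then have "n \<le> card (initials S (pull (N n)))" by simp
  also have "\<dots> \<le> card (exps V - S)"
    using pull_submodule(1)[of "N n"] assms(1) fin
    by (intro card_mono initials_sub) (auto simp: subspace_like_def)
  finally show ?thesis .
qed

lemma length_monomial_quotient_aux: "module_length R (quot_module R J) = enat (card (exps V - S))"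
  unfolding module_length_def
proof (rule antisym)
  let ?C = "{n. \<exists>N. (\<forall>i\<le>n. submodule (N i) R (quot_module R J)) \<and> (\<forall>i<n. N i \<subset> N (Suc i))}"
  show "(SUP n\<in>?C. enat n) \<le> enat (card (exps V - S))"
    by (rule SUP_least) (use submodule_chain_le in auto)
  obtain T where T: "T 0 = S" "\<forall>i\<le>card (exps V - S). up_set V (T i) \<and> S \<subseteq> T i"
    "\<forall>i<card (exps V - S). T i \<subset> T (Suc i)"
    using up_set_chain[OF up finV fin] by blast
  have "card (exps V - S) \<in> ?C"
  proof (intro CollectI exI[of _ "\<lambda>i. (+>\<^bsub>R\<^esub>) J ` mono_set (T i)"] conjI allI impI)
    fix i
    show "submodule ((+>\<^bsub>R\<^esub>) J ` mono_set (T i)) R (quot_module R J)" if "i \<le> card (exps V - S)"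
      using push_submodule[of "T i"] T(2) that by blast
    show "(+>\<^bsub>R\<^esub>) J ` mono_set (T i) \<subset> (+>\<^bsub>R\<^esub>) J ` mono_set (T (Suc i))" if i: "i < card (exps V - S)"
    proof (rule push_strict)
      show "up_set V (T i)" "S \<subseteq> T i" "up_set V (T (Suc i))" using T(2) i by (auto simp: Suc_le_eq)
      show "T i \<subset> T (Suc i)" using T(3) i by blast
    qed
  qed
  then show "enat (card (exps V - S)) \<le> (SUP n\<in>?C. enat n)" by (rule SUP_upper)
qed

end

lemma length_monomial_quotient:
  assumes "up_set V S" "finite V" "finite (exps V - S)"
  shows "module_length (mpoly_ring V :: 'k::field mpoly ring) (quot_module (mpoly_ring V) (mono_set S))
    = enat (card (exps V - S))"
  using length_monomial_quotient_aux[OF assms] .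

section \<open>Integral closures of powers of monomial ideals\<close>

lemma single_power: "(single u c :: 'k::field mpoly) ^ k = single (scale k u) (c ^ k)"
  by (induction k) (simp_all add: scale_Suc mult_single add.commute)

context exponent_ideal
begin

lemma power_exps_up_set: "up_set V (power_exps V E n)"
  using power_exps_sub power_exps_up by (auto simp: up_set_def)

lemma closure_exps_up_set: "up_set V (closure_exps V E n)"
  using closure_exps_sub closure_exps_up by (auto simp: up_set_def)

lemma power_exps_plus: "power_exps V E (m + n) = {u + v | u v. u \<in> power_exps V E m \<and> v \<in> power_exps V E n}"
proof
  show "{u + v | u v. u \<in> power_exps V E m \<and> v \<in> power_exps V E n} \<subseteq> power_exps V E (m + n)"
    using power_exps_add by blast
  have "\<exists>u\<in>power_exps V E m. \<exists>v\<in>power_exps V E n. x = u + v" if "x \<in> power_exps V E (m + n)" for x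
    using that
  proof (induction n arbitrary: x)
    case 0
    then show ?case by (intro bexI[of _ x] bexI[of _ 0]) auto
  next
    case (Suc n)
    then obtain w a where wa: "w \<in> power_exps V E (m + n)" "a \<in> E" "x = w + a" by auto
    then obtain u v where "u \<in> power_exps V E m" "v \<in> power_exps V E n" "w = u + v" using Suc.IH by blast
    then show ?case using wa power_exps_SucI[of v n a] by (metis add.assoc)
  qed
  then show "power_exps V E (m + n) \<subseteq> {u + v | u v. u \<in> power_exps V E m \<and> v \<in> power_exps V E n}" by blast
qed

lemma power_exps_power_exps: "power_exps V (power_exps V E n) i = power_exps V E (i * n)"
proof (induction i)
  case (Suc i)
  have "power_exps V (power_exps V E n) (Suc i) = power_exps V E (i * n + n)" unfolding power_exps_plus power_exps.simps(2) Suc ..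
  then show ?case by (simp only: mult_Suc add.commute)
qed simp

lemma mono_power_exps_mult: "p \<in> mono_set (power_exps V E m) \<Longrightarrow> q \<in> mono_set (power_exps V E n) \<Longrightarrow> p * q \<in> mono_set (power_exps V E (m + n))"
  by (rule mono_set_mult) (auto intro: power_exps_add)

lemma mono_power_exps_antimono: "m \<le> n \<Longrightarrow> mono_set (power_exps V E n) \<subseteq> mono_set (power_exps V E m)"
  by (rule mono_set_mono[OF power_exps_antimono])

lemma mono_power_exps_carrier: "mono_set (power_exps V E n) \<subseteq> mono_set (exps V)"
  by (rule mono_set_mono[OF power_exps_sub])

text \<open>Write each \<open>(k + c) u\<close> as a sum of \<open>n k\<close> generators plus a vector. By Dickson's lemma two of these
  representations, for \<open>i < j\<close>, are comparable in all multiplicities and coordinates; their difference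
  represents \<open>(j - i) u\<close> as a sum of \<open>n (j - i)\<close> generators plus a vector, so the constant loss \<open>c\<close>
  disappears.\<close>

lemma closure_exps_of_multiples:
  assumes "\<And>k. scale k u \<in> power_exps V E (n * (k - c))" and uV: "u \<in> exps V"
  shows "u \<in> closure_exps V E n"
proof -
  obtain Ag where Ag: "finite Ag" "Ag \<subseteq> E" "\<forall>u\<in>E. \<exists>w\<in>exps V. \<exists>a\<in>Ag. u = w + a"
    using finite_generators[OF E_sub] by blast
  have "\<exists>fv. snd fv \<in> exps V \<and> (\<Sum>a\<in>Ag. fst fv a) = n * k \<and> scale (k + c) u = snd fv + (\<Sum>a\<in>Ag. scale (fst fv a) a)" for k
  proof -
    have "scale (k + c) u \<in> power_exps V E (n * k)" using assms(1)[of "k + c"] by simp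
    then obtain f v where "v \<in> exps V" "(\<Sum>a\<in>Ag. f a) = n * k" "scale (k + c) u = v + (\<Sum>a\<in>Ag. scale (f a) a)"
      unfolding power_exps_iff[OF Ag] by blast
    then show ?thesis by (intro exI[of _ "(f, v)"]) simp
  qed
  then obtain fv where fv0: "\<forall>k. snd (fv k) \<in> exps V \<and> (\<Sum>a\<in>Ag. fst (fv k) a) = n * k
      \<and> scale (k + c) u = snd (fv k) + (\<Sum>a\<in>Ag. scale (fst (fv k) a) a)"
    using choice[where Q = "\<lambda>k fv. snd fv \<in> exps V \<and> (\<Sum>a\<in>Ag. fst fv a) = n * k \<and> scale (k + c) u = snd fv + (\<Sum>a\<in>Ag. scale (fst fv a) a)"]
    by blast
  define v where "v = (\<lambda>k. snd (fv k))"
  define f where "f = (\<lambda>k. fst (fv k))"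
  have fv: "v k \<in> exps V" "(\<Sum>a\<in>Ag. f k a) = n * k" "scale (k + c) u = v k + (\<Sum>a\<in>Ag. scale (f k a) a)" for k
    using fv0[THEN spec, of k] unfolding v_def f_def by blast+
  define s where "s = (\<lambda>k x. case x of Inl a \<Rightarrow> f k a | Inr i \<Rightarrow> lookup (v k) i)"
  have "finite (Inl ` Ag \<union> Inr ` V)" using Ag(1) finV by simp
  from dickson_sequence[OF this, of s] obtain g :: "nat \<Rightarrow> nat" where g: "strict_mono g"
    "\<forall>x\<in>Inl ` Ag \<union> Inr ` V. \<forall>i j. i \<le> j \<longrightarrow> s (g i) x \<le> s (g j) x"
    by (elim exE conjE)
  define i j where "i = g 0" and "j = g 1"
  have ij: "i < j" using g(1) by (simp add: i_def j_def strict_mono_def)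
  have f_le: "f i a \<le> f j a" if "a \<in> Ag" for a
  proof -
    have "s (g 0) (Inl a) \<le> s (g 1) (Inl a)" using g(2) that by blast
    then show ?thesis by (simp add: s_def i_def j_def)
  qed
  have v_le: "lookup (v i) x \<le> lookup (v j) x" if "x \<in> V" for x
  proof -
    have "s (g 0) (Inr x) \<le> s (g 1) (Inr x)" using g(2) that by blast
    then show ?thesis by (simp add: s_def i_def j_def)
  qed
  obtain w where w: "w \<in> exps V" "v j = w + v i"
    by (rule exps_diffE[OF fv(1)[of j] v_le fv(1)[of i]]) auto
  have fsum: "(\<Sum>a\<in>Ag. f j a) = (\<Sum>a\<in>Ag. f j a - f i a) + (\<Sum>a\<in>Ag. f i a)"
    using f_le by (simp flip: sum.distrib)
  have "scale (f j a) a = scale (f j a - f i a) a + scale (f i a) a" if "a \<in> Ag" for a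
    using f_le[OF that] by (simp flip: scale_add_left)
  then have ssum: "(\<Sum>a\<in>Ag. scale (f j a) a) = (\<Sum>a\<in>Ag. scale (f j a - f i a) a) + (\<Sum>a\<in>Ag. scale (f i a) a)"
    by (simp flip: sum.distrib)
  have "scale (j - i) u + scale (i + c) u = scale (j + c) u" using ij by (simp flip: scale_add_left)
  also have "\<dots> = w + (\<Sum>a\<in>Ag. scale (f j a - f i a) a) + scale (i + c) u"
    unfolding fv(3) w(2) ssum by (simp only: add_ac)
  finally have "scale (j - i) u = w + (\<Sum>a\<in>Ag. scale (f j a - f i a) a)" by simp
  moreover have "(\<Sum>a\<in>Ag. f j a - f i a) = (j - i) * n"
  proof -
    have "n * j = (\<Sum>a\<in>Ag. f j a - f i a) + n * i" using fsum unfolding fv(2) .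
    then have "(\<Sum>a\<in>Ag. f j a - f i a) = n * j - n * i" by linarith
    then show ?thesis by (simp add: diff_mult_distrib2[of n] mult.commute[of _ n])
  qed
  ultimately have "scale (j - i) u \<in> power_exps V E ((j - i) * n)"
    unfolding power_exps_iff[OF Ag] using w(1) by blast
  moreover have "1 \<le> j - i" using ij by simp
  ultimately show ?thesis using uV unfolding closure_exps_def by blast
qed

text \<open>The elements whose powers lie in the powers of \<open>I\<^sup>n\<close> up to a constant loss in the exponent. Every integral
  element is of this kind, and unlike integrality this property is visibly stable under sums.\<close>

definition almost_powers :: "nat \<Rightarrow> 'k::field mpoly set" where
  "almost_powers n = {r \<in> mono_set (exps V). \<exists>c. \<forall>k. r ^ k \<in> mono_set (power_exps V E (n * (k - c)))}"

lemma almost_powers_add: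
  assumes "r \<in> almost_powers n" "s \<in> almost_powers n"
  shows "r + s \<in> almost_powers n"
proof -
  obtain c where c: "\<And>k. r ^ k \<in> mono_set (power_exps V E (n * (k - c)))" and rV: "r \<in> mono_set (exps V)"
    using assms(1) by (auto simp: almost_powers_def)
  obtain d where d: "\<And>k. s ^ k \<in> mono_set (power_exps V E (n * (k - d)))" and sV: "s \<in> mono_set (exps V)"
    using assms(2) by (auto simp: almost_powers_def)
  have "(r + s) ^ k \<in> mono_set (power_exps V E (n * (k - (c + d))))" for k
    unfolding binomial_ring
  proof (rule mono_set_sum)
    fix j assume j: "j \<in> {..k}"
    have "r ^ j * s ^ (k - j) \<in> mono_set (power_exps V E (n * (j - c) + n * (k - j - d)))"
      using c d by (rule mono_power_exps_mult)
    moreover have "n * (k - (c + d)) \<le> n * (j - c) + n * (k - j - d)"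
    proof -
      have "k - (c + d) \<le> (j - c) + (k - j - d)" using j by auto
      then show ?thesis unfolding add_mult_distrib2[symmetric] by (rule mult_le_mono2)
    qed
    ultimately have "r ^ j * s ^ (k - j) \<in> mono_set (power_exps V E (n * (k - (c + d))))"
      using mono_power_exps_antimono by blast
    moreover have "of_nat (k choose j) \<in> (mono_set (exps V) :: 'a mpoly set)"
      by (simp only: single_of_nat[symmetric]) (rule single_mono_set, simp)
    ultimately show "of_nat (k choose j) * r ^ j * s ^ (k - j) \<in> mono_set (power_exps V E (n * (k - (c + d))))"
      unfolding mult.assoc by (rule up_mult(2)[OF power_exps_up_set])
  qed
  then show ?thesis using mono_set_add[OF rV sV] by (auto simp: almost_powers_def)
qed

text \<open>The loss is the number of generators, by \<open>closure_exps_sub_power_exps_shift\<close>.\<close>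

lemma monomial_almost_powers:
  assumes u: "u \<in> closure_exps V E n"
  shows "(single u c :: 'k::field mpoly) \<in> almost_powers n"
proof -
  obtain Ag where Ag: "finite Ag" "Ag \<subseteq> E" "\<forall>u\<in>E. \<exists>w\<in>exps V. \<exists>a\<in>Ag. u = w + a"
    using finite_generators[OF E_sub] by blast
  have scale_closure_exps: "scale k u \<in> closure_exps V E (n * k)" for k
  proof (induction k)
    case 0
    then show ?case using power_exps_sub_closure_exps[of 0] by auto
  next
    case (Suc k)
    then show ?case using closure_exps_add[OF Suc u] by (simp add: scale_Suc add.commute)
  qed
  have "scale k u \<in> power_exps V E (n * (k - card Ag))" for k
  proof (cases "n = 0 \<or> k \<le> card Ag")
    case True
    moreover have "scale k u \<in> exps V" using u closure_exps_sub by (intro exps_scale) blast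
    ultimately show ?thesis by auto
  next
    case False
    have "n * k - card Ag \<ge> n * (k - card Ag)" using False by (auto simp: diff_mult_distrib2 intro!: diff_le_mono2)
    moreover have "k \<le> n * k" using False by simp
    then have "card Ag \<le> n * k" using False by linarith
    then have "scale k u \<in> power_exps V E (n * k - card Ag)"
      using closure_exps_sub_power_exps_shift[OF Ag, of "n * k - card Ag"] scale_closure_exps[of k] by auto
    ultimately show ?thesis using power_exps_antimono by blast
  qed
  then have "single u c ^ k \<in> mono_set (power_exps V E (n * (k - card Ag)))" for k
    unfolding single_power by (rule single_mono_set)
  moreover have "single u c \<in> mono_set (exps V)" using u closure_exps_sub by (intro single_mono_set) auto
  ultimately show ?thesis by (auto simp: almost_powers_def)
qed

lemma lookup_power_lead:
  fixes r :: "'k::field mpoly"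
  assumes "\<And>w. w \<in> keys r \<Longrightarrow> w \<le> u"
  shows "lookup (r ^ k) (scale k u) = lookup r u ^ k \<and> (\<forall>w\<in>keys (r ^ k). w \<le> scale k u)"
proof (induction k)
  case 0
  then show ?case by (simp add: lookup_one)
next
  case (Suc k)
  have le: "\<And>w. w \<in> keys (r ^ k) \<Longrightarrow> w \<le> scale k u" using Suc by blast
  have "w \<le> scale (Suc k) u" if w: "w \<in> keys (r ^ Suc k)" for w
  proof -
    obtain a b where "a \<in> keys (r ^ k)" "b \<in> keys r" "w = a + b"
      using w keys_mult[of "r ^ k" r] unfolding power_Suc2 by blast
    then show ?thesis unfolding scale_Suc using le assms add_mono by blast
  qed
  moreover have "lookup (r ^ Suc k) (scale (Suc k) u) = lookup r u ^ Suc k"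
  proof -
    let ?p = "r ^ k"
    define p0 where "p0 = ?p - single (scale k u) (lookup ?p (scale k u))"
    define r0 where "r0 = r - single u (lookup r u)"
    have p0: "w < scale k u" if "w \<in> keys p0" for w
    proof -
      have "w \<noteq> scale k u" "w \<in> keys ?p"
        using that by (auto simp: p0_def in_keys_iff lookup_minus lookup_single when_def split: if_splits)
      then show ?thesis using le by (metis order_le_imp_less_or_eq)
    qed
    have "r ^ Suc k = single (scale k u) (lookup ?p (scale k u)) * single u (lookup r u) + (single (scale k u) (lookup ?p (scale k u)) * r0 + p0 * r)"
      unfolding power_Suc2 p0_def r0_def by (simp add: algebra_simps)
    moreover have "lookup (p0 * r) (scale (Suc k) u) = 0"
    proof (rule ccontr)
      assume "lookup (p0 * r) (scale (Suc k) u) \<noteq> 0"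
      then have "scale (Suc k) u \<in> keys (p0 * r)" by (simp add: in_keys_iff)
      then obtain a b where "a \<in> keys p0" "b \<in> keys r" "scale (Suc k) u = a + b"
        using keys_mult[of p0 r] by blast
      then show False unfolding scale_Suc using p0 assms by (metis add_less_le_mono order_less_irrefl)
    qed
    moreover have "lookup (single (scale k u) (lookup ?p (scale k u)) * r0) (scale (Suc k) u) = 0"
    proof (rule ccontr)
      assume "lookup (single (scale k u) (lookup ?p (scale k u)) * r0) (scale (Suc k) u) \<noteq> 0"
      then have "scale (Suc k) u \<in> keys (single (scale k u) (lookup ?p (scale k u)) * r0)" by (simp add: in_keys_iff)
      then obtain a b where ab: "a \<in> keys (single (scale k u) (lookup ?p (scale k u)))" "b \<in> keys r0" "scale (Suc k) u = a + b"
        using keys_mult by blast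
      then have "a = scale k u" by (auto split: if_splits)
      then have "b = u" using ab(3) by (simp add: scale_Suc)
      then show False using ab(2) by (simp add: r0_def in_keys_iff lookup_minus)
    qed
    ultimately show ?thesis using Suc by (simp add: lookup_add mult_single scale_Suc)
  qed
  ultimately show ?case by blast
qed

text \<open>The leading exponent \<open>u\<close> of \<open>r\<close> satisfies the hypothesis of \<open>closure_exps_of_multiples\<close>, because \<open>k u\<close> is
  an exponent of \<open>r\<^sup>k\<close>. Removing the leading term stays within the set, which allows induction on the
  number of terms.\<close>

lemma almost_powers_sub: "almost_powers n \<subseteq> (mono_set (closure_exps V E n) :: 'k::field mpoly set)"
proof
  fix r :: "'k mpoly" assume "r \<in> almost_powers n"
  then show "r \<in> mono_set (closure_exps V E n)"
  proof (induction "card (keys r)" arbitrary: r rule: less_induct)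
    case less
    show ?case
    proof (cases "r = 0")
      case False
      define u where "u = Max (keys r)"
      have u: "u \<in> keys r" "\<And>w. w \<in> keys r \<Longrightarrow> w \<le> u"
        unfolding u_def by (rule Max_in) (use False in auto)
      obtain c where c: "\<And>k. r ^ k \<in> mono_set (power_exps V E (n * (k - c)))" and rV: "r \<in> mono_set (exps V)"
        using less.prems by (auto simp: almost_powers_def)
      have "scale k u \<in> power_exps V E (n * (k - c))" for k
      proof -
        have "lookup (r ^ k) (scale k u) = lookup r u ^ k" using lookup_power_lead[where k = k, OF u(2)] by (rule conjunct1)
        moreover have "lookup r u \<noteq> 0" using u(1) by (simp only: in_keys_iff not_False_eq_True)
        ultimately have "lookup (r ^ k) (scale k u) \<noteq> 0" by simp
        then show ?thesis using c[of k] by (auto simp: mono_set_iff)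
      qed
      moreover have "u \<in> exps V" using u(1) rV by (auto simp: mono_set_def)
      ultimately have ucl: "u \<in> closure_exps V E n" by (rule closure_exps_of_multiples)
      define s where "s = r + single u (- lookup r u)"
      have "s \<in> almost_powers n" unfolding s_def
        using less.prems monomial_almost_powers[OF ucl] by (rule almost_powers_add)
      moreover have "keys s \<subset> keys r"
        using u(1) by (auto simp: s_def in_keys_iff lookup_add lookup_single when_def split: if_splits)
      then have "card (keys s) < card (keys r)" by (intro psubset_card_mono) auto
      ultimately have "s \<in> mono_set (closure_exps V E n)" using less.hyps by blast
      moreover have "single u (lookup r u) \<in> mono_set (closure_exps V E n)" using ucl by (rule single_mono_set)
      ultimately have "s + single u (lookup r u) \<in> mono_set (closure_exps V E n)" by (rule mono_set_add)
      moreover have "s + single u (lookup r u) = r" by (simp add: s_def add.assoc flip: single_add)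
      ultimately show ?thesis by simp
    qed simp
  qed
qed

lemma closure_exps_split_power_exps:
  assumes Ag: "finite Ag" "Ag \<subseteq> E" "\<forall>u\<in>E. \<exists>w\<in>exps V. \<exists>a\<in>Ag. u = w + a"
  shows "u \<in> closure_exps V E (n + card Ag) \<Longrightarrow> \<exists>a\<in>power_exps V E n. \<exists>w\<in>closure_exps V E (card Ag). u = a + w"
proof (induction n arbitrary: u)
  case 0
  then show ?case by (intro bexI[of _ 0] bexI[of _ u]) auto
next
  case (Suc n)
  obtain w a where wa: "w \<in> closure_exps V E (n + card Ag)" "a \<in> Ag" "u = w + a"
    using closure_exps_split[OF Ag, of "n + card Ag" u] Suc.prems by auto
  obtain b x where bx: "b \<in> power_exps V E n" "x \<in> closure_exps V E (card Ag)" "w = b + x" using Suc.IH[OF wa(1)] by blast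
  have "b + a \<in> power_exps V E (Suc n)" using bx wa Ag(2) by (intro power_exps_SucI) auto
  moreover have "u = (b + a) + x" using bx wa by (simp add: add_ac)
  ultimately show ?case using bx(2) by blast
qed

text \<open>A homogeneous polynomial expression of degree \<open>m\<close> in \<open>r\<close> over the Rees algebra of \<open>I\<^sup>n\<close>, with leading
  coefficient \<open>c\<close>. An equation of integral dependence is the case \<open>c = 1\<close>, \<open>x = 0\<close>.\<close>

definition int_expr :: "nat \<Rightarrow> 'k::field mpoly \<Rightarrow> nat \<Rightarrow> 'k mpoly \<Rightarrow> 'k mpoly \<Rightarrow> bool" where
  "int_expr n r m c x \<longleftrightarrow> (\<exists>a. a 0 = c \<and> (\<forall>i. a i \<in> mono_set (power_exps V E (i * n))) \<and> x = (\<Sum>i\<le>m. a i * r ^ (m - i)))"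

lemma int_expr_sum:
  assumes "finite P" "\<And>p. p \<in> P \<Longrightarrow> int_expr n r m (c p) (x p)"
  shows "int_expr n r m (sum c P) (sum x P)"
proof -
  have "\<forall>p\<in>P. \<exists>a. a 0 = c p \<and> (\<forall>i. a i \<in> mono_set (power_exps V E (i * n))) \<and> x p = (\<Sum>i\<le>m. a i * r ^ (m - i))"
    using assms(2) unfolding int_expr_def by blast
  from bchoice[OF this] obtain a where a: "\<And>p. p \<in> P \<Longrightarrow> a p 0 = c p"
    "\<And>p i. p \<in> P \<Longrightarrow> a p i \<in> mono_set (power_exps V E (i * n))"
    "\<And>p. p \<in> P \<Longrightarrow> x p = (\<Sum>i\<le>m. a p i * r ^ (m - i))" by blast
  have "sum x P = (\<Sum>p\<in>P. \<Sum>i\<le>m. a p i * r ^ (m - i))" using a(3) by simp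
  also have "\<dots> = (\<Sum>i\<le>m. (\<Sum>p\<in>P. a p i) * r ^ (m - i))"
    by (subst sum.swap) (simp add: sum_distrib_right)
  finally show ?thesis unfolding int_expr_def
    using a(1,2) by (intro exI[of _ "\<lambda>i. \<Sum>p\<in>P. a p i"]) (auto intro!: mono_set_sum)
qed

lemma int_expr_scale:
  assumes "int_expr n r m c x" "z \<in> mono_set (exps V)"
  shows "int_expr n r m (z * c) (z * x)"
proof -
  obtain a where a: "a 0 = c" "\<And>i. a i \<in> mono_set (power_exps V E (i * n))" "x = (\<Sum>i\<le>m. a i * r ^ (m - i))"
    using assms(1) unfolding int_expr_def by blast
  show ?thesis unfolding int_expr_def
    by (rule exI[of _ "\<lambda>i. z * a i"])
      (simp add: a up_mult(2)[OF power_exps_up_set a(2) assms(2)] sum_distrib_left mult.assoc)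
qed

lemma int_expr_mult:
  assumes "int_expr n r m c x" and z: "z \<in> mono_set (exps V)" and b: "b \<in> mono_set (power_exps V E n)"
  shows "int_expr n r (Suc m) (z * c) ((z * r + b) * x)"
proof -
  obtain a where a: "a 0 = c" "\<And>i. a i \<in> mono_set (power_exps V E (i * n))" "x = (\<Sum>i\<le>m. a i * r ^ (m - i))"
    using assms(1) unfolding int_expr_def by blast
  define a' where "a' = (\<lambda>i. (if i \<le> m then z * a i else 0) + (case i of 0 \<Rightarrow> 0 | Suc j \<Rightarrow> b * a j))"
  have mem: "a' i \<in> mono_set (power_exps V E (i * n))" for i
  proof -
    have "(case i of 0 \<Rightarrow> 0 | Suc j \<Rightarrow> b * a j) \<in> mono_set (power_exps V E (i * n))"
    proof (cases i)
      case (Suc j)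
      then show ?thesis using mono_power_exps_mult[OF b a(2)[of j]] by simp
    qed simp
    then show ?thesis unfolding a'_def using up_mult(2)[OF power_exps_up_set a(2) z] by (intro mono_set_add) auto
  qed
  have "(\<Sum>i\<le>Suc m. a' i * r ^ (Suc m - i)) = (\<Sum>i\<le>Suc m. (if i \<le> m then z * a i else 0) * r ^ (Suc m - i))
      + (\<Sum>i\<le>Suc m. (case i of 0 \<Rightarrow> 0 | Suc j \<Rightarrow> b * a j) * r ^ (Suc m - i))"
    unfolding a'_def by (simp only: distrib_right sum.distrib)
  also have "(\<Sum>i\<le>Suc m. (if i \<le> m then z * a i else 0) * r ^ (Suc m - i)) = (\<Sum>i\<le>m. z * r * (a i * r ^ (m - i)))"
    by (simp add: Suc_diff_le mult_ac)
  also have "(\<Sum>i\<le>Suc m. (case i of 0 \<Rightarrow> 0 | Suc j \<Rightarrow> b * a j) * r ^ (Suc m - i)) = (\<Sum>i\<le>m. b * (a i * r ^ (m - i)))"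
    by (subst sum.atMost_Suc_shift) (simp add: mult.assoc)
  finally have "(z * r + b) * x = (\<Sum>i\<le>Suc m. a' i * r ^ (Suc m - i))"
    unfolding a(3) by (simp add: sum_distrib_left distrib_right sum.distrib)
  then show ?thesis unfolding int_expr_def using mem a(1)
    by (intro exI[of _ a']) (auto simp: a'_def)
qed

lemma int_expr_prod:
  assumes "finite X" "\<And>i. i \<in> X \<Longrightarrow> z i \<in> mono_set (exps V)" "\<And>i. i \<in> X \<Longrightarrow> b i \<in> mono_set (power_exps V E n)"
  shows "int_expr n r (card X) (\<Prod>i\<in>X. z i) (\<Prod>i\<in>X. z i * r + b i)"
  using assms
proof (induction X)
  case empty
  show ?case unfolding int_expr_def
    by (rule exI[of _ "\<lambda>i. if i = 0 then 1 else 0"]) (simp add: one_carrier)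
next
  case (insert x X)
  then show ?case using int_expr_mult[of n r "card X" _ _ "z x" "b x"] by simp
qed

text \<open>The determinant trick: the matrix \<open>r 1 - M\<close> annihilates the nonzero vector \<open>w\<close>, so its determinant
  vanishes. In the Leibniz expansion every entry has the form \<open>z r + b\<close> with \<open>b\<close> in the ideal, and only the
  identity permutation contributes to the leading coefficient.\<close>

lemma integral_equation_of_matrix:
  fixes r :: "'k::field mpoly" and w :: "nat \<Rightarrow> 'k mpoly"
  assumes M: "\<And>i j. i < s \<Longrightarrow> j < s \<Longrightarrow> M i j \<in> mono_set (power_exps V E n)"
    and eq: "\<And>i. i < s \<Longrightarrow> r * w i = (\<Sum>j<s. M i j * w j)"
    and w: "l < s" "w l \<noteq> 0"
  shows "int_expr n r s 1 0"
proof -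
  \<comment> \<open>the coefficient of \<open>r\<close> in the entry in row \<open>i\<close> and column \<open>p i\<close>\<close>
  define z where "z = (\<lambda>(p::nat \<Rightarrow> nat) i. if i = p i then 1 else 0 :: 'k mpoly)"
  define A where "A = mat s s (\<lambda>(i, j). (if i = j then r else 0) - M i j)"
  define v where "v = vec s w"
  have A: "A \<in> carrier_mat s s" by (simp add: A_def)
  have "A *\<^sub>v v = 0\<^sub>v s"
  proof (rule eq_vecI)
    fix i assume "i < dim_vec (0\<^sub>v s)"
    then have i: "i < s" by simp
    have "(A *\<^sub>v v) $ i = (\<Sum>j = 0..<s. ((if i = j then r else 0) - M i j) * w j)"
      using i by (simp add: A_def v_def scalar_prod_def)
    also have "\<dots> = (\<Sum>j<s. (if i = j then r * w j else 0)) - (\<Sum>j<s. M i j * w j)"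
    proof -
      have "((if i = j then r else 0) - M i j) * w j = (if i = j then r * w j else 0) - M i j * w j" for j
        by (simp add: left_diff_distrib)
      then show ?thesis by (simp only: atLeast0LessThan sum_subtractf)
    qed
    also have "\<dots> = 0" using i eq[OF i] by simp
    finally show "(A *\<^sub>v v) $ i = 0\<^sub>v s $ i" using i by simp
  qed (simp add: A_def)
  moreover have "v \<noteq> 0\<^sub>v s"
  proof
    assume "v = 0\<^sub>v s"
    then have "v $ l = 0" using w(1) by simp
    then show False using w by (simp add: v_def)
  qed
  moreover have "v \<in> carrier_vec s" by (simp add: v_def)
  ultimately have "det A = 0" using det_0_iff_vec_prod_zero[OF A] by blast
  then have det0: "0 = (\<Sum>p\<in>{p. p permutes {0..<s}}. signof p * (\<Prod>i = 0..<s. A $$ (i, p i)))"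
    unfolding det_def'[OF A] by simp
  let ?P = "{p. p permutes {0..<s}}"
  have finP: "finite ?P" by (simp add: finite_permutations)
  have one: "int_expr n r s (signof p * (\<Prod>i = 0..<s. z p i)) (signof p * (\<Prod>i = 0..<s. A $$ (i, p i)))"
    if p: "p \<in> ?P" for p
  proof (rule int_expr_scale)
    have lt: "p i < s" if "i < s" for i using p that permutes_in_image[of p "{0..<s}" i] by auto
    have "int_expr n r (card {0..<s}) (\<Prod>i\<in>{0..<s}. z p i) (\<Prod>i\<in>{0..<s}. z p i * r + (- M i (p i)))"
    proof (rule int_expr_prod)
      show "z p i \<in> mono_set (exps V)" for i by (simp add: z_def one_carrier)
      show "- M i (p i) \<in> mono_set (power_exps V E n)" if "i \<in> {0..<s}" for i
        using that lt by (intro mono_set_uminus M) auto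
    qed simp
    moreover have "(\<Prod>i\<in>{0..<s}. z p i * r + (- M i (p i))) = (\<Prod>i = 0..<s. A $$ (i, p i))"
      using lt by (intro prod.cong refl) (auto simp: A_def z_def)
    ultimately show "int_expr n r s (\<Prod>i = 0..<s. z p i) (\<Prod>i = 0..<s. A $$ (i, p i))" by simp
    show "signof p \<in> (mono_set (exps V) :: 'k mpoly set)"
      using one_carrier[of V] mono_set_uminus[OF one_carrier, of V] by (auto simp: sign_def)
  qed
  have "int_expr n r s (\<Sum>p\<in>?P. signof p * (\<Prod>i = 0..<s. z p i)) 0"
    unfolding det0 by (rule int_expr_sum[OF finP one])
  moreover have "(\<Sum>p\<in>?P. signof p * (\<Prod>i = 0..<s. z p i)) = 1"
  proof -
    have "(\<Prod>i = 0..<s. z p i) = 0" if "p \<in> ?P - {id}" for p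
    proof -
      have "\<exists>i\<in>{0..<s}. i \<noteq> p i"
      proof (rule ccontr)
        assume "\<not> ?thesis"
        then have "p = id" using that permutes_not_in[of p "{0..<s}"] by (intro ext) (metis DiffD1 id_apply mem_Collect_eq)
        then show False using that by simp
      qed
      then show ?thesis by (intro prod_zero) (auto simp: z_def)
    qed
    then have "(\<Sum>p\<in>?P - {id}. signof p * (\<Prod>i = 0..<s. z p i)) = 0"
      by (intro sum.neutral) simp
    moreover have "id \<in> ?P" by (simp add: permutes_id)
    ultimately have "(\<Sum>p\<in>?P. signof p * (\<Prod>i = 0..<s. z p i)) = signof id * (\<Prod>i = 0..<s. z id i)"
      using sum.remove[OF finP, of id "\<lambda>p. signof p * (\<Prod>i = 0..<s. z p i)"] by simp
    then show ?thesis by (simp add: z_def)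
  qed
  ultimately show ?thesis by simp
qed

text \<open>Multiplication by \<open>r\<close> maps the monomial ideal \<open>N\<close> with exponent set \<open>closure_exps V E (card Ag)\<close> into
  \<open>I\<^sup>n N\<close>: this is where splitting off generators in \<open>closure_exps_split_power_exps\<close> is used. The finitely
  many monomial generators of \<open>N\<close> give the matrix for the determinant trick.\<close>

lemma closure_exps_integral_equation:
  fixes r :: "'k::field mpoly"
  assumes r: "r \<in> mono_set (closure_exps V E n)"
  shows "\<exists>s\<ge>1. int_expr n r s 1 0"
proof -
  obtain Ag where Ag: "finite Ag" "Ag \<subseteq> E" "\<forall>u\<in>E. \<exists>w\<in>exps V. \<exists>a\<in>Ag. u = w + a"
    using finite_generators[OF E_sub] by blast
  let ?T = "closure_exps V E (card Ag)"
  obtain B where B0: "B \<subseteq> ?T \<and> finite B \<and> (\<forall>u\<in>?T. \<exists>w\<in>exps V. \<exists>b\<in>B. u = w + b)"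
    using finite_generators[OF closure_exps_sub[of "card Ag"]] ..
  note B = B0[THEN conjunct1] B0[THEN conjunct2, THEN conjunct1] B0[THEN conjunct2, THEN conjunct2]
  have "?T \<noteq> {}"
  proof (cases "Ag = {}")
    case True
    then show ?thesis using subsetD[OF power_exps_sub_closure_exps, of 0 0] exps_zero[of V] by auto
  next
    case False
    then obtain a where "a \<in> E" using Ag(2) by blast
    then have "scale (card Ag) a \<in> power_exps V E (card Ag)" using power_exps_scale[of a 1 "card Ag"] unfolding power_exps_1 by simp
    then show ?thesis using power_exps_sub_closure_exps by blast
  qed
  then have "B \<noteq> {}" using B(3) by blast
  define s where "s = card B"
  have s: "s \<ge> 1" using \<open>B \<noteq> {}\<close> B(2) by (simp add: s_def Suc_le_eq card_gt_0_iff)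
  obtain w where w: "bij_betw w {0..<s} B" using ex_bij_betw_nat_finite[OF B(2)] unfolding s_def by blast
  have ex: "\<exists>a j. a \<in> power_exps V E n \<and> j < s \<and> u + w i = a + w j" if "u \<in> keys r" "i < s" for u i
  proof -
    have "u \<in> closure_exps V E n" using r that(1) by (auto simp: mono_set_def)
    moreover have "w i \<in> ?T" using B(1) w that(2) by (auto simp: bij_betw_def)
    ultimately have "u + w i \<in> closure_exps V E (n + card Ag)" by (rule closure_exps_add)
    then obtain a x where ax: "a \<in> power_exps V E n" "x \<in> ?T" "u + w i = a + x" using closure_exps_split_power_exps[OF Ag] by blast
    then obtain y b where yb: "y \<in> exps V" "b \<in> B" "x = y + b" using B(3) by blast
    then obtain j where "j < s" "b = w j" using w by (auto simp: bij_betw_def)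
    moreover have "u + w i = (a + y) + b" using ax(3) yb(3) by (simp add: add.assoc)
    ultimately show ?thesis using power_exps_up[OF ax(1) yb(1)] by blast
  qed
  have "\<forall>x\<in>keys r \<times> {..<s}. \<exists>y. fst y \<in> power_exps V E n \<and> snd y < s \<and> fst x + w (snd x) = fst y + w (snd y)"
  proof
    fix x assume x: "x \<in> keys r \<times> {..<s}"
    have "fst x \<in> keys r" "snd x < s" using x by auto
    from ex[OF this] obtain a j where "a \<in> power_exps V E n \<and> j < s \<and> fst x + w (snd x) = a + w j" by blast
    then show "\<exists>y. fst y \<in> power_exps V E n \<and> snd y < s \<and> fst x + w (snd x) = fst y + w (snd y)"
      by (intro exI[of _ "(a, j)"]) simp
  qed
  from bchoice[OF this] obtain h where h: "\<forall>x\<in>keys r \<times> {..<s}. fst (h x) \<in> power_exps V E n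
    \<and> snd (h x) < s \<and> fst x + w (snd x) = fst (h x) + w (snd (h x))" ..
  define \<alpha> where "\<alpha> = (\<lambda>u i. fst (h (u, i)))"
  define \<iota> where "\<iota> = (\<lambda>u i. snd (h (u, i)))"
  have ai: "\<alpha> u i \<in> power_exps V E n" "\<iota> u i < s" "u + w i = \<alpha> u i + w (\<iota> u i)"
    if "u \<in> keys r" "i < s" for u i
    using h[THEN bspec, of "(u, i)"] that unfolding \<alpha>_def \<iota>_def by simp_all
  define M where "M = (\<lambda>i j. \<Sum>u\<in>keys r. if \<iota> u i = j then single (\<alpha> u i) (lookup r u) else 0)"
  have "int_expr n r s 1 0"
  proof (rule integral_equation_of_matrix[where M = M and w = "\<lambda>i. single (w i) 1" and l = 0])
    show "M i j \<in> mono_set (power_exps V E n)" if "i < s" "j < s" for i j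
      unfolding M_def by (rule mono_set_sum) (use ai(1) that in \<open>auto intro: single_mono_set\<close>)
    show "0 < s" using s by simp
    show "single (w 0) (1::'k) \<noteq> 0" by (metis keys_single keys_zero insert_not_empty zero_neq_one)
    show "r * single (w i) 1 = (\<Sum>j<s. M i j * single (w j) 1)" if i: "i < s" for i
    proof -
      have "(\<Sum>j<s. M i j * single (w j) 1)
          = (\<Sum>u\<in>keys r. \<Sum>j<s. (if \<iota> u i = j then single (\<alpha> u i) (lookup r u) else 0) * single (w j) 1)"
        unfolding M_def sum_distrib_right by (rule sum.swap)
      also have "\<dots> = (\<Sum>u\<in>keys r. single u (lookup r u) * single (w i) 1)"
      proof (rule sum.cong[OF refl])
        fix u assume u: "u \<in> keys r"
        have "(\<Sum>j<s. (if \<iota> u i = j then single (\<alpha> u i) (lookup r u) else 0) * single (w j) 1)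
            = (\<Sum>j<s. if \<iota> u i = j then single (\<alpha> u i) (lookup r u) * single (w j) 1 else 0)"
          by (intro sum.cong refl) auto
        also have "\<dots> = single (\<alpha> u i) (lookup r u) * single (w (\<iota> u i)) 1" using ai(2)[OF u i] by simp
        also have "\<dots> = single u (lookup r u) * single (w i) 1" using ai(3)[OF u i] by (simp add: mult_single)
        finally show "(\<Sum>j<s. (if \<iota> u i = j then single (\<alpha> u i) (lookup r u) else 0) * single (w j) 1)
            = single u (lookup r u) * single (w i) 1" .
      qed
      also have "\<dots> = r * single (w i) 1" using monomial_expansion[of r] by (simp flip: sum_distrib_right)
      finally show ?thesis by simp
    qed
  qed
  then show ?thesis using s by blast
qed

text \<open>From an equation of degree \<open>m\<close>, every power \<open>r\<^sup>k\<close> with \<open>k \<ge> m\<close> is a combination of lower powers, so it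
  lies in the power of the ideal with exponent \<open>k - m\<close>; then \<open>almost_powers_sub\<close> applies. The other
  inclusion is the determinant trick.\<close>

theorem integral_closure_mono_set:
  "integral_closure (mpoly_ring V) (ideal_power (mpoly_ring V) (mono_set E) n) = (mono_set (closure_exps V E n) :: 'k::field mpoly set)"
proof -
  let ?R = "mpoly_ring V :: 'k mpoly ring"
  have pow: "ideal_power ?R (ideal_power ?R (mono_set E) n) i = mono_set (power_exps V E (i * n))" for i
    by (simp only: ideal_power_mono_set power_exps_power_exps)
  have expr: "r [^]\<^bsub>?R\<^esub> m \<oplus>\<^bsub>?R\<^esub> (\<Oplus>\<^bsub>?R\<^esub>i\<in>{1..m}. a i \<otimes>\<^bsub>?R\<^esub> r [^]\<^bsub>?R\<^esub> (m - i)) = r ^ m + (\<Sum>i\<in>{1..m}. a i * r ^ (m - i))"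
    if "r \<in> mono_set (exps V)" "\<forall>i\<in>{1..m}. a i \<in> mono_set (power_exps V E (i * n))" for r a m
  proof -
    have "a i * r ^ (m - i) \<in> mono_set (exps V)" if "i \<in> {1..m}" for i
    proof (rule carrier_mult)
      show "a i \<in> mono_set (exps V)"
        using \<open>\<forall>i\<in>{1..m}. a i \<in> _\<close> that by (intro subsetD[OF mono_power_exps_carrier]) blast
      show "r ^ (m - i) \<in> mono_set (exps V)" by (rule carrier_power[OF \<open>r \<in> _\<close>])
    qed
    then have "(\<Oplus>\<^bsub>?R\<^esub>i\<in>{1..m}. a i * r ^ (m - i)) = (\<Sum>i\<in>{1..m}. a i * r ^ (m - i))"
      by (intro mpoly_finsum) auto
    then show ?thesis by (simp only: mpoly_pow mpoly_ring_simps)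
  qed
  show ?thesis
  proof
    show "integral_closure ?R (ideal_power ?R (mono_set E) n) \<subseteq> mono_set (closure_exps V E n)"
    proof
      fix r assume "r \<in> integral_closure ?R (ideal_power ?R (mono_set E) n)"
      then obtain m a where rV: "r \<in> mono_set (exps V)" and m: "m \<ge> 1"
        and a: "\<forall>i\<in>{1..m}. a i \<in> mono_set (power_exps V E (i * n))"
        and e: "r [^]\<^bsub>?R\<^esub> m \<oplus>\<^bsub>?R\<^esub> (\<Oplus>\<^bsub>?R\<^esub>i\<in>{1..m}. a i \<otimes>\<^bsub>?R\<^esub> r [^]\<^bsub>?R\<^esub> (m - i)) = \<zero>\<^bsub>?R\<^esub>"
        unfolding integral_closure_def pow by auto
      have eq: "r ^ m = - (\<Sum>i\<in>{1..m}. a i * r ^ (m - i))"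
        using e unfolding expr[OF rV a] by (simp add: eq_neg_iff_add_eq_0)
      have "r ^ k \<in> mono_set (power_exps V E (n * (k - m)))" for k
      proof (induction k rule: less_induct)
        case (less k)
        show ?case
        proof (cases "k < m")
          case True
          then show ?thesis using carrier_power[OF rV] by simp
        next
          case False
          have "r ^ k = r ^ (k - m) * r ^ m" using False by (simp flip: power_add)
          also have "\<dots> = - (\<Sum>i\<in>{1..m}. a i * r ^ (k - i))"
          proof -
            have "r ^ (k - m) * (a i * r ^ (m - i)) = a i * r ^ (k - i)" if "i \<in> {1..m}" for i
            proof -
              have "k - i = (k - m) + (m - i)" using False that by auto
              then show ?thesis by (simp add: power_add)
            qed
            then have "(\<Sum>i\<in>{1..m}. r ^ (k - m) * (a i * r ^ (m - i))) = (\<Sum>i\<in>{1..m}. a i * r ^ (k - i))"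
              by (intro sum.cong refl)
            then show ?thesis unfolding eq by (simp only: mult_minus_right sum_distrib_left)
          qed
          also have "\<dots> \<in> mono_set (power_exps V E (n * (k - m)))"
          proof (intro mono_set_uminus mono_set_sum)
            fix i assume i: "i \<in> {1..m}"
            have "a i * r ^ (k - i) \<in> mono_set (power_exps V E (i * n + n * (k - i - m)))"
              using a i less[of "k - i"] False by (intro mono_power_exps_mult) auto
            moreover have "n * (k - m) \<le> i * n + n * (k - i - m)"
            proof -
              have "n * (k - m) \<le> n * (i + (k - i - m))" by (intro mult_le_mono2) simp
              then show ?thesis by (simp add: add_mult_distrib2 mult.commute)
            qed
            ultimately show "a i * r ^ (k - i) \<in> mono_set (power_exps V E (n * (k - m)))" using mono_power_exps_antimono by blast
          qed
          finally show ?thesis .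
        qed
      qed
      then have "r \<in> almost_powers n" using rV by (auto simp: almost_powers_def)
      then show "r \<in> mono_set (closure_exps V E n)" using almost_powers_sub by blast
    qed
    show "mono_set (closure_exps V E n) \<subseteq> integral_closure ?R (ideal_power ?R (mono_set E) n)"
    proof
      fix r :: "'k mpoly" assume r: "r \<in> mono_set (closure_exps V E n)"
      then have rV: "r \<in> mono_set (exps V)" using mono_set_mono[OF closure_exps_sub] by blast
      obtain s a where s: "s \<ge> 1" and a: "a 0 = 1" "\<And>i. a i \<in> mono_set (power_exps V E (i * n))"
        "0 = (\<Sum>i\<le>s. a i * r ^ (s - i))"
        using closure_exps_integral_equation[OF r] unfolding int_expr_def by blast
      have "(\<Sum>i\<le>s. a i * r ^ (s - i)) = r ^ s + (\<Sum>i\<in>{1..s}. a i * r ^ (s - i))"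
      proof -
        have "{..s} = insert 0 {1..s}" by auto
        then have "(\<Sum>i\<le>s. a i * r ^ (s - i)) = (\<Sum>i\<in>insert 0 {1..s}. a i * r ^ (s - i))" by (simp only:)
        then show ?thesis using a(1) by simp
      qed
      then have "r [^]\<^bsub>?R\<^esub> s \<oplus>\<^bsub>?R\<^esub> (\<Oplus>\<^bsub>?R\<^esub>i\<in>{1..s}. a i \<otimes>\<^bsub>?R\<^esub> r [^]\<^bsub>?R\<^esub> (s - i)) = \<zero>\<^bsub>?R\<^esub>"
        using a(3) expr[OF rV, of s a] a(2) by simp
      then show "r \<in> integral_closure ?R (ideal_power ?R (mono_set E) n)"
        unfolding integral_closure_def pow using rV s a(2) by auto
    qed
  qed
qed

end

section \<open>The inequality for the second coefficient\<close>

lemma staircase_closure_exps: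
  assumes "zero_dim_exponent_ideal V E K" "l \<in> V"
  shows "staircase V l (closure_exps V E n) (K * n)"
proof -
  interpret zero_dim_exponent_ideal V E K by fact
  show ?thesis
    by unfold_locales (use finV assms(2) closure_exps_sub closure_exps_up not_closure_exps_box in auto)
qed

lemma zero_dim_face:
  assumes "zero_dim_exponent_ideal V E K"
  shows "zero_dim_exponent_ideal (V - {i}) (E \<inter> exps (V - {i})) K"
proof -
  interpret zero_dim_exponent_ideal V E K by fact
  show ?thesis
  proof unfold_locales
    show "finite (V - {i})" using finV by simp
    show "a + b \<in> E \<inter> exps (V - {i})" if "a \<in> E \<inter> exps (V - {i})" "b \<in> exps (V - {i})" for a b
      using that E_up exps_mono[of "V - {i}" V] exps_add by blast
    show "single j K \<in> E \<inter> exps (V - {i})" if "j \<in> V - {i}" for j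
      using that K by (auto simp: exps_iff lookup_single when_def)
  qed (use zero_notin in auto)
qed

text \<open>The reflected count of the staircase of closures has the doubling property because sums of exponents
  of closures are exponents of closures. Restricting to \<open>x\<^sub>i = 0\<close> commutes with taking powers, and the
  shift \<open>r\<close> is the number of generators, the price of replacing closures by ordinary powers.\<close>

theorem multiplicities_of_faces_le:
  assumes zd: "zero_dim_exponent_ideal V E K" and l: "l \<in> V" and D: "card (V - {l}) = D" "D \<ge> 1"
    and p: "\<forall>\<^sub>F n in sequentially. real (card (exps V - closure_exps V E n)) = poly p (real n)"
    and q: "\<And>i. i \<in> V - {l} \<Longrightarrow> \<forall>\<^sub>F n in sequentially.
      real (card (exps (V - {i}) - power_exps (V - {i}) (E \<inter> exps (V - {i})) n)) = poly (q i) (real n)"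
  shows "(\<Sum>i\<in>V - {l}. coeff (q i) D) \<le> 2 * coeff p D"
proof -
  interpret zero_dim_exponent_ideal V E K by (rule zd)
  have st: "staircase V l (closure_exps V E n) (K * n)" for n by (rule staircase_closure_exps[OF zd l])
  have cardV: "card V = Suc D" using staircase.card_V[OF st] D by simp
  obtain Ag where Ag: "finite Ag" "Ag \<subseteq> E" "\<forall>u\<in>E. \<exists>w\<in>exps V. \<exists>a\<in>Ag. u = w + a"
    using finite_generators[OF E_sub] by blast
  show ?thesis
  proof (rule second_coeff_of_doubling[where F = "\<lambda>n. real (refl_count V l (closure_exps V E n))"
        and f = "\<lambda>n. real (card (exps V - closure_exps V E n))" and r = "card Ag" and a = "2 ^ D"
        and g = "\<lambda>i n. real (card (exps (V - {i}) - power_exps (V - {i}) (E \<inter> exps (V - {i})) n))"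
        and gb = "\<lambda>i n. real (card (exps (V - {i}) - closure_exps V E n))"
        and C = "2 ^ D * real D ^ 3 * real K ^ (D - 1)" and C' = "2 ^ D * real D * real K ^ D"])
    show "D \<ge> 1" by fact
    show "finite (V - {l})" using finV by simp
    show "\<forall>\<^sub>F n in sequentially. real (card (exps V - closure_exps V E n)) = poly p (real n)" by fact
    show "degree p \<le> Suc D" using colength_poly_degree[OF p not_closure_exps_box] cardV by simp
    show "degree (q i) \<le> D" if "i \<in> V - {l}" for i
    proof -
      interpret W: zero_dim_exponent_ideal "V - {i}" "E \<inter> exps (V - {i})" K by (rule zero_dim_face[OF zd])
      have "card (V - {i}) = D" using that cardV finV by simp
      then show ?thesis using W.colength_poly_degree[OF q[OF that] W.not_power_exps_box] by simp
    qed
    show "\<forall>\<^sub>F n in sequentially. \<forall>i\<in>V - {l}.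
        real (card (exps (V - {i}) - power_exps (V - {i}) (E \<inter> exps (V - {i})) n)) = poly (q i) (real n)"
      using q finV by (intro eventually_ball_finite) auto
    show "real (card (exps (V - {i}) - power_exps (V - {i}) (E \<inter> exps (V - {i})) n))
        \<le> real (card (exps (V - {i}) - closure_exps V E (n + card Ag)))" if "i \<in> V - {l}" for i n
    proof -
      have "power_exps (V - {i}) (E \<inter> exps (V - {i})) n = power_exps V E n \<inter> exps (V - {i})"
        by (rule power_exps_face[OF E_sub]) auto
      then have "exps (V - {i}) - power_exps (V - {i}) (E \<inter> exps (V - {i})) n \<subseteq> exps (V - {i}) - closure_exps V E (n + card Ag)"
        using closure_exps_sub_power_exps_shift[OF Ag, of n] by blast
      moreover have "finite (exps (V - {i}) - closure_exps V E (n + card Ag))"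
        by (rule finite_subset[OF _ finite_not_closure_exps[of "n + card Ag"]]) (use exps_mono[of "V - {i}" V] in auto)
      ultimately show ?thesis by (simp add: card_mono)
    qed
    show "2 * real (refl_count V l (closure_exps V E n)) \<le> 2 * 2 ^ D * real (card (exps V - closure_exps V E n))
        - 2 ^ D * (\<Sum>i\<in>V - {l}. real (card (exps (V - {i}) - closure_exps V E n)))
        + 2 ^ D * real D ^ 3 * real K ^ (D - 1) * real n ^ (D - 1)" for n
      using staircase.refl_count_upper[OF st[of n]] unfolding D by (simp add: power_mult_distrib mult.assoc)
    show "2 ^ D * real (card (exps V - closure_exps V E n)) - 2 ^ D * real D * real K ^ D * real n ^ D
        \<le> real (refl_count V l (closure_exps V E n))" for n
      using staircase.refl_count_lower[OF st[of n]] unfolding D by (simp add: power_mult_distrib mult.assoc)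
    show "real (refl_count V l (closure_exps V E (2 * n))) \<le> 2 ^ Suc D * real (refl_count V l (closure_exps V E n))" for n
    proof -
      have "u + v \<in> closure_exps V E (2 * n)" if "u \<in> closure_exps V E n" "v \<in> closure_exps V E n" for u v
        using closure_exps_add[OF that] by (simp add: mult_2)
      then have "refl_count V l (closure_exps V E (2 * n)) \<le> 2 ^ card V * refl_count V l (closure_exps V E n)"
        by (rule refl_count_double[OF st st])
      then have "real (refl_count V l (closure_exps V E (2 * n))) \<le> real (2 ^ card V * refl_count V l (closure_exps V E n))"
        by (simp only: of_nat_le_iff)
      then show ?thesis unfolding cardV by simp
    qed
  qed simp
qed

theorem corollary3p17:
  fixes d :: nat and R :: "'k::field mpoly ring" and I :: "'k mpoly set" and e :: "nat \<Rightarrow> real"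
  assumes "d \<ge> 2"
    and "R = mpoly_ring {1..d}"
    and "ideal I R" and "monomial_ideal {1..d} I" and "krull_dim (R Quot I) = 0"
    and "e = hilbert_coeff d
           (\<lambda>n. module_length R (quot_module R (integral_closure R (ideal_power R I n))))"
  shows "e 0 * (real d - 1) - 2 * e 1 \<ge>
           (\<Sum>i=1..d-1. ideal_multiplicity (d - 1) (mpoly_ring ({1..d} - {i})) (subst_zero i ` I))
       \<and> (\<Sum>i=1..d-1. ideal_multiplicity (d - 1) (mpoly_ring ({1..d} - {i})) (subst_zero i ` I))
           \<ge> real d - 1"
proof -
  let ?V = "{1..d}"
  obtain E where E: "up_set ?V E" "I = mono_set E"
    by (rule monomial_ideal_exponents[OF assms(4)])
  have dim: "krull_dim ((mpoly_ring ?V :: 'k mpoly ring) Quot mono_set E) = 0"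
    using assms(5) unfolding assms(2) E(2) .
  obtain K where K: "\<forall>i\<in>?V. single i K \<in> E" using zero_dim_exponents(2)[OF E(1) _ dim] by auto
  have zd: "zero_dim_exponent_ideal ?V E K"
    by unfold_locales (use E(1) K zero_dim_exponents(1)[OF E(1) _ dim] in \<open>auto simp: up_set_def\<close>)
  interpret zero_dim_exponent_ideal ?V E K by (rule zd)
  define D where "D = d - 1"
  have d: "d = Suc D" "D \<ge> 1" using assms(1) by (auto simp: D_def)
  have V': "?V - {d} = {1..d-1}" "card (?V - {d}) = D" using d by auto
  obtain p where p: "\<forall>\<^sub>F n in sequentially. real (card (exps ?V - closure_exps ?V E n)) = poly p (real n)"
    using eventually_poly_closure_exps by blast
  have len: "module_length R (quot_module R (integral_closure R (ideal_power R I n))) = enat (card (exps ?V - closure_exps ?V E n))" for n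
    unfolding assms(2) E(2) integral_closure_mono_set
    by (rule length_monomial_quotient[OF closure_exps_up_set finV finite_not_closure_exps])
  have ep: "eventual_poly (\<lambda>n. module_length R (quot_module R (integral_closure R (ideal_power R I n)))) = p"
    unfolding len by (rule eventual_poly_eqI[OF p])
  have "degree p \<le> Suc D" using colength_poly_degree[OF p not_closure_exps_box] d by simp
  then have e01: "e 0 * real D - 2 * e 1 = 2 * fact D * coeff p D"
    using hilbert_coeff_e0_e1[OF _ ep] unfolding assms(6) d(1) by blast
  have face: "zero_dim_exponent_ideal (?V - {i}) (E \<inter> exps (?V - {i})) K" for i
    by (rule zero_dim_face[OF zd])
  have "\<exists>q. \<forall>\<^sub>F n in sequentially.
      real (card (exps (?V - {i}) - power_exps (?V - {i}) (E \<inter> exps (?V - {i})) n)) = poly q (real n)" for i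
    by (rule zero_dim_exponent_ideal.eventually_poly_power_exps[OF face])
  then obtain q where q: "\<And>i. \<forall>\<^sub>F n in sequentially.
      real (card (exps (?V - {i}) - power_exps (?V - {i}) (E \<inter> exps (?V - {i})) n)) = poly (q i) (real n)" by metis
  have mult: "ideal_multiplicity (d - 1) (mpoly_ring (?V - {i})) (subst_zero i ` I) = fact D * coeff (q i) D" for i
  proof -
    interpret W: zero_dim_exponent_ideal "?V - {i}" "E \<inter> exps (?V - {i})" K by (rule face)
    have "module_length (mpoly_ring (?V - {i})) (quot_module (mpoly_ring (?V - {i}))
        (ideal_power (mpoly_ring (?V - {i})) (subst_zero i ` I) n))
      = enat (card (exps (?V - {i}) - power_exps (?V - {i}) (E \<inter> exps (?V - {i})) n))" for n
      unfolding E(2) subst_zero_image[OF E_sub] ideal_power_mono_set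
      by (rule length_monomial_quotient[OF W.power_exps_up_set W.finV W.finite_not_power_exps])
    then show ?thesis unfolding ideal_multiplicity_def using eventual_poly_eqI[OF q[of i]] by (simp add: D_def)
  qed
  \<comment> \<open>The last variable is the direction of the columns, so the sum runs over the other variables.\<close>
  have "(\<Sum>i\<in>?V - {d}. coeff (q i) D) \<le> 2 * coeff p D"
    by (rule multiplicities_of_faces_le[OF zd _ V'(2) d(2) p q]) (use d in auto)
  then have "fact D * (\<Sum>i\<in>?V - {d}. coeff (q i) D) \<le> fact D * (2 * coeff p D)" by (rule mult_left_mono) simp
  then have first: "(\<Sum>i=1..d-1. fact D * coeff (q i) D) \<le> e 0 * real D - 2 * e 1"
    unfolding e01 V'(1) by (simp add: sum_distrib_left mult_ac)
  have "fact D * coeff (q i) D \<ge> 1" if "i \<in> {1..d-1}" for i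
  proof -
    interpret W: zero_dim_exponent_ideal "?V - {i}" "E \<inter> exps (?V - {i})" K by (rule face)
    have "card (?V - {i}) = D" using that d by simp
    then show ?thesis using W.multiplicity_ge_1[OF q] by simp
  qed
  then have "(\<Sum>i=1..d-1. (1::real)) \<le> (\<Sum>i=1..d-1. fact D * coeff (q i) D)" by (rule sum_mono)
  then have second: "real d - 1 \<le> (\<Sum>i=1..d-1. fact D * coeff (q i) D)" using d by simp
  show ?thesis unfolding mult using first second d by simp
qed

end
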